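(* Let $E$ be an lcHs over $\mathbb{K}$, let $(T^{E}_{m},T^{\mathbb{K}}_{m})_{m\in M}$ be a strong and consistent generator for $(\mathcal{FV},E)$ and suppose $\mathcal{FV}(\Omega,E)\subset\mathcal{FV}(\Omega,E)_{\kappa}$. Suppose that one of the following conditions is fulfilled: a) $E$ is complete. b) $E$ is quasi-complete and for every $f\in\mathcal{FV}(\Omega,E)$ and $f'\in\mathcal{FV}(\Omega)'$ there is a bounded net $(f'_\tau)_{\tau\in\mathcal{T}}$ in $\mathcal{FV}(\Omega)'$ (bounded in $\mathcal{FV}(\Omega)'_\kappa$) converging to $f'$ in $\mathcal{FV}(\Omega)'_\kappa$ such that $R_f^t(f'_\tau)\in\mathcal{J}(E)$ for every $\tau\in\mathcal{T}$. c) $E$ is sequentially complete and for every $f\in\mathcal{FV}(\Omega,E)$ and $f'\in\mathcal{FV}(\Omega)'$ there is a sequence $(f'_n)_{n\in\mathbb{N}}$ in $\mathcal{FV}(\Omega)'$ converging to $f'$ in $\mathcal{FV}(\Omega)'_\kappa$ such that $R_f^t(f'_n)\in\mathcal{J}(E)$ for every $n\in\mathbb{N}$. d) $E$ is locally complete and for every $f\in\mathcal{FV}(\Omega,E)$ and $f'\in\mathcal{FV}(\Omega)'$ there is a sequence $(f'_n)_{n\in\mathbb{N}}$ in $\mathcal{FV}(\Omega)'$ locally converging to $f'$ in $\mathcal{FV}(\Omega)'_\kappa$ such that $R_f^t(f'_n)\in\mathcal{J}(E)$ for every $n\in\mathbb{N}$. e) For every $f\in\mathcal{FV}(\Omega,E)$,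 $j\in J$, $m\in M$ there is an absolutely convex $\sigma(E,E')$-compact set $K\subset E$ with $N_{j,m}(f)\subset K$. Then the map $S\colon\mathcal{FV}(\Omega)\varepsilon E\to\mathcal{FV}(\Omega,E)$, $u\mapsto[x\mapsto u(\delta_x)]$, is an isomorphism, i.e. $\mathcal{FV}(\Omega)$ and $\mathcal{FV}(\Omega,E)$ are $\varepsilon$-compatible, and the inverse of $S$ is given by \[ R^{t}\colon\mathcal{FV}(\Omega,E)\to\mathcal{FV}(\Omega)\varepsilon E,\; f\mapsto\mathcal{J}^{-1}\circ R_f^{t}. \]
   Context: $\mathbb{K}=\mathbb{R}$ or $\mathbb{C}$. An lcHs is a non-trivial locally convex Hausdorff space over $\mathbb{K}$; the topology of $E$ is given by a directed system of seminorms $(p_{\alpha})_{\alpha\in\mathfrak{A}}$ (for $E=\mathbb{K}$ it is $\{|\cdot|\}$). For an lcHs $F$, $F'_{\kappa}$ is $F'$ with the topology of uniform convergence on absolutely convex compact subsets of $F$, and $F\varepsilon E:=L_{e}(F'_{\kappa},E)$ carries the topology of uniform convergence on equicontinuous subsets of $F'$. "Isomorphism" means linear topological isomorphism. $\delta_x(f):=f(x)$. $\mathcal{F}(\Omega)$ and $\mathcal{F}(\Omega,E)$ are $\varepsilon$-compatible if $S\colon\mathcal{F}(\Omega)\varepsilon E\to\mathcal{F}(\Omega,E)$, $u\mapsto[x\mapsto u(\delta_x)]$, is a well-defined isomorphism. A disk is a bounded absolutely convex set $D$; $E_D:=\bigcup_{n}nD$ is normed by the gauge of $D$. $E$ is locally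 complete if $E_D$ is a Banach space for every closed disk $D\subset E$. A sequence converges locally to $x$ in an lcHs $X$ if it converges to $x$ in $X_D$ for some disk $D\subset X$. Weighted spaces: Let $\Omega$, $J$, $M$ be non-empty sets, $(\omega_m)_{m\in M}$ non-empty sets, and $\mathcal{V}=(\nu_{j,m})_{j\in J,m\in M}$ weight functions, i.e. $\nu_{j,m}\colon\omega_m\to[0,\infty)$ and for all $m\in M$, $x\in\omega_m$ there is $j\in J$ with $\nu_{j,m}(x)>0$. For $Y\in\{\mathbb{K},E\}$ let $T^{Y}_m\colon Y^{\Omega}\supset\operatorname{dom}T^{Y}_m\to Y^{\omega_m}$ be linear, $\operatorname{AP}(\Omega,Y)$ a linear subspace of $Y^{\Omega}$, $F(\Omega,Y):=\operatorname{AP}(\Omega,Y)\cap\bigcap_{m}\operatorname{dom}T^{Y}_m$ and \[ \mathcal{FV}(\Omega,Y):=\{f\in F(\Omega,Y)\;|\;\forall j,m,\alpha:\ |f|_{j,m,\alpha}:=\sup_{x\in\omega_m}p_\alpha(T^{Y}_m(f)(x))\nu_{j,m}(x)<\infty\} \] with these seminorms; $F(\Omega):=F(\Omega,\mathbb{K})$, $\mathcal{FV}(\Omega):=\mathcal{FV}(\Omega,\mathbb{K})$. It is a dom-space if it is Hausdorff, the system of seminorms is directed and, if $Y=\mathbb{K}$, all $\delta_x$, $x\in\Omega$, are continuous. $T^{\mathbb{K}}_{m,x}(f):=T^{\mathbb{K}}_m(f)(x)$ (an element of $\mathcal{FV}(\Omega)'$). $N_{j,m}(f):=\{T^{E}_m(f)(x)\nu_{j,m}(x)\;|\;x\in\omega_m\}$.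 $(T^{E}_m,T^{\mathbb{K}}_m)_{m\in M}$ is a generator for $(\mathcal{FV},E)$ if $\mathcal{FV}(\Omega)$ and $\mathcal{FV}(\Omega,E)$ (built with the same $M,J,\omega_m,\mathcal{V}$) are dom-spaces. It is consistent if for all $u\in\mathcal{FV}(\Omega)\varepsilon E$: $S(u)\in F(\Omega,E)$ and $(T^{E}_mS(u))(x)=u(T^{\mathbb{K}}_{m,x})$ for all $m\in M,x\in\omega_m$. It is strong if for all $e'\in E'$, $f\in\mathcal{FV}(\Omega,E)$: $e'\circ f\in F(\Omega)$ and $T^{\mathbb{K}}_m(e'\circ f)(x)=e'(T^{E}_m(f)(x))$ for all $m\in M$, $x\in\omega_m$. $\mathcal{FV}(\Omega,E)_{\sigma}:=\{f\colon\Omega\to E\;|\;\forall e'\in E':\ e'\circ f\in\mathcal{FV}(\Omega)\}$. For such $f$, $R_f\colon E'\to\mathcal{FV}(\Omega)$, $R_f(e'):=e'\circ f$, and $R_f^{t}\colon\mathcal{FV}(\Omega)'\to E'^{\star}$, $R_f^{t}(f')(e'):=f'(e'\circ f)$, where $E'^{\star}$ is the algebraic dual of $E'$. $\mathcal{J}\colon E\to E'^{\star}$, $\mathcal{J}(x)(e'):=e'(x)$, is the canonical injection. With $B_\alpha:=\{x\in E\;|\;p_\alpha(x)<1\}$ and polar $B_\alpha^\circ\subset E'$, $\mathcal{FV}(\Omega,E)_{\kappa}:=\{f\in\mathcal{FV}(\Omega,E)_\sigma\;|\;\forall\alpha\in\mathfrak{A}:\ R_f(B_\alpha^{\circ})\text{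 relatively compact in }\mathcal{FV}(\Omega)\}$. *)

theory Defs
  imports "HOL-Analysis.Analysis" "HOL-Library.Function_Algebras"
begin

section \<open>The scalar field\<close>

text \<open>The types of this class are, up to an isometric field isomorphism, exactly
  the real and the complex numbers.\<close>

class real_or_complex = real_normed_field +
  assumes real_or_complex:
    "(\<exists>\<phi> :: 'a \<Rightarrow> real. bij \<phi> \<and> (\<forall>x y. \<phi> (x + y) = \<phi> x + \<phi> y) \<and>
        (\<forall>x y. \<phi> (x * y) = \<phi> x * \<phi> y) \<and> (\<forall>x. norm (\<phi> x) = norm x)) \<or>
     (\<exists>\<phi> :: 'a \<Rightarrow> complex. bij \<phi> \<and> (\<forall>x y. \<phi> (x + y) = \<phi> x + \<phi> y) \<and>
        (\<forall>x y. \<phi> (x * y) = \<phi> x * \<phi> y) \<and> (\<forall>x. norm (\<phi> x) = norm x))"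

instance real :: real_or_complex
  by standard (rule disjI1, rule exI[of _ id], simp)

instance complex :: real_or_complex
  by standard (rule disjI2, rule exI[of _ id], simp)


section \<open>Locally convex spaces\<close>

text \<open>A locally convex space is a linear subspace of an ambient abelian group type,
  together with a scalar multiplication and a system of seminorms on it.  Scalar
  multiplication and seminorms are only relevant on the carrier.\<close>

record ('k, 'v) lcs =
  vecs :: "'v set"
  scl :: "'k \<Rightarrow> 'v \<Rightarrow> 'v"
  snorms :: "('v \<Rightarrow> real) set"

definition lcs_openin :: "('k, 'v::ab_group_add) lcs \<Rightarrow> 'v set \<Rightarrow> bool" where
  "lcs_openin X U \<longleftrightarrow> U \<subseteq> vecs X \<and>
     (\<forall>x\<in>U. \<exists>Q \<epsilon>. finite Q \<and> Q \<subseteq> snorms X \<and> \<epsilon> > 0 \<and>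
        {y \<in> vecs X. \<forall>q\<in>Q. q (y - x) < \<epsilon>} \<subseteq> U)"

definition lcs_topology :: "('k, 'v::ab_group_add) lcs \<Rightarrow> 'v topology" where
  "lcs_topology X = topology (lcs_openin X)"

lemma istopology_lcs_openin: "istopology (lcs_openin X)"
  unfolding istopology_def
proof (intro conjI allI impI)
  fix S T assume S: "lcs_openin X S" and T: "lcs_openin X T"
  show "lcs_openin X (S \<inter> T)"
    unfolding lcs_openin_def
  proof (intro conjI ballI)
    show "S \<inter> T \<subseteq> vecs X" using S by (auto simp: lcs_openin_def)
    fix x assume x: "x \<in> S \<inter> T"
    obtain Q \<epsilon> where 1: "finite Q" "Q \<subseteq> snorms X" "\<epsilon> > 0"
        "{y \<in> vecs X. \<forall>q\<in>Q. q (y - x) < \<epsilon>} \<subseteq> S"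
      using S x unfolding lcs_openin_def by blast
    obtain R \<delta> where 2: "finite R" "R \<subseteq> snorms X" "\<delta> > 0"
        "{y \<in> vecs X. \<forall>q\<in>R. q (y - x) < \<delta>} \<subseteq> T"
      using T x unfolding lcs_openin_def by blast
    have "{y \<in> vecs X. \<forall>q\<in>Q \<union> R. q (y - x) < min \<epsilon> \<delta>} \<subseteq> S \<inter> T"
      using 1(4) 2(4) by auto
    with 1 2 show "\<exists>Q \<epsilon>. finite Q \<and> Q \<subseteq> snorms X \<and> \<epsilon> > 0 \<and>
        {y \<in> vecs X. \<forall>q\<in>Q. q (y - x) < \<epsilon>} \<subseteq> S \<inter> T"
      by (intro exI[of _ "Q \<union> R"] exI[of _ "min \<epsilon> \<delta>"]) auto
  qed
next
  fix \<K> assume *: "\<forall>K\<in>\<K>. lcs_openin X K"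
  show "lcs_openin X (\<Union>\<K>)"
    unfolding lcs_openin_def
  proof (intro conjI ballI)
    show "\<Union>\<K> \<subseteq> vecs X" using * by (auto simp: lcs_openin_def)
    fix x assume "x \<in> \<Union>\<K>"
    then obtain K where K: "K \<in> \<K>" "x \<in> K" by blast
    then obtain Q \<epsilon> where "finite Q" "Q \<subseteq> snorms X" "\<epsilon> > 0"
        "{y \<in> vecs X. \<forall>q\<in>Q. q (y - x) < \<epsilon>} \<subseteq> K"
      using * unfolding lcs_openin_def by meson
    moreover have "K \<subseteq> \<Union>\<K>" using K by blast
    ultimately show "\<exists>Q \<epsilon>. finite Q \<and> Q \<subseteq> snorms X \<and> \<epsilon> > 0 \<and>
        {y \<in> vecs X. \<forall>q\<in>Q. q (y - x) < \<epsilon>} \<subseteq> \<Union>\<K>"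
      by (meson order_trans)
  qed
qed

lemma openin_lcs_topology: "openin (lcs_topology X) U \<longleftrightarrow> lcs_openin X U"
  by (simp add: lcs_topology_def istopology_lcs_openin topology_inverse')

lemma topspace_lcs_topology [simp]: "topspace (lcs_topology X) = vecs X"
proof
  show "topspace (lcs_topology X) \<subseteq> vecs X"
    using openin_topspace[of "lcs_topology X"] unfolding openin_lcs_topology lcs_openin_def by blast
  have "lcs_openin X (vecs X)"
    unfolding lcs_openin_def by (auto intro!: exI[of _ "{}"] exI[of _ "1::real"])
  then show "vecs X \<subseteq> topspace (lcs_topology X)"
    by (simp add: openin_lcs_topology openin_subset)
qed

definition linear_on ::
    "'v::ab_group_add set \<Rightarrow> ('k \<Rightarrow> 'v \<Rightarrow> 'v) \<Rightarrow> ('k \<Rightarrow> 'w::ab_group_add \<Rightarrow> 'w) \<Rightarrow> ('v \<Rightarrow> 'w) \<Rightarrow> bool" where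
  "linear_on V s t f \<longleftrightarrow>
     (\<forall>x\<in>V. \<forall>y\<in>V. f (x + y) = f x + f y) \<and> (\<forall>c. \<forall>x\<in>V. f (s c x) = t c (f x))"

definition seminorm_on ::
    "'v::ab_group_add set \<Rightarrow> ('k::real_or_complex \<Rightarrow> 'v \<Rightarrow> 'v) \<Rightarrow> ('v \<Rightarrow> real) \<Rightarrow> bool" where
  "seminorm_on V s q \<longleftrightarrow>
     (\<forall>x\<in>V. 0 \<le> q x) \<and> (\<forall>x\<in>V. \<forall>y\<in>V. q (x + y) \<le> q x + q y) \<and>
     (\<forall>c. \<forall>x\<in>V. q (s c x) = norm c * q x)"

definition directed_seminorms :: "('k, 'v) lcs \<Rightarrow> bool" where
  "directed_seminorms X \<longleftrightarrow> snorms X \<noteq> {} \<and>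
     (\<forall>p\<in>snorms X. \<forall>q\<in>snorms X. \<exists>r\<in>snorms X. \<exists>C\<ge>0.
        \<forall>x\<in>vecs X. p x \<le> C * r x \<and> q x \<le> C * r x)"

definition lcHs :: "('k::real_or_complex, 'v::ab_group_add) lcs \<Rightarrow> bool" where
  "lcHs X \<longleftrightarrow> vector_space (scl X) \<and> module.subspace (scl X) (vecs X) \<and>
     (\<forall>q\<in>snorms X. seminorm_on (vecs X) (scl X) q) \<and> directed_seminorms X \<and>
     Hausdorff_space (lcs_topology X) \<and> (\<exists>x\<in>vecs X. x \<noteq> 0)"

definition lcs_bounded :: "('k, 'v) lcs \<Rightarrow> 'v set \<Rightarrow> bool" where
  "lcs_bounded X B \<longleftrightarrow> B \<subseteq> vecs X \<and> (\<forall>q\<in>snorms X. bdd_above (q ` B))"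

definition abs_convex :: "('k::real_or_complex, 'v::ab_group_add) lcs \<Rightarrow> 'v set \<Rightarrow> bool" where
  "abs_convex X D \<longleftrightarrow> D \<noteq> {} \<and> D \<subseteq> vecs X \<and>
     (\<forall>x\<in>D. \<forall>y\<in>D. \<forall>a b. norm a + norm b \<le> 1 \<longrightarrow> scl X a x + scl X b y \<in> D)"

definition disk :: "('k::real_or_complex, 'v::ab_group_add) lcs \<Rightarrow> 'v set \<Rightarrow> bool" where
  "disk X D \<longleftrightarrow> lcs_bounded X D \<and> abs_convex X D"

definition gauge_norm :: "('k::real_or_complex, 'v) lcs \<Rightarrow> 'v set \<Rightarrow> 'v \<Rightarrow> real" where
  "gauge_norm X D x = Inf {t. t > 0 \<and> x \<in> scl X (of_real t) ` D}"

definition disk_space :: "('k::real_or_complex, 'v) lcs \<Rightarrow> 'v set \<Rightarrow> ('k, 'v) lcs" where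
  "disk_space X D =
     \<lparr>vecs = (\<Union>n::nat. scl X (of_nat n) ` D), scl = scl X, snorms = {gauge_norm X D}\<rparr>"


subsection \<open>Completeness\<close>

definition lcs_cauchy_filter :: "('k, 'v::ab_group_add) lcs \<Rightarrow> 'v filter \<Rightarrow> bool" where
  "lcs_cauchy_filter X F \<longleftrightarrow>
     (\<forall>q\<in>snorms X. \<forall>\<epsilon>>0. \<exists>A. eventually (\<lambda>x. x \<in> A) F \<and> (\<forall>x\<in>A. \<forall>y\<in>A. q (x - y) < \<epsilon>))"

definition lcs_complete_set :: "('k, 'v::ab_group_add) lcs \<Rightarrow> 'v set \<Rightarrow> bool" where
  "lcs_complete_set X S \<longleftrightarrow>
     (\<forall>F. F \<noteq> bot \<longrightarrow> F \<le> principal S \<longrightarrow> lcs_cauchy_filter X F \<longrightarrow>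
        (\<exists>l\<in>S. limitin (lcs_topology X) (\<lambda>x. x) l F))"

definition lcs_complete :: "('k, 'v::ab_group_add) lcs \<Rightarrow> bool" where
  "lcs_complete X \<longleftrightarrow> lcs_complete_set X (vecs X)"

definition lcs_quasi_complete :: "('k, 'v::ab_group_add) lcs \<Rightarrow> bool" where
  "lcs_quasi_complete X \<longleftrightarrow>
     (\<forall>B. closedin (lcs_topology X) B \<longrightarrow> lcs_bounded X B \<longrightarrow> lcs_complete_set X B)"

definition lcs_seq_complete :: "('k, 'v::ab_group_add) lcs \<Rightarrow> bool" where
  "lcs_seq_complete X \<longleftrightarrow>
     (\<forall>s::nat \<Rightarrow> 'v. range s \<subseteq> vecs X \<longrightarrow>
        (\<forall>q\<in>snorms X. \<forall>\<epsilon>>0. \<exists>N. \<forall>m\<ge>N. \<forall>n\<ge>N. q (s m - s n) < \<epsilon>) \<longrightarrow>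
        (\<exists>l. limitin (lcs_topology X) s l sequentially))"

text \<open>If \<open>X\<close> is Hausdorff and \<open>D\<close> is a disk, then the gauge of \<open>D\<close> is a norm on
  \<open>disk_space X D\<close>.  Hence sequential completeness of that space says that it is a
  Banach space.\<close>

definition locally_complete :: "('k::real_or_complex, 'v::ab_group_add) lcs \<Rightarrow> bool" where
  "locally_complete X \<longleftrightarrow>
     (\<forall>D. disk X D \<longrightarrow> closedin (lcs_topology X) D \<longrightarrow> lcs_seq_complete (disk_space X D))"


subsection \<open>Convergence of nets and local convergence of sequences\<close>

definition directed_set :: "'t set \<Rightarrow> ('t \<Rightarrow> 't \<Rightarrow> bool) \<Rightarrow> bool" where
  "directed_set I le \<longleftrightarrow> I \<noteq> {} \<and> (\<forall>a\<in>I. le a a) \<and>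
     (\<forall>a\<in>I. \<forall>b\<in>I. \<forall>c\<in>I. le a b \<longrightarrow> le b c \<longrightarrow> le a c) \<and>
     (\<forall>a\<in>I. \<forall>b\<in>I. \<exists>c\<in>I. le a c \<and> le b c)"

definition net_converges ::
    "'v topology \<Rightarrow> 't set \<Rightarrow> ('t \<Rightarrow> 't \<Rightarrow> bool) \<Rightarrow> ('t \<Rightarrow> 'v) \<Rightarrow> 'v \<Rightarrow> bool" where
  "net_converges X I le s l \<longleftrightarrow> l \<in> topspace X \<and>
     (\<forall>U. openin X U \<longrightarrow> l \<in> U \<longrightarrow> (\<exists>a\<in>I. \<forall>b\<in>I. le a b \<longrightarrow> s b \<in> U))"

definition locally_converges ::
    "('k::real_or_complex, 'v::ab_group_add) lcs \<Rightarrow> (nat \<Rightarrow> 'v) \<Rightarrow> 'v \<Rightarrow> bool" where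
  "locally_converges X s l \<longleftrightarrow>
     (\<exists>D. disk X D \<and> range s \<subseteq> vecs (disk_space X D) \<and>
        limitin (lcs_topology (disk_space X D)) s l sequentially)"


subsection \<open>Duality and the epsilon product\<close>

text \<open>Linear maps that are only defined on a carrier are represented by functions on
  the ambient type that vanish off the carrier; thus equality of functions is equality
  of maps and the vector space operations are pointwise.\<close>

definition dual :: "('k::real_or_complex, 'v::ab_group_add) lcs \<Rightarrow> ('v \<Rightarrow> 'k) set" where
  "dual X = {y. linear_on (vecs X) (scl X) (*) y \<and> continuous_map (lcs_topology X) euclidean y \<and>
     (\<forall>x. x \<notin> vecs X \<longrightarrow> y x = 0)}"

definition kappa_dual ::
    "('k::real_or_complex, 'v::ab_group_add) lcs \<Rightarrow> ('k, 'v \<Rightarrow> 'k) lcs" where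
  "kappa_dual X =
     \<lparr>vecs = dual X,
      scl = (\<lambda>c y x. c * y x),
      snorms = {\<lambda>y. SUP x\<in>K. norm (y x) | K. abs_convex X K \<and> compactin (lcs_topology X) K}\<rparr>"

definition equicontinuous :: "('k::real_or_complex, 'v::ab_group_add) lcs \<Rightarrow> ('v \<Rightarrow> 'k) set \<Rightarrow> bool" where
  "equicontinuous X H \<longleftrightarrow> H \<subseteq> dual X \<and>
     (\<forall>\<epsilon>>0. \<exists>U. openin (lcs_topology X) U \<and> 0 \<in> U \<and> (\<forall>y\<in>H. \<forall>x\<in>U. norm (y x) < \<epsilon>))"

text \<open>The empty set is excluded below because its supremum is unspecified.\<close>

definition eps_product ::
    "('k::real_or_complex, 'v::ab_group_add) lcs \<Rightarrow> ('k, 'e::ab_group_add) lcs \<Rightarrow>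
     ('k, ('v \<Rightarrow> 'k) \<Rightarrow> 'e) lcs" where
  "eps_product F E =
     \<lparr>vecs = {u. linear_on (dual F) (scl (kappa_dual F)) (scl E) u \<and>
                 continuous_map (lcs_topology (kappa_dual F)) (lcs_topology E) u \<and>
                 (\<forall>y. y \<notin> dual F \<longrightarrow> u y = 0)},
      scl = (\<lambda>c u y. scl E c (u y)),
      snorms = {\<lambda>u. SUP y\<in>H. q (u y) | H q. H \<noteq> {} \<and> equicontinuous F H \<and> q \<in> snorms E}\<rparr>"

definition lcs_isomorphism ::
    "('k, 'v::ab_group_add) lcs \<Rightarrow> ('k, 'w::ab_group_add) lcs \<Rightarrow> ('v \<Rightarrow> 'w) \<Rightarrow> bool" where
  "lcs_isomorphism X Y f \<longleftrightarrow> linear_on (vecs X) (scl X) (scl Y) f \<and>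
     homeomorphic_map (lcs_topology X) (lcs_topology Y) f"

definition weak_topology :: "('k::real_or_complex, 'v::ab_group_add) lcs \<Rightarrow> 'v topology" where
  "weak_topology X = lcs_topology (X\<lparr>snorms := {\<lambda>x. norm (y x) | y. y \<in> dual X}\<rparr>)"

text \<open>The space on a whole type whose system of seminorms is the family \<open>p\<close>.\<close>

definition lcs_of :: "('k \<Rightarrow> 'e \<Rightarrow> 'e) \<Rightarrow> ('a \<Rightarrow> 'e \<Rightarrow> real) \<Rightarrow> ('k, 'e) lcs" where
  "lcs_of s p = \<lparr>vecs = UNIV, scl = s, snorms = range p\<rparr>"

definition polar_ball ::
    "('k::real_or_complex \<Rightarrow> 'e::ab_group_add \<Rightarrow> 'e) \<Rightarrow> ('a \<Rightarrow> 'e \<Rightarrow> real) \<Rightarrow> 'a \<Rightarrow> ('e \<Rightarrow> 'k) set" where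
  "polar_ball s p \<alpha> = {e' \<in> dual (lcs_of s p). \<forall>x. p \<alpha> x < 1 \<longrightarrow> norm (e' x) \<le> 1}"

definition canon_inj ::
    "('k::real_or_complex, 'e::ab_group_add) lcs \<Rightarrow> 'e \<Rightarrow> ('e \<Rightarrow> 'k) \<Rightarrow> 'k" where
  "canon_inj E x = (\<lambda>e'. if e' \<in> dual E then e' x else 0)"


section \<open>Weighted function spaces\<close>

text \<open>The sets \<open>\<Omega>\<close>, \<open>J\<close> and \<open>M\<close> are represented by the types \<open>'x\<close>, \<open>'j\<close> and \<open>'m\<close>, and
  the sets \<open>\<omega>\<^sub>m\<close> by subsets of a common type \<open>'w\<close>.  Only the values of \<open>fd_op D m f\<close>
  on \<open>\<omega> m\<close>, for \<open>f\<close> in \<open>fd_dom D m\<close>, are relevant.\<close>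

record ('x, 'y, 'm, 'w) fun_data =
  fd_AP :: "('x \<Rightarrow> 'y) set"
  fd_dom :: "'m \<Rightarrow> ('x \<Rightarrow> 'y) set"
  fd_op :: "'m \<Rightarrow> ('x \<Rightarrow> 'y) \<Rightarrow> 'w \<Rightarrow> 'y"

definition weights :: "('m \<Rightarrow> 'w set) \<Rightarrow> ('j \<Rightarrow> 'm \<Rightarrow> 'w \<Rightarrow> real) \<Rightarrow> bool" where
  "weights \<omega> \<nu> \<longleftrightarrow> (\<forall>m. \<omega> m \<noteq> {}) \<and> (\<forall>j m. \<forall>x\<in>\<omega> m. 0 \<le> \<nu> j m x) \<and>
     (\<forall>m. \<forall>x\<in>\<omega> m. \<exists>j. \<nu> j m x > 0)"

definition pointwise :: "('k \<Rightarrow> 'y \<Rightarrow> 'y) \<Rightarrow> 'k \<Rightarrow> ('x \<Rightarrow> 'y) \<Rightarrow> 'x \<Rightarrow> 'y" where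
  "pointwise s c f = (\<lambda>x. s c (f x))"

definition linear_data ::
    "('k::real_or_complex \<Rightarrow> 'y::ab_group_add \<Rightarrow> 'y) \<Rightarrow> ('m \<Rightarrow> 'w set) \<Rightarrow>
     ('x, 'y, 'm, 'w) fun_data \<Rightarrow> bool" where
  "linear_data s \<omega> D \<longleftrightarrow> module.subspace (pointwise s) (fd_AP D) \<and>
     (\<forall>m. module.subspace (pointwise s) (fd_dom D m) \<and>
       (\<forall>x\<in>\<omega> m. linear_on (fd_dom D m) (pointwise s) s (\<lambda>f. fd_op D m f x)))"

definition F_space :: "('x, 'y, 'm, 'w) fun_data \<Rightarrow> ('x \<Rightarrow> 'y) set" where
  "F_space D = fd_AP D \<inter> (\<Inter>m. fd_dom D m)"

definition FV_space ::
    "('k \<Rightarrow> 'y \<Rightarrow> 'y) \<Rightarrow> ('a \<Rightarrow> 'y \<Rightarrow> real) \<Rightarrow> ('m \<Rightarrow> 'w set) \<Rightarrow> ('j \<Rightarrow> 'm \<Rightarrow> 'w \<Rightarrow> real) \<Rightarrow>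
     ('x, 'y, 'm, 'w) fun_data \<Rightarrow> ('k, 'x \<Rightarrow> 'y) lcs" where
  "FV_space s p \<omega> \<nu> D =
     \<lparr>vecs = {f \<in> F_space D. \<forall>j m \<alpha>. bdd_above ((\<lambda>x. p \<alpha> (fd_op D m f x) * \<nu> j m x) ` \<omega> m)},
      scl = pointwise s,
      snorms = {\<lambda>f. SUP x\<in>\<omega> m. p \<alpha> (fd_op D m f x) * \<nu> j m x | j m \<alpha>. True}\<rparr>"

abbreviation FV_scalar ::
    "('m \<Rightarrow> 'w set) \<Rightarrow> ('j \<Rightarrow> 'm \<Rightarrow> 'w \<Rightarrow> real) \<Rightarrow>
     ('x, 'k::real_or_complex, 'm, 'w) fun_data \<Rightarrow> ('k, 'x \<Rightarrow> 'k) lcs" where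
  "FV_scalar \<equiv> FV_space (*) (\<lambda>_::unit. norm)"

definition pt_eval :: "('k, 'x \<Rightarrow> 'k::zero) lcs \<Rightarrow> 'x \<Rightarrow> ('x \<Rightarrow> 'k) \<Rightarrow> 'k" where
  "pt_eval F x = (\<lambda>f. if f \<in> vecs F then f x else 0)"

definition op_eval ::
    "('k, 'x \<Rightarrow> 'k::zero) lcs \<Rightarrow> ('x, 'k, 'm, 'w) fun_data \<Rightarrow> 'm \<Rightarrow> 'w \<Rightarrow> ('x \<Rightarrow> 'k) \<Rightarrow> 'k" where
  "op_eval F D m x = (\<lambda>f. if f \<in> vecs F then fd_op D m f x else 0)"

definition S_map :: "('k, 'x \<Rightarrow> 'k::zero) lcs \<Rightarrow> ((('x \<Rightarrow> 'k) \<Rightarrow> 'k) \<Rightarrow> 'e) \<Rightarrow> 'x \<Rightarrow> 'e" where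
  "S_map F u = (\<lambda>x. u (pt_eval F x))"

definition eps_compatible ::
    "('k::real_or_complex, 'x \<Rightarrow> 'k) lcs \<Rightarrow> ('k, 'x \<Rightarrow> 'e) lcs \<Rightarrow> ('k, 'e::ab_group_add) lcs \<Rightarrow> bool" where
  "eps_compatible F FE E \<longleftrightarrow> lcs_isomorphism (eps_product F E) FE (S_map F)"

text \<open>In the following, \<open>D\<close> and \<open>DE\<close> are the data of the scalar-valued and of the
  \<open>E\<close>-valued functions.  The predicate \<open>generator\<close> also contains the standing
  assumptions on the weights and the linearity of the operators; its last conjunct is
  the continuity of the point evaluations that is part of being a dom-space over the
  scalar field.\<close>

definition generator ::
    "('k::real_or_complex \<Rightarrow> 'e::ab_group_add \<Rightarrow> 'e) \<Rightarrow> ('a \<Rightarrow> 'e \<Rightarrow> real) \<Rightarrow>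
     ('m \<Rightarrow> 'w set) \<Rightarrow> ('j \<Rightarrow> 'm \<Rightarrow> 'w \<Rightarrow> real) \<Rightarrow>
     ('x, 'e, 'm, 'w) fun_data \<Rightarrow> ('x, 'k, 'm, 'w) fun_data \<Rightarrow> bool" where
  "generator s p \<omega> \<nu> DE D \<longleftrightarrow>
     weights \<omega> \<nu> \<and> linear_data s \<omega> DE \<and> linear_data (*) \<omega> D \<and>
     Hausdorff_space (lcs_topology (FV_space s p \<omega> \<nu> DE)) \<and>
     directed_seminorms (FV_space s p \<omega> \<nu> DE) \<and>
     Hausdorff_space (lcs_topology (FV_scalar \<omega> \<nu> D)) \<and>
     directed_seminorms (FV_scalar \<omega> \<nu> D) \<and>
     (\<forall>x. continuous_map (lcs_topology (FV_scalar \<omega> \<nu> D)) euclidean (\<lambda>f. f x))"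

definition consistent ::
    "('k::real_or_complex \<Rightarrow> 'e::ab_group_add \<Rightarrow> 'e) \<Rightarrow> ('a \<Rightarrow> 'e \<Rightarrow> real) \<Rightarrow>
     ('m \<Rightarrow> 'w set) \<Rightarrow> ('j \<Rightarrow> 'm \<Rightarrow> 'w \<Rightarrow> real) \<Rightarrow>
     ('x, 'e, 'm, 'w) fun_data \<Rightarrow> ('x, 'k, 'm, 'w) fun_data \<Rightarrow> bool" where
  "consistent s p \<omega> \<nu> DE D \<longleftrightarrow>
     (let F = FV_scalar \<omega> \<nu> D in
      \<forall>u\<in>vecs (eps_product F (lcs_of s p)). S_map F u \<in> F_space DE \<and>
        (\<forall>m. \<forall>x\<in>\<omega> m. fd_op DE m (S_map F u) x = u (op_eval F D m x)))"

definition strong ::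
    "('k::real_or_complex \<Rightarrow> 'e::ab_group_add \<Rightarrow> 'e) \<Rightarrow> ('a \<Rightarrow> 'e \<Rightarrow> real) \<Rightarrow>
     ('m \<Rightarrow> 'w set) \<Rightarrow> ('j \<Rightarrow> 'm \<Rightarrow> 'w \<Rightarrow> real) \<Rightarrow>
     ('x, 'e, 'm, 'w) fun_data \<Rightarrow> ('x, 'k, 'm, 'w) fun_data \<Rightarrow> bool" where
  "strong s p \<omega> \<nu> DE D \<longleftrightarrow>
     (\<forall>e'\<in>dual (lcs_of s p). \<forall>f\<in>vecs (FV_space s p \<omega> \<nu> DE). e' \<circ> f \<in> F_space D \<and>
        (\<forall>m. \<forall>x\<in>\<omega> m. fd_op D m (e' \<circ> f) x = e' (fd_op DE m f x)))"

definition FV_sigma ::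
    "('k::real_or_complex, 'x \<Rightarrow> 'k) lcs \<Rightarrow> ('k, 'e::ab_group_add) lcs \<Rightarrow> ('x \<Rightarrow> 'e) set" where
  "FV_sigma F E = {f. \<forall>e'\<in>dual E. e' \<circ> f \<in> vecs F}"

definition FV_kappa ::
    "('k::real_or_complex, 'x \<Rightarrow> 'k) lcs \<Rightarrow> ('k \<Rightarrow> 'e::ab_group_add \<Rightarrow> 'e) \<Rightarrow> ('a \<Rightarrow> 'e \<Rightarrow> real) \<Rightarrow>
     ('x \<Rightarrow> 'e) set" where
  "FV_kappa F s p = {f \<in> FV_sigma F (lcs_of s p). \<forall>\<alpha>.
     compactin (lcs_topology F)
       (lcs_topology F closure_of ((\<lambda>e'. e' \<circ> f) ` polar_ball s p \<alpha>))}"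

text \<open>\<open>Rt_dual E f\<close> is the map written \<open>R\<^sub>f\<^sup>t\<close>, with values in the algebraic dual of \<open>E'\<close>;
  \<open>Rt_map F E\<close> is the map \<open>R\<^sup>t\<close>.  The latter is meaningful at \<open>f\<close> only if all
  \<open>Rt_dual E f f'\<close> lie in the range of \<open>canon_inj E\<close>.\<close>

definition Rt_dual ::
    "('k::real_or_complex, 'e::ab_group_add) lcs \<Rightarrow> ('x \<Rightarrow> 'e) \<Rightarrow>
     (('x \<Rightarrow> 'k) \<Rightarrow> 'k) \<Rightarrow> ('e \<Rightarrow> 'k) \<Rightarrow> 'k" where
  "Rt_dual E f f' = (\<lambda>e'. if e' \<in> dual E then f' (e' \<circ> f) else 0)"

definition Rt_map ::
    "('k::real_or_complex, 'x \<Rightarrow> 'k) lcs \<Rightarrow> ('k, 'e::ab_group_add) lcs \<Rightarrow> ('x \<Rightarrow> 'e) \<Rightarrow>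
     (('x \<Rightarrow> 'k) \<Rightarrow> 'k) \<Rightarrow> 'e" where
  "Rt_map F E f = (\<lambda>f'. if f' \<in> dual F then inv (canon_inj E) (Rt_dual E f f') else 0)"

definition N_set ::
    "('m \<Rightarrow> 'w set) \<Rightarrow> ('j \<Rightarrow> 'm \<Rightarrow> 'w \<Rightarrow> real) \<Rightarrow> ('k::real_or_complex \<Rightarrow> 'e \<Rightarrow> 'e) \<Rightarrow>
     ('x, 'e, 'm, 'w) fun_data \<Rightarrow> 'j \<Rightarrow> 'm \<Rightarrow> ('x \<Rightarrow> 'e) \<Rightarrow> 'e set" where
  "N_set \<omega> \<nu> s DE j m f = {s (of_real (\<nu> j m x)) (fd_op DE m f x) | x. x \<in> \<omega> m}"

end

theory Submission
  imports Defs
begin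

text \<open>
  For \<open>f\<close> in \<open>FVE\<close> and \<open>f'\<close> in \<open>FV'\<close>, the linear form \<open>e' \<mapsto> f' (e' \<circ> f)\<close> on \<open>E'\<close> is bounded on
  each polar of a ball by a seminorm of compact convergence of \<open>f'\<close>, because \<open>f\<close> maps polars to
  relatively compact sets.  Thus it varies continuously with \<open>f'\<close>, and it is represented by a vector
  of \<open>E\<close> as soon as \<open>f'\<close> is a limit of represented functionals in a sense that fits the completeness
  of \<open>E\<close>.  In case (a) the point evaluations supply them: their span is dense, since a functional
  continuous for compact convergence is an evaluation (Mackey--Arens).  In case (e) the same theorem,
  applied to the weakly compact set \<open>K\<close>, gives the representing vector directly.  This
  provides a right inverse of \<open>S\<close>.

  Mackey--Arens also shows that \<open>e' \<circ> u\<close> is the evaluation at \<open>e' \<circ> S u\<close> for every \<open>u\<close> in the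
  \<open>\<epsilon>\<close>-product.  This gives \<open>R\<^sup>t (S u) = u\<close>, and together with strength and consistency it lets the
  seminorms of \<open>u\<close> and \<open>S u\<close> be compared in both directions.
\<close>

section \<open>The scalar field\<close>

text \<open>A seminorm of \<open>E\<close> is the supremum of the moduli of the functionals in its
  polar. Hence the compact set \<open>polar_image\<close> bounds a representing vector by a seminorm
  of the represented functional, with constant 1. Boundedness, Cauchy properties and even disks
  therefore pass from \<open>FV'\<close> to \<open>E\<close>, so that each completeness hypothesis
  meets its own kind of limit: a filter of near representers, a sequence of representers, or a
  sequence that is Cauchy for the gauge of a transported disk. In the Mackey--Arens step the
  topology that makes the set compact is a free parameter. The original topology yields the duality
  for compact convergence, the weak one settles case (e). Finitely many functionals are handled by
  least squares, all of them by the finite intersection property. Real and complex scalars are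
  treated together. The class offers only field operations and a norm, so the real part and the
  conjugate are recovered from the norm.\<close>

definition kre :: "'k::real_or_complex \<Rightarrow> real" where
  "kre x = ((norm (x + 1))\<^sup>2 - (norm x)\<^sup>2 - 1) / 2"

text \<open>Complex conjugation expressed through the norm. Division by zero gives
  \<open>kcnj 0 = 0\<close>, which is the correct value.\<close>

definition kcnj :: "'k::real_or_complex \<Rightarrow> 'k" where
  "kcnj x = of_real ((norm x)\<^sup>2) / x"

text \<open>Both alternatives of the class are placed inside the complex numbers, so that one
  argument covers them. The range is recorded because \<open>real_linear_representation\<close> has
  to know whether an imaginary unit exists.\<close>

lemma scalar_embedding:
  obtains \<phi> :: "'k::real_or_complex \<Rightarrow> complex" where
    "inj \<phi>" "\<And>x y. \<phi> (x + y) = \<phi> x + \<phi> y" "\<And>x y. \<phi> (x * y) = \<phi> x * \<phi> y" "\<And>x. norm (\<phi> x) = norm x"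
    "range \<phi> = \<real> \<or> range \<phi> = UNIV"
proof -
  consider (r) \<phi> :: "'k \<Rightarrow> real" where "bij \<phi>" "\<forall>x y. \<phi> (x + y) = \<phi> x + \<phi> y"
        "\<forall>x y. \<phi> (x * y) = \<phi> x * \<phi> y" "\<forall>x. norm (\<phi> x) = norm x"
    | (c) \<phi> :: "'k \<Rightarrow> complex" where "bij \<phi>" "\<forall>x y. \<phi> (x + y) = \<phi> x + \<phi> y"
        "\<forall>x y. \<phi> (x * y) = \<phi> x * \<phi> y" "\<forall>x. norm (\<phi> x) = norm x"
    using real_or_complex[where 'a='k] by blast
  then show ?thesis
  proof cases
    case r
    have "range (complex_of_real \<circ> \<phi>) = \<real>"
      using r(1) by (metis Reals_def bij_is_surj image_comp)
    then show ?thesis using r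
      by (intro that[of "complex_of_real \<circ> \<phi>"]) (auto simp: bij_def inj_def)
  next
    case c
    then show ?thesis by (intro that[of \<phi>]) (auto simp: bij_def)
  qed
qed

text \<open>Polarisation: the squared modulus of z + 1 is that of z plus 2 Re z + 1, so
  \<open>kre\<close> is the real part although it is defined without reference to an
  embedding.\<close>

lemma scalar_embedding_kre:
  fixes \<phi> :: "'k::real_or_complex \<Rightarrow> complex"
  assumes "inj \<phi>" and add: "\<And>x y. \<phi> (x + y) = \<phi> x + \<phi> y"
    and mult: "\<And>x y. \<phi> (x * y) = \<phi> x * \<phi> y" and norm: "\<And>x. norm (\<phi> x) = norm x"
  shows "kre x = Re (\<phi> x)" and "\<phi> (of_real r) = of_real r"
proof -
  \<comment> \<open>\<open>\<phi> 1\<close> is idempotent and has norm 1, so it is not 0.\<close>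
  have 1: "\<phi> 1 = 1" using mult[of 1 1] norm[of 1] by (metis mult_cancel_left1 norm_zero zero_neq_one norm_one mult_1)
  have *: "kre x = Re (\<phi> x)" for x
  proof -
    have "(norm (\<phi> x + 1))\<^sup>2 = (norm (x + 1))\<^sup>2" "(norm (\<phi> x))\<^sup>2 = (norm x)\<^sup>2"
      using norm[of "x + 1"] norm[of x] by (simp_all add: add 1)
    then show ?thesis unfolding kre_def cmod_power2
      by (simp add: power2_eq_square algebra_simps)
  qed
  then show "kre x = Re (\<phi> x)" .
  have "norm (of_real r + 1 :: 'k) = \<bar>r + 1\<bar>"
    by (metis of_real_1 of_real_add norm_of_real)
  then have "Re (\<phi> (of_real r)) = r"
    unfolding *[symmetric] kre_def by (simp add: power2_eq_square algebra_simps)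
  moreover have "cmod (\<phi> (of_real r)) = \<bar>r\<bar>" by (simp add: norm)
  \<comment> \<open>The modulus equals the absolute value of the real part, which leaves no room for
    an imaginary part.\<close>
  ultimately have "Im (\<phi> (of_real r)) = 0"
    by (metis cmod_eq_Re norm_complex_def abs_ge_zero add_cancel_right_right power2_abs power_eq_0_iff cmod_power2)
  then show "\<phi> (of_real r) = of_real r" using \<open>Re (\<phi> (of_real r)) = r\<close>
    by (simp add: complex_eq_iff)
qed

lemma kre_add: "kre (x + y) = kre x + kre y"
  and kre_scale: "kre (of_real r * x) = r * kre x"
  and kre_le_norm: "kre x \<le> norm x"
proof -
  obtain \<phi> :: "'a \<Rightarrow> complex" where \<phi>: "inj \<phi>" "\<And>x y. \<phi> (x + y) = \<phi> x + \<phi> y"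
    "\<And>x y. \<phi> (x * y) = \<phi> x * \<phi> y" "\<And>x. norm (\<phi> x) = norm x"
    using scalar_embedding by metis
  note [simp] = scalar_embedding_kre[OF \<phi>] \<phi>(2,3)
  show "kre (x + y) = kre x + kre y" "kre (of_real r * x) = r * kre x" by simp_all
  show "kre x \<le> norm x" using complex_Re_le_cmod[of "\<phi> x"] by (simp add: \<phi>(4))
qed

lemma kre_of_real [simp]: "kre (of_real r) = r" and kre_0 [simp]: "kre 0 = 0"
  and kre_minus: "kre (- x) = - kre x"
proof -
  show 0: "kre (0 :: 'b) = 0" using kre_add[of 0 "0::'b"] by simp
  show "kre (- x) = - kre x" using kre_scale[of "-1" x] by simp
  have "norm (of_real r + 1 :: 'a) = \<bar>r + 1\<bar>"
    by (metis of_real_1 of_real_add norm_of_real)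
  then show "kre (of_real r :: 'a) = r"
    unfolding kre_def by (simp add: power2_eq_square algebra_simps)
qed

lemma kre_diff: "kre (x - y) = kre x - kre y"
  using kre_add[of x "- y"] by (simp add: kre_minus)

lemma kre_sum: "kre (sum f A) = (\<Sum>a\<in>A. kre (f a))"
  by (induction A rule: infinite_finite_induct) (auto simp: kre_add)

lemma kcnj_mult_self: "kcnj x * x = of_real ((norm x)\<^sup>2)"
  by (simp add: kcnj_def)

text \<open>For nonzero \<open>x\<close>, division by the squared norm of \<open>x\<close> turns
  this into the definition of \<open>kre\<close> at \<open>y / x\<close>. It supplies the expansion
  for the least-squares argument.\<close>

lemma norm_add_squared: "(norm (x + y))\<^sup>2 = (norm x)\<^sup>2 + 2 * kre (kcnj x * y) + (norm y)\<^sup>2"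
proof (cases "x = 0")
  case False
  have "kcnj x * y = of_real ((norm x)\<^sup>2) * (y / x)" by (simp add: kcnj_def)
  then have k: "kre (kcnj x * y) = (norm x)\<^sup>2 * kre (y / x)" by (simp only: kre_scale)
  have "norm (x + y) = norm x * norm (y / x + 1)"
    using False by (simp add: norm_mult[symmetric] algebra_simps)
  then show ?thesis using False unfolding k
    by (simp add: kre_def power_mult_distrib norm_divide field_simps)
qed (simp add: kcnj_def)

lemma unimodular_rotation:
  fixes x :: "'k::real_or_complex"
  obtains c :: 'k where "norm c = 1" "c * x = of_real (norm x)"
proof (cases "x = 0")
  case True then show ?thesis using that[of 1] by simp
next
  case False then show ?thesis using that[of "of_real (norm x) / x"] by (simp add: norm_divide)
qed

text \<open>Testing with the conjugate of \<open>z - w\<close> makes the difference of the two sides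
  the squared norm of \<open>z - w\<close>.\<close>

lemma kre_mult_eqI:
  fixes z w :: "'k::real_or_complex"
  assumes "\<And>c. kre (c * z) = kre (c * w)"
  shows "z = w"
proof -
  have "kre (kcnj (z - w) * z) = kre (kcnj (z - w) * w)" by (rule assms)
  moreover have "kre (kcnj (z - w) * (z - w)) = kre (kcnj (z - w) * z) - kre (kcnj (z - w) * w)"
    using kre_add[of "kcnj (z - w) * (z - w)" "kcnj (z - w) * w"] by (simp add: algebra_simps)
  ultimately have "(norm (z - w))\<^sup>2 = 0" by (metis kcnj_mult_self kre_of_real diff_self)
  then show ?thesis by simp
qed

text \<open>This converts a real functional into a scalar-valued one: it will be applied to the
  restriction of a real-linear functional to the multiples of one vector.\<close>

lemma real_linear_representation:
  fixes h :: "'k::real_or_complex \<Rightarrow> real"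
  assumes add: "\<And>a b. h (a + b) = h a + h b" and scale: "\<And>r a. h (of_real r * a) = r * h a"
  obtains z where "\<And>c. h c = kre (c * z)"
proof -
  obtain \<phi> :: "'k \<Rightarrow> complex" where \<phi>: "inj \<phi>" "\<And>x y. \<phi> (x + y) = \<phi> x + \<phi> y"
    "\<And>x y. \<phi> (x * y) = \<phi> x * \<phi> y" "\<And>x. norm (\<phi> x) = norm x" "range \<phi> = \<real> \<or> range \<phi> = UNIV"
    using scalar_embedding by metis
  note k [simp] = scalar_embedding_kre[OF \<phi>(1-4)]
  show ?thesis
  proof (cases "range \<phi> = UNIV")
    case False
    then have R: "range \<phi> = \<real>" using \<phi>(5) by blast
    have "h c = kre (c * of_real (h 1))" for c
    proof -
      have "\<phi> c \<in> \<real>" using R by blast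
      then have "\<phi> c = \<phi> (of_real (Re (\<phi> c)))" by simp
      then have c: "c = of_real (Re (\<phi> c))" using \<phi>(1) by (meson injD)
      have "h c = Re (\<phi> c) * h 1" using scale[of "Re (\<phi> c)" 1] c by simp
      then show ?thesis by (simp add: \<phi>(3))
    qed
    then show ?thesis by (rule that)
  next
    case True
    then obtain i where i: "\<phi> i = \<i>" by (metis UNIV_I image_iff)
    \<comment> \<open>The coefficient is h(1) - i h(i): the real part of its product with
      \<open>c\<close> is Re c h(1) + Im c h(i).\<close>
    have "h c = kre (c * (of_real (h 1) + of_real (- h i) * i))" for c
    proof -
      have "\<phi> c = \<phi> (of_real (Re (\<phi> c)) * 1 + of_real (Im (\<phi> c)) * i)"
        using complex_eq[of "\<phi> c"] by (simp add: \<phi>(2,3) i mult.commute)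
      then have c: "c = of_real (Re (\<phi> c)) * 1 + of_real (Im (\<phi> c)) * i" using \<phi>(1) by (meson injD)
      have "h c = Re (\<phi> c) * h 1 + Im (\<phi> c) * h i"
        by (subst c) (simp only: add scale)
      then show ?thesis by (simp add: \<phi>(2,3) i del: of_real_minus)
    qed
    then show ?thesis by (rule that)
  qed
qed

section \<open>The Hahn-Banach theorem for seminorms on a subspace\<close>

lemma linear_onD:
  assumes "linear_on V s t f"
  shows linear_on_add: "\<And>x y. x \<in> V \<Longrightarrow> y \<in> V \<Longrightarrow> f (x + y) = f x + f y"
    and linear_on_scale: "\<And>c x. x \<in> V \<Longrightarrow> f (s c x) = t c (f x)"
  using assms by (auto simp: linear_on_def)

lemma seminorm_onD:
  assumes "seminorm_on V s q"
  shows seminorm_on_nonneg: "\<And>x. x \<in> V \<Longrightarrow> 0 \<le> q x"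
    and seminorm_on_add: "\<And>x y. x \<in> V \<Longrightarrow> y \<in> V \<Longrightarrow> q (x + y) \<le> q x + q y"
    and seminorm_on_scale: "\<And>c x. x \<in> V \<Longrightarrow> q (s c x) = norm c * q x"
  using assms by (auto simp: seminorm_on_def)

section \<open>Sublinear functionals on a subspace\<close>

locale subspace_of = vector_space s for s :: "'k::real_or_complex \<Rightarrow> 'v::ab_group_add \<Rightarrow> 'v" +
  fixes V :: "'v set"
  assumes sub: "subspace V"
begin

lemma V_add: "x \<in> V \<Longrightarrow> y \<in> V \<Longrightarrow> x + y \<in> V"
  and V_diff: "x \<in> V \<Longrightarrow> y \<in> V \<Longrightarrow> x - y \<in> V"
  and V_scale: "x \<in> V \<Longrightarrow> s c x \<in> V"
  and V_0: "0 \<in> V"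
  and V_minus: "x \<in> V \<Longrightarrow> - x \<in> V"
  using sub by (simp_all add: subspace_add subspace_diff subspace_scale subspace_0 subspace_neg)

abbreviation rs :: "real \<Rightarrow> 'v \<Rightarrow> 'v" where "rs r x \<equiv> s (of_real r) x"

text \<open>Fixing the value 0 off \<open>V\<close> makes functionals on \<open>V\<close> correspond
  to functions, so that minimality in the pointwise order yields an equality of functions.
  Homogeneity is demanded as an inequality only; applying it to the inverse factor gives the
  equality.\<close>

definition sublinear :: "('v \<Rightarrow> real) \<Rightarrow> bool" where
  "sublinear q \<longleftrightarrow> (\<forall>x\<in>V. \<forall>y\<in>V. q (x + y) \<le> q x + q y) \<and> (\<forall>x\<in>V. \<forall>r\<ge>0. q (rs r x) \<le> r * q x) \<and>
    (\<forall>x. x \<notin> V \<longrightarrow> q x = 0)"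

lemma sublinear_add: "sublinear q \<Longrightarrow> x \<in> V \<Longrightarrow> y \<in> V \<Longrightarrow> q (x + y) \<le> q x + q y"
  by (simp add: sublinear_def)

lemma sublinear_0:
  assumes "sublinear q" shows "q 0 = 0"
proof -
  have "q (0 + 0) \<le> q 0 + q 0" using assms V_0 unfolding sublinear_def by blast
  moreover have "q (rs 0 0) \<le> 0 * q 0" using assms V_0 unfolding sublinear_def by blast
  ultimately show ?thesis by simp
qed

lemma sublinear_scale:
  assumes "sublinear q" "x \<in> V" "r \<ge> 0"
  shows "q (rs r x) = r * q x"
proof (cases "r = 0")
  case True then show ?thesis using sublinear_0[OF assms(1)] by simp
next
  case False
  have le: "q (rs t y) \<le> t * q y" if "y \<in> V" "t \<ge> 0" for t y
    using assms(1) that unfolding sublinear_def by blast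
  have "q (rs (inverse r) (rs r x)) \<le> inverse r * q (rs r x)"
    using assms by (intro le V_scale) auto
  also have "rs (inverse r) (rs r x) = x"
    using False by (simp only: scale_scale of_real_mult[symmetric]) simp
  finally have "r * q x \<le> q (rs r x)"
    using False assms(3) by (simp add: field_simps)
  then show ?thesis using le[OF assms(2,3)] by linarith
qed

lemma sublinear_minus: 
  assumes "sublinear q" "x \<in> V" shows "- q (- x) \<le> q x"
  using sublinear_add[OF assms V_minus[OF assms(2)]] sublinear_0[OF assms(1)] by simp

text \<open>Makes a sublinear functional as small as possible in the direction \<open>- y\<close>, where
  it then takes the value \<open>- q y\<close>.\<close>

definition tilt :: "('v \<Rightarrow> real) \<Rightarrow> 'v \<Rightarrow> 'v \<Rightarrow> real" where
  "tilt q y x = (if x \<in> V then INF t\<in>{0..}. q (x + rs t y) - t * q y else 0)"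

lemma tilt_le:
  assumes "sublinear q" "x \<in> V" "y \<in> V" "t \<ge> 0"
  shows "tilt q y x \<le> q (x + rs t y) - t * q y"
proof -
  \<comment> \<open>Subadditivity for the summands \<open>x + rs r y\<close> and \<open>- x\<close>
    gives a lower bound that does not depend on the parameter, so the infimum is a proper
    one.\<close>
  have "- q (- x) \<le> q (x + rs r y) - r * q y" if "r \<ge> 0" for r
    using sublinear_add[OF assms(1), of "x + rs r y" "- x"] sublinear_scale[OF assms(1,3) that]
    by (simp add: V_add V_minus V_scale assms)
  then have "bdd_below ((\<lambda>t. q (x + rs t y) - t * q y) ` {0..})"
    by (intro bdd_belowI2) auto
  then show ?thesis using assms by (auto simp: tilt_def intro!: cINF_lower)
qed

lemma tilt_greatest:
  assumes "x \<in> V" "\<And>t. t \<ge> 0 \<Longrightarrow> b \<le> q (x + rs t y) - t * q y"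
  shows "b \<le> tilt q y x"
  using assms by (auto simp: tilt_def intro!: cINF_greatest)

lemma tilt_le_self: "sublinear q \<Longrightarrow> y \<in> V \<Longrightarrow> tilt q y x \<le> q x"
  using tilt_le[of q x y 0] by (cases "x \<in> V") (auto simp: tilt_def sublinear_def)

lemma sublinear_tilt:
  assumes q: "sublinear q" and y: "y \<in> V"
  shows "sublinear (tilt q y)"
  unfolding sublinear_def
proof (intro conjI ballI allI impI)
  fix a b assume ab: "a \<in> V" "b \<in> V"
  have "tilt q y (a + b) - (q (b + rs u y) - u * q y) \<le> q (a + rs t y) - t * q y"
    if "t \<ge> 0" "u \<ge> 0" for t u
  proof -
    \<comment> \<open>The parameters \<open>t\<close> and \<open>u\<close> chosen for the two
      summands are spent together as \<open>t + u\<close>; the infima over them are taken one after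
      the other.\<close>
    have "tilt q y (a + b) \<le> q (a + b + rs (t + u) y) - (t + u) * q y"
      using that ab by (intro tilt_le q y V_add) auto
    also have "a + b + rs (t + u) y = (a + rs t y) + (b + rs u y)"
      by (simp add: scale_left_distrib)
    also have "q \<dots> \<le> q (a + rs t y) + q (b + rs u y)"
      by (intro sublinear_add q V_add V_scale y ab)
    finally show ?thesis by (simp add: algebra_simps)
  qed
  then have "tilt q y (a + b) - (q (b + rs u y) - u * q y) \<le> tilt q y a" if "u \<ge> 0" for u
    using that by (intro tilt_greatest ab)
  then have "tilt q y (a + b) - tilt q y a \<le> q (b + rs u y) - u * q y" if "u \<ge> 0" for u
    using that by (smt (verit))
  then have "tilt q y (a + b) - tilt q y a \<le> tilt q y b"
    by (intro tilt_greatest ab)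
  then show "tilt q y (a + b) \<le> tilt q y a + tilt q y b" by simp
next
  fix x and r :: real assume x: "x \<in> V" and r: "0 \<le> r"
  show "tilt q y (rs r x) \<le> r * tilt q y x"
  proof (cases "r = 0")
    case True
    then show ?thesis using tilt_le_self[OF q y, of 0] sublinear_0[OF q] by simp
  next
    case False
    have "tilt q y (rs r x) / r \<le> q (x + rs t y) - t * q y" if "t \<ge> 0" for t
    proof -
      have "tilt q y (rs r x) \<le> q (rs r x + rs (r * t) y) - (r * t) * q y"
        using that r by (intro tilt_le q y V_scale x) auto
      also have "rs r x + rs (r * t) y = rs r (x + rs t y)"
        by (simp add: scale_right_distrib)
      also have "q \<dots> = r * q (x + rs t y)"
        by (intro sublinear_scale q r V_add V_scale x y)
      finally show ?thesis using False r by (simp add: field_simps)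
    qed
    then have "tilt q y (rs r x) / r \<le> tilt q y x" by (intro tilt_greatest x)
    then show ?thesis using False r by (simp add: field_simps)
  qed
qed (auto simp: tilt_def)

text \<open>Zorn's lemma for the reversed pointwise order: \<open>p\<close> itself bounds the empty
  chain, and the pointwise infimum bounds a nonempty one.\<close>

lemma minimal_sublinear:
  assumes p: "sublinear p"
  obtains m where "sublinear m" "\<And>x. m x \<le> p x"
    "\<And>q. sublinear q \<Longrightarrow> (\<And>x. q x \<le> m x) \<Longrightarrow> q = m"
proof -
  define A where "A = {q. sublinear q \<and> q \<le> p}"
  have po: "partial_order_on A (relation_of (\<ge>) A)"
    by (rule partial_order_on_relation_ofI) auto
  have ch: "\<exists>u\<in>A. \<forall>q\<in>C. u \<le> q" if C: "C \<in> Chains (relation_of (\<ge>) A)" for C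
  proof (cases "C = {}")
    case True then show ?thesis using p by (auto simp: A_def)
  next
    case False
    have CA: "C \<subseteq> A" and tot: "\<And>q r. q \<in> C \<Longrightarrow> r \<in> C \<Longrightarrow> q \<le> r \<or> r \<le> q"
      using C by (auto simp: Chains_def relation_of_def)
    have sl: "sublinear q" "q x \<le> p x" if "q \<in> C" for q x
      using CA that by (auto simp: A_def le_fun_def)
    define u where "u x = (INF q\<in>C. q x)" for x
    have bdd: "bdd_below ((\<lambda>q. q x) ` C)" for x
    proof (cases "x \<in> V")
      case True
      have "- p (- x) \<le> q x" if "q \<in> C" for q
        using sublinear_minus[OF sl(1) True, of q] sl(2)[of q "- x"] that by force
      then show ?thesis by (intro bdd_belowI2) auto
    next
      case False
      then have "0 \<le> q x" if "q \<in> C" for q using sl(1)[OF that] by (auto simp: sublinear_def)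
      then show ?thesis by (intro bdd_belowI2) auto
    qed
    have ul: "u x \<le> q x" if "q \<in> C" for q x
      using that bdd by (auto simp: u_def intro: cINF_lower)
    have ug: "b \<le> u x" if "\<And>q. q \<in> C \<Longrightarrow> b \<le> q x" for b x
      using that False by (auto simp: u_def intro: cINF_greatest)
    have "sublinear u"
      unfolding sublinear_def
    proof (intro conjI ballI allI impI)
      fix x y assume xy: "x \<in> V" "y \<in> V"
      have "u (x + y) - q x \<le> r y" if q: "q \<in> C" and r: "r \<in> C" for q r
      proof -
        \<comment> \<open>Here the chain property matters: the infimum may approach its values at
          \<open>x\<close> and at \<open>y\<close> along different members, and the smaller of the
          two serves both points.\<close>
        obtain w where w: "w \<in> C" "w \<le> q" "w \<le> r" using tot[OF q r] q r by blast
        have "u (x + y) \<le> w x + w y"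
          using ul[OF w(1), of "x + y"] sublinear_add[OF sl(1)[OF w(1)] xy] by linarith
        then show ?thesis using le_funD[OF w(2), of x] le_funD[OF w(3), of y] by linarith
      qed
      then have "u (x + y) - q x \<le> u y" if "q \<in> C" for q using that by (intro ug)
      then have "u (x + y) - u y \<le> q x" if "q \<in> C" for q using that by (smt (verit))
      then have "u (x + y) - u y \<le> u x" by (intro ug)
      then show "u (x + y) \<le> u x + u y" by simp
    next
      fix x and r :: real assume x: "x \<in> V" and r: "0 \<le> r"
      show "u (rs r x) \<le> r * u x"
      proof (cases "r = 0")
        case True
        obtain q where q: "q \<in> C" using False by blast
        show ?thesis using ul[OF q, of 0] sublinear_0[OF sl(1)[OF q]] True by simp
      next
        case rn: False
        have "u (rs r x) / r \<le> q x" if "q \<in> C" for q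
          using ul[OF that, of "rs r x"] sublinear_scale[OF sl(1)[OF that] x r] rn r
          by (simp add: field_simps)
        then have "u (rs r x) / r \<le> u x" by (rule ug)
        then show ?thesis using rn r by (simp add: field_simps)
      qed
    next
      fix x assume "x \<notin> V"
      then have "q x = 0" if "q \<in> C" for q using sl(1)[OF that] by (auto simp: sublinear_def)
      then have "(\<lambda>q. q x) ` C = {0}" using False by (auto simp: image_iff)
      then show "u x = 0" by (simp add: u_def)
    qed
    moreover have "u \<le> p"
      using False sl(2) ul by (meson ex_in_conv le_funI order_trans)
    ultimately show ?thesis using ul by (auto simp: A_def le_fun_def)
  qed
  from predicate_Zorn[OF po ch] obtain m where m: "m \<in> A" "\<forall>q\<in>A. q \<le> m \<longrightarrow> q = m" by blast
  show ?thesis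
  proof (rule that[of m])
    show "sublinear m" "m x \<le> p x" for x using m(1) by (auto simp: A_def le_fun_def)
    show "q = m" if "sublinear q" "\<And>x. q x \<le> m x" for q
      using m that by (metis (mono_tags, lifting) A_def le_funI mem_Collect_eq order_trans)
  qed
qed

text \<open>Minimality forces linearity: tilting \<open>m\<close> in any direction gives a sublinear
  functional below \<open>m\<close>, hence \<open>m\<close> itself, and the tilt inequality then
  reads as superadditivity. Starting below the tilt of \<open>p\<close> at \<open>x0\<close> instead
  of below \<open>p\<close> fixes the value at \<open>x0\<close>.\<close>

lemma real_hahn_banach:
  assumes p: "sublinear p" and x0: "x0 \<in> V"
  obtains g where "\<And>x y. x \<in> V \<Longrightarrow> y \<in> V \<Longrightarrow> g (x + y) = g x + g y"
    "\<And>r x. x \<in> V \<Longrightarrow> g (rs r x) = r * g x" "\<And>x. g x \<le> p x" "g x0 = p x0"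
proof -
  obtain m where m: "sublinear m" "\<And>x. m x \<le> tilt p x0 x"
    "\<And>q. sublinear q \<Longrightarrow> (\<And>x. q x \<le> m x) \<Longrightarrow> q = m"
    using minimal_sublinear[OF sublinear_tilt[OF p x0]] by metis
  have mp: "m x \<le> p x" for x using m(2)[of x] tilt_le_self[OF p x0, of x] by linarith
  have "tilt m y = m" if "y \<in> V" for y
    by (intro m(3) sublinear_tilt tilt_le_self m(1) that)
  then have add_le: "m x + m y \<le> m (x + y)" if "x \<in> V" "y \<in> V" for x y
    using tilt_le[OF m(1) that, of 1] that by simp
  have add: "m (x + y) = m x + m y" if "x \<in> V" "y \<in> V" for x y
    using add_le[OF that] sublinear_add[OF m(1) that] by linarith
  have minus: "m (- x) = - m x" if "x \<in> V" for x
    using add[OF that V_minus[OF that]] sublinear_0[OF m(1)] by simp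
  have scale: "m (rs r x) = r * m x" if "x \<in> V" for r x
  proof (cases "r \<ge> 0")
    case True then show ?thesis by (rule sublinear_scale[OF m(1) that])
  next
    case False
    then have "m (rs (- r) x) = - r * m x" by (intro sublinear_scale[OF m(1) that]) simp
    moreover have "m (rs (- r) x) = - m (rs r x)" using minus[OF V_scale[OF that]] by simp
    ultimately show ?thesis by simp
  qed
  \<comment> \<open>The parameter 1 cancels the vector \<open>- x0\<close>, so the tilt is at most
    \<open>- p x0\<close> there.\<close>
  have "m (- x0) \<le> p (- x0 + rs 1 x0) - 1 * p x0"
    using m(2)[of "- x0"] tilt_le[OF p V_minus[OF x0] x0, of 1] by linarith
  then have "p x0 \<le> m x0" using minus[OF x0] sublinear_0[OF p] by simp
  then show ?thesis using mp by (intro that[of m] add scale) (auto intro: antisym)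
qed

section \<open>Seminorms: elementary rules, norming functionals, distances\<close>

lemma seminorm_on_0: "seminorm_on V s p \<Longrightarrow> p 0 = 0"
  using seminorm_on_scale[of V s p 0 0] V_0 by simp

lemma seminorm_on_minus: "seminorm_on V s p \<Longrightarrow> x \<in> V \<Longrightarrow> p (- x) = p x"
  using seminorm_on_scale[of V s p x "- 1"] by simp

lemma seminorm_on_minus_commute: "seminorm_on V s p \<Longrightarrow> x \<in> V \<Longrightarrow> y \<in> V \<Longrightarrow> p (x - y) = p (y - x)"
  using seminorm_on_minus[of p "x - y"] V_diff by simp

lemma seminorm_on_diff: "seminorm_on V s p \<Longrightarrow> x \<in> V \<Longrightarrow> y \<in> V \<Longrightarrow> p (x - y) \<le> p x + p y"
  using seminorm_on_add[of V s p x "- y"] V_minus[of y] seminorm_on_minus[of p y] by simp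

text \<open>The reverse of \<open>le\<close> is \<open>le\<close> for \<open>inverse c\<close> and \<open>s c x\<close>.\<close>

lemma seminorm_onI:
  assumes nn: "\<And>x. x \<in> V \<Longrightarrow> 0 \<le> q x"
    and add: "\<And>x y. x \<in> V \<Longrightarrow> y \<in> V \<Longrightarrow> q (x + y) \<le> q x + q y"
    and le: "\<And>c x. x \<in> V \<Longrightarrow> q (s c x) \<le> norm c * q x"
  shows "seminorm_on V s q"
  unfolding seminorm_on_def
proof (intro conjI ballI allI nn add)
  fix c x assume x: "x \<in> V"
  show "q (s c x) = norm c * q x"
  proof (cases "c = 0")
    case True then show ?thesis using le[OF x, of 0] nn[OF V_0] by simp
  next
    case False
    have "q (s (inverse c) (s c x)) \<le> norm (inverse c) * q (s c x)" by (intro le V_scale x)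
    then have "norm c * q x \<le> q (s c x)" using False by (simp add: norm_divide field_simps)
    then show ?thesis using le[OF x, of c] by linarith
  qed
qed

theorem seminorm_hahn_banach:
  assumes p: "seminorm_on V s p" and x0: "x0 \<in> V"
  obtains f where "linear_on V s (*) f" "\<And>x. x \<in> V \<Longrightarrow> norm (f x) \<le> p x" "norm (f x0) = p x0"
    "\<And>x. x \<notin> V \<Longrightarrow> f x = 0"
proof -
  define p' where "p' x = (if x \<in> V then p x else 0)" for x
  have "sublinear p'"
    unfolding sublinear_def p'_def using seminorm_onD[OF p] by (auto simp: V_add V_scale)
  from real_hahn_banach[OF this x0] obtain g where
    g: "\<And>x y. x \<in> V \<Longrightarrow> y \<in> V \<Longrightarrow> g (x + y) = g x + g y"
    "\<And>r x. x \<in> V \<Longrightarrow> g (rs r x) = r * g x" "\<And>x. g x \<le> p' x" "g x0 = p' x0" by blast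
  \<comment> \<open>For fixed \<open>x\<close> the map sending \<open>c\<close> to
    \<open>g (s c x)\<close> is real-linear in the scalar, so it is the real part of multiplication
    by one number. That number becomes the value at \<open>x\<close>.\<close>
  have "\<exists>z. \<forall>c. g (s c x) = kre (c * z)" if "x \<in> V" for x
  proof -
    have "g (s (of_real r * a) x) = r * g (s a x)" for r a
      using g(2)[OF V_scale[OF that], of r a] by simp
    moreover have "g (s (a + b) x) = g (s a x) + g (s b x)" for a b
      by (simp add: scale_left_distrib g(1) V_scale that)
    ultimately show ?thesis using real_linear_representation[of "\<lambda>c. g (s c x)"] by metis
  qed
  then obtain F where F: "\<And>x c. x \<in> V \<Longrightarrow> g (s c x) = kre (c * F x)" by metis
  define f where "f x = (if x \<in> V then F x else 0)" for x
  have f: "g (s c x) = kre (c * f x)" if "x \<in> V" for x c using F[OF that, of c] that by (simp only: f_def if_True)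
  have "linear_on V s (*) f"
    unfolding linear_on_def
  proof (intro conjI ballI allI)
    fix x y assume xy: "x \<in> V" "y \<in> V"
    show "f (x + y) = f x + f y"
      by (rule kre_mult_eqI)
         (simp only: xy f[symmetric] V_add V_scale kre_add distrib_left scale_right_distrib g(1))
  next
    fix c x assume x: "x \<in> V"
    show "f (s c x) = c * f x"
      by (rule kre_mult_eqI) (simp only: x f[symmetric] V_scale mult.assoc[symmetric] scale_scale)
  qed
  moreover have norm_le: "norm (f x) \<le> p x" if "x \<in> V" for x
  proof -
    \<comment> \<open>Rotating the value to a nonnegative real lets the one-sided bound on
      \<open>g\<close> control the modulus.\<close>
    obtain c where c: "norm c = 1" "c * f x = of_real (norm (f x))" using unimodular_rotation by blast
    have "norm (f x) = g (s c x)" using f[OF that, of c] c by simp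
    also have "\<dots> \<le> p (s c x)" using g(3)[of "s c x"] that by (simp add: p'_def V_scale)
    also have "\<dots> = p x" using seminorm_on_scale[OF p that] c by simp
    finally show ?thesis .
  qed
  moreover have "p x0 \<le> norm (f x0)"
    using f[OF x0, of 1] g(4) x0 kre_le_norm[of "f x0"] by (simp add: p'_def)
  ultimately show ?thesis using x0 by (intro that[of f]) (auto simp: f_def intro: antisym)
qed

text \<open>This is the distance from \<open>Z\<close>. A functional dominated by it vanishes on
  \<open>Z\<close>, while Hahn--Banach can still make it nonzero at a point of positive
  distance.\<close>

lemma quotient_seminorm:
  assumes p: "seminorm_on V s p" and Z: "subspace Z" "Z \<subseteq> V"
  shows "seminorm_on V s (\<lambda>x. INF z\<in>Z. p (x - z))"
    and "\<And>x z. x \<in> V \<Longrightarrow> z \<in> Z \<Longrightarrow> (INF z\<in>Z. p (x - z)) \<le> p (x - z)"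
proof -
  let ?q = "\<lambda>x. INF z\<in>Z. p (x - z)"
  have ne: "Z \<noteq> {}" using subspace_0[OF Z(1)] by blast
  have nn: "0 \<le> p (x - z)" if "x \<in> V" "z \<in> Z" for x z
    using that Z(2) by (intro seminorm_on_nonneg[OF p] V_diff) auto
  show le: "?q x \<le> p (x - z)" if "x \<in> V" "z \<in> Z" for x z
    using that nn by (intro cINF_lower bdd_belowI2[of _ 0]) auto
  have ge: "b \<le> ?q x" if "\<And>z. z \<in> Z \<Longrightarrow> b \<le> p (x - z)" for b x
    using that ne by (intro cINF_greatest)
  show "seminorm_on V s ?q"
  proof (rule seminorm_onI)
    show "0 \<le> ?q x" if "x \<in> V" for x using nn that by (intro ge)
  next
    fix x y assume xy: "x \<in> V" "y \<in> V"
    have "?q (x + y) - p (y - w) \<le> p (x - z)" if z: "z \<in> Z" "w \<in> Z" for z w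
    proof -
      have "?q (x + y) \<le> p (x + y - (z + w))"
        using xy z by (intro le V_add subspace_add Z)
      also have "x + y - (z + w) = (x - z) + (y - w)" by simp
      also have "p \<dots> \<le> p (x - z) + p (y - w)"
        using z xy Z(2) by (intro seminorm_on_add[OF p] V_diff) auto
      finally show ?thesis by simp
    qed
    then have "?q (x + y) - p (y - w) \<le> ?q x" if "w \<in> Z" for w using that by (intro ge)
    then have "?q (x + y) - ?q x \<le> p (y - w)" if "w \<in> Z" for w using that by (smt (verit))
    then have "?q (x + y) - ?q x \<le> ?q y" by (intro ge)
    then show "?q (x + y) \<le> ?q x + ?q y" by simp
  next
    fix c x assume x: "x \<in> V"
    show "?q (s c x) \<le> norm c * ?q x"
    proof (cases "c = 0")
      case True
      then show ?thesis using le[OF V_0 subspace_0[OF Z(1)]] seminorm_on_0[OF p] by simp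
    next
      case False
      have "?q (s c x) / norm c \<le> p (x - z)" if z: "z \<in> Z" for z
      proof -
        have "?q (s c x) \<le> p (s c x - s c z)"
          using z x by (intro le V_scale subspace_scale Z)
        also have "\<dots> = norm c * p (x - z)"
          unfolding scale_right_diff_distrib[symmetric]
          using z x Z(2) by (intro seminorm_on_scale[OF p] V_diff) auto
        finally show ?thesis using False by (simp add: field_simps)
      qed
      then have "?q (s c x) / norm c \<le> ?q x" by (intro ge)
      then show ?thesis using False by (simp add: field_simps)
    qed
  qed
qed

end

section \<open>Locally convex spaces\<close>

text \<open>The assumptions are kept this weak because the lemma also serves disk spaces, for whose
  gauge only subadditivity is established.\<close>

lemma openin_lcs_ball:
  assumes "\<And>x y. x \<in> vecs X \<Longrightarrow> y \<in> vecs X \<Longrightarrow> x - y \<in> vecs X"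
    and "\<And>x y. x \<in> vecs X \<Longrightarrow> y \<in> vecs X \<Longrightarrow> q (x + y) \<le> q x + q y"
    and "q \<in> snorms X" "l \<in> vecs X"
  shows "openin (lcs_topology X) {y \<in> vecs X. q (y - l) < \<epsilon>}"
  unfolding openin_lcs_topology lcs_openin_def
proof (intro conjI ballI)
  fix x assume x: "x \<in> {y \<in> vecs X. q (y - l) < \<epsilon>}"
  have "q (y - l) < \<epsilon>" if "y \<in> vecs X" "q (y - x) < \<epsilon> - q (x - l)" for y
    using assms(2)[OF assms(1)[OF that(1), of x] assms(1)[OF _ assms(4), of x]] x that by simp
  then show "\<exists>Q \<delta>. finite Q \<and> Q \<subseteq> snorms X \<and> \<delta> > 0 \<and>
      {y \<in> vecs X. \<forall>q\<in>Q. q (y - x) < \<delta>} \<subseteq> {y \<in> vecs X. q (y - l) < \<epsilon>}"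
    using x assms(3) by (intro exI[of _ "{q}"] exI[of _ "\<epsilon> - q (x - l)"]) auto
qed auto

text \<open>Only differences and domination enter, so the criterion applies to the
  \<open>\<epsilon>\<close>-product and to the weak topology without a check that their seminorms
  form a directed system.\<close>

lemma bounded_imp_continuous_map:
  assumes diff: "\<And>x y. x \<in> vecs X \<Longrightarrow> y \<in> vecs X \<Longrightarrow> x - y \<in> vecs X"
    and maps: "\<And>x. x \<in> vecs X \<Longrightarrow> u x \<in> vecs Z"
    and lin: "\<And>x y. x \<in> vecs X \<Longrightarrow> y \<in> vecs X \<Longrightarrow> u (x - y) = u x - u y"
    and bnd: "\<And>r. r \<in> snorms Z \<Longrightarrow> \<exists>q\<in>snorms X. \<exists>C>0. \<forall>x\<in>vecs X. r (u x) \<le> C * q x"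
  shows "continuous_map (lcs_topology X) (lcs_topology Z) u"
  unfolding continuous_map_def
proof (intro conjI allI impI)
  show "u \<in> topspace (lcs_topology X) \<rightarrow> topspace (lcs_topology Z)" using maps by auto
  fix U assume U: "openin (lcs_topology Z) U"
  obtain q C where q: "\<And>r. r \<in> snorms Z \<Longrightarrow> q r \<in> snorms X"
    and C: "\<And>r. r \<in> snorms Z \<Longrightarrow> C r > 0"
    and qC: "\<And>r x. r \<in> snorms Z \<Longrightarrow> x \<in> vecs X \<Longrightarrow> r (u x) \<le> C r * q r x"
    using bnd by metis
  show "openin (lcs_topology X) {x \<in> topspace (lcs_topology X). u x \<in> U}"
    unfolding openin_lcs_topology lcs_openin_def
  proof (intro conjI ballI)
    fix x assume x: "x \<in> {x \<in> topspace (lcs_topology X). u x \<in> U}"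
    then obtain R \<epsilon> where R: "finite R" "R \<subseteq> snorms Z" "\<epsilon> > 0"
      "{z \<in> vecs Z. \<forall>r\<in>R. r (z - u x) < \<epsilon>} \<subseteq> U"
      using U unfolding openin_lcs_topology lcs_openin_def by auto
    \<comment> \<open>A single radius \<open>\<epsilon> / M\<close> then suits all of the finitely
      many seminorms in \<open>R\<close>; the summand 1 keeps \<open>M\<close> positive when
      \<open>R\<close> is empty.\<close>
    define M where "M = 1 + (\<Sum>r\<in>R. C r)"
    have C_nn: "0 \<le> C r" if "r \<in> R" for r using C[of r] R(2) that by force
    have M: "C r \<le> M" if "r \<in> R" for r
      using member_le_sum[of r R C] that R(1) C_nn by (force simp: M_def)
    have M0: "M > 0" using sum_nonneg[of R C] C_nn by (fastforce simp: M_def)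
    have "u y \<in> U" if y: "y \<in> vecs X" "\<forall>q\<in>q ` R. q (y - x) < \<epsilon> / M" for y
    proof -
      have "r (u y - u x) < \<epsilon>" if r: "r \<in> R" for r
      proof -
        have r': "r \<in> snorms Z" using R(2) r by blast
        have "r (u y - u x) = r (u (y - x))" using lin y(1) x by simp
        also have "\<dots> \<le> C r * q r (y - x)" using x y(1) r' by (intro qC diff) auto
        also have "\<dots> < C r * (\<epsilon> / M)" using C[OF r'] y(2) r by (intro mult_strict_left_mono) auto
        also have "\<dots> \<le> M * (\<epsilon> / M)" using M[OF r] M0 R(3) by (intro mult_right_mono) auto
        finally show ?thesis using M0 by simp
      qed
      then show ?thesis using R(4) maps[OF y(1)] by auto
    qed
    then show "\<exists>Q \<delta>. finite Q \<and> Q \<subseteq> snorms X \<and> \<delta> > 0 \<and>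
        {y \<in> vecs X. \<forall>q\<in>Q. q (y - x) < \<delta>} \<subseteq> {x \<in> topspace (lcs_topology X). u x \<in> U}"
      using R q M0 by (intro exI[of _ "q ` R"] exI[of _ "\<epsilon> / M"]) auto
  qed auto
qed

text \<open>With the scalar field as a target space, the criteria for continuous linear maps
  specialise to functionals.\<close>

definition scalar_lcs :: "('k::real_or_complex, 'k) lcs" where
  "scalar_lcs = \<lparr>vecs = UNIV, scl = (*), snorms = {norm}\<rparr>"

lemma scalar_lcs_simps [simp]:
  "vecs scalar_lcs = UNIV" "scl scalar_lcs = (*)" "snorms scalar_lcs = {norm}"
  by (simp_all add: scalar_lcs_def)

lemma lcs_topology_scalar [simp]:
  "lcs_topology (scalar_lcs :: ('k::real_or_complex, 'k) lcs) = euclidean"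
proof -
  have "lcs_openin scalar_lcs U \<longleftrightarrow> open U" for U :: "'k set"
  proof
    assume "open U"
    then show "lcs_openin scalar_lcs U" 
      unfolding lcs_openin_def open_dist
      by (force simp: dist_norm intro: exI[of _ "{norm}"])
  next
    assume U: "lcs_openin scalar_lcs U"
    show "open U"
      unfolding open_dist
    proof
      fix x assume "x \<in> U"
      then obtain Q \<epsilon> where Q: "Q \<subseteq> {norm}" "\<epsilon> > 0" "{y. \<forall>q\<in>Q. q (y - x) < \<epsilon>} \<subseteq> U"
        using U unfolding lcs_openin_def by auto
      then have "y \<in> U" if "dist y x < \<epsilon>" for y
        using that by (auto simp: dist_norm)
      then show "\<exists>e>0. \<forall>y. dist y x < e \<longrightarrow> y \<in> U" using Q(2) by blast
    qed
  qed
  then show ?thesis by (simp add: topology_eq openin_lcs_topology)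
qed

section \<open>Absolutely convex sets, balls and bounded linear maps\<close>

lemma abs_convexD:
  assumes "abs_convex X D"
  shows "D \<noteq> {}" "D \<subseteq> vecs X"
    "\<And>x y a b. x \<in> D \<Longrightarrow> y \<in> D \<Longrightarrow> norm a + norm b \<le> 1 \<Longrightarrow> scl X a x + scl X b y \<in> D"
  using assms unfolding abs_convex_def by blast+

text \<open>Separation and non-triviality are left out: the weighted spaces and their duals, to
  which this is applied, may be zero.\<close>

locale lc_space = subspace_of "scl X" "vecs X" for X :: "('k::real_or_complex, 'v::ab_group_add) lcs" +
  assumes snorm: "q \<in> snorms X \<Longrightarrow> seminorm_on (vecs X) (scl X) q"
    and directed: "directed_seminorms X"
begin

lemma abs_convex_scale:
  assumes "abs_convex X D" "x \<in> D" "norm a \<le> 1"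
  shows "scl X a x \<in> D"
  using abs_convexD(3)[OF assms(1,2,2), of a 0] assms(3) by simp

lemma abs_convex_0: "abs_convex X D \<Longrightarrow> 0 \<in> D"
  using abs_convex_scale[of D _ 0] abs_convexD(1) by fastforce

lemma abs_convex_uminus: "abs_convex X D \<Longrightarrow> x \<in> D \<Longrightarrow> - x \<in> D"
  using abs_convex_scale[of D x "-1"] by simp

lemma snorm_nonneg: "q \<in> snorms X \<Longrightarrow> x \<in> vecs X \<Longrightarrow> 0 \<le> q x"
  using seminorm_on_nonneg[OF snorm] .

lemma openin_ball: "q \<in> snorms X \<Longrightarrow> l \<in> vecs X \<Longrightarrow> openin (lcs_topology X) {y \<in> vecs X. q (y - l) < \<epsilon>}"
  by (rule openin_lcs_ball) (auto intro: V_diff seminorm_on_add[OF snorm])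

lemma finite_dominated:
  assumes "finite Q" "Q \<subseteq> snorms X"
  shows "\<exists>r\<in>snorms X. \<exists>C>0. \<forall>q\<in>Q. \<forall>x\<in>vecs X. q x \<le> C * r x"
  using assms
proof (induction Q)
  case empty
  then show ?case using directed unfolding directed_seminorms_def by (auto intro: exI[of _ 1])
next
  case (insert p Q)
  then obtain r C where r: "r \<in> snorms X" "C > 0" "\<forall>q\<in>Q. \<forall>x\<in>vecs X. q x \<le> C * r x" by auto
  obtain t B where t: "t \<in> snorms X" "B \<ge> 0" "\<forall>x\<in>vecs X. p x \<le> B * t x \<and> r x \<le> B * t x"
    using directed insert.prems r(1) unfolding directed_seminorms_def by (metis insert_subset)
  \<comment> \<open>The factor has to exceed both \<open>B\<close>, needed for the new seminorm, and
    \<open>C * B\<close>, needed for the old ones; the final 1 makes it positive even if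
    \<open>B\<close> is 0.\<close>
  have "q x \<le> (B * (1 + C) + 1) * t x" if "x \<in> vecs X" "q \<in> Q" for x q
  proof -
    have "q x \<le> C * r x" using r(3) that by blast
    also have "\<dots> \<le> C * (B * t x)" using t(3) that r(2) by (intro mult_left_mono) auto
    also have "\<dots> = (C * B) * t x" by simp
    also have "\<dots> \<le> (B * (1 + C) + 1) * t x"
      using t(2) r(2) snorm_nonneg[OF t(1) that(1)] by (intro mult_right_mono) (auto simp: algebra_simps)
    finally show ?thesis .
  qed
  moreover have "p x \<le> (B * (1 + C) + 1) * t x" if "x \<in> vecs X" for x
  proof -
    have "B * t x \<le> (B * (1 + C) + 1) * t x"
      using t(2) r(2) snorm_nonneg[OF t(1) that] by (intro mult_right_mono) (auto simp: algebra_simps)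
    then show "p x \<le> (B * (1 + C) + 1) * t x" using t(3) that by force
  qed
  moreover have "B * (1 + C) + 1 > 0" using t(2) r(2) by (simp add: add_nonneg_pos)
  ultimately show ?case using t(1) by (metis insert_iff)
qed

lemma open_contains_ball:
  assumes "openin (lcs_topology X) U" "x \<in> U"
  obtains q \<epsilon> where "q \<in> snorms X" "\<epsilon> > 0" "{y \<in> vecs X. q (y - x) < \<epsilon>} \<subseteq> U"
proof -
  obtain Q \<epsilon> where Q: "finite Q" "Q \<subseteq> snorms X" "\<epsilon> > 0" "{y \<in> vecs X. \<forall>q\<in>Q. q (y - x) < \<epsilon>} \<subseteq> U" "x \<in> vecs X"
    using assms unfolding openin_lcs_topology lcs_openin_def by blast
  obtain r C where r: "r \<in> snorms X" "C > 0" "\<forall>q\<in>Q. \<forall>x\<in>vecs X. q x \<le> C * r x"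
    using finite_dominated[OF Q(1,2)] by blast
  have "q (y - x) < \<epsilon>" if "q \<in> Q" "y \<in> vecs X" "r (y - x) < \<epsilon> / C" for q y
  proof -
    have "q (y - x) \<le> C * r (y - x)" using r(3) that V_diff[OF that(2) Q(5)] by blast
    also have "\<dots> < \<epsilon>" using r(2) that(3) by (simp add: field_simps)
    finally show ?thesis .
  qed
  then show ?thesis using Q r by (intro that[of r "\<epsilon> / C"]) auto
qed

lemma limitin_iff:
  "limitin (lcs_topology X) f l G \<longleftrightarrow>
     l \<in> vecs X \<and> (\<forall>q\<in>snorms X. \<forall>\<epsilon>>0. eventually (\<lambda>a. f a \<in> vecs X \<and> q (f a - l) < \<epsilon>) G)"
proof
  assume L: "limitin (lcs_topology X) f l G"
  then have l: "l \<in> vecs X" by (auto simp: limitin_def)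
  have "eventually (\<lambda>a. f a \<in> {y \<in> vecs X. q (y - l) < \<epsilon>}) G" if "q \<in> snorms X" "\<epsilon> > 0" for q \<epsilon>
    using L openin_ball[OF that(1) l, of \<epsilon>] l that seminorm_on_0[OF snorm[OF that(1)]]
    unfolding limitin_def by auto
  then show "l \<in> vecs X \<and> (\<forall>q\<in>snorms X. \<forall>\<epsilon>>0. eventually (\<lambda>a. f a \<in> vecs X \<and> q (f a - l) < \<epsilon>) G)"
    using l by simp
next
  assume R: "l \<in> vecs X \<and> (\<forall>q\<in>snorms X. \<forall>\<epsilon>>0. eventually (\<lambda>a. f a \<in> vecs X \<and> q (f a - l) < \<epsilon>) G)"
  show "limitin (lcs_topology X) f l G"
    unfolding limitin_def
  proof (intro conjI allI impI)
    fix U assume "openin (lcs_topology X) U \<and> l \<in> U"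
    then obtain q \<epsilon> where q: "q \<in> snorms X" "\<epsilon> > 0" "{y \<in> vecs X. q (y - l) < \<epsilon>} \<subseteq> U"
      using open_contains_ball by metis
    then have "eventually (\<lambda>a. f a \<in> vecs X \<and> q (f a - l) < \<epsilon>) G" using R by blast
    then show "eventually (\<lambda>a. f a \<in> U) G" by eventually_elim (use q(3) in auto)
  qed (use R in auto)
qed

lemma in_closure_iff:
  assumes "A \<subseteq> vecs X"
  shows "x \<in> lcs_topology X closure_of A \<longleftrightarrow>
    x \<in> vecs X \<and> (\<forall>q\<in>snorms X. \<forall>\<epsilon>>0. \<exists>a\<in>A. q (a - x) < \<epsilon>)"
proof
  assume L: "x \<in> lcs_topology X closure_of A"
  then have x: "x \<in> vecs X" by (auto simp: in_closure_of)
  have "\<exists>a\<in>A. q (a - x) < \<epsilon>" if h: "q \<in> snorms X" "\<epsilon> > 0" for q \<epsilon>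
  proof -
    have "x \<in> {y \<in> vecs X. q (y - x) < \<epsilon>}"
      using x h(2) seminorm_on_0[OF snorm[OF h(1)]] by simp
    then obtain a where "a \<in> A" "a \<in> {y \<in> vecs X. q (y - x) < \<epsilon>}"
      using L openin_ball[OF h(1) x] unfolding in_closure_of by meson
    then show ?thesis by blast
  qed
  then show "x \<in> vecs X \<and> (\<forall>q\<in>snorms X. \<forall>\<epsilon>>0. \<exists>a\<in>A. q (a - x) < \<epsilon>)" using x by simp
next
  assume R: "x \<in> vecs X \<and> (\<forall>q\<in>snorms X. \<forall>\<epsilon>>0. \<exists>a\<in>A. q (a - x) < \<epsilon>)"
  have "\<exists>a. a \<in> A \<and> a \<in> U" if "x \<in> U" "openin (lcs_topology X) U" for U
  proof -
    obtain q \<epsilon> where "q \<in> snorms X" "\<epsilon> > 0" "{y \<in> vecs X. q (y - x) < \<epsilon>} \<subseteq> U"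
      using open_contains_ball \<open>x \<in> U\<close> \<open>openin (lcs_topology X) U\<close> by metis
    then show ?thesis using R assms by blast
  qed
  then show "x \<in> lcs_topology X closure_of A" using R by (auto simp: in_closure_of)
qed

text \<open>The compact sets that define the topology of compact convergence have to be absolutely
  convex; this makes the closures of polar images admissible.\<close>

lemma abs_convex_closure_of:
  assumes A: "abs_convex X A"
  shows "abs_convex X (lcs_topology X closure_of A)"
  unfolding abs_convex_def
proof (intro conjI ballI allI impI)
  note AV = abs_convexD(2)[OF A]
  have "A \<subseteq> lcs_topology X closure_of A" using AV by (intro closure_of_subset) simp
  then show "lcs_topology X closure_of A \<noteq> {}" using abs_convexD(1)[OF A] by blast
  show "lcs_topology X closure_of A \<subseteq> vecs X"
    using closure_of_subset_topspace[of "lcs_topology X" A] by simp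
  fix x y and a b :: 'k assume x: "x \<in> lcs_topology X closure_of A" and y: "y \<in> lcs_topology X closure_of A"
    and ab: "norm a + norm b \<le> 1"
  have xV: "x \<in> vecs X" and yV: "y \<in> vecs X"
    using x y by (auto simp: in_closure_iff[OF AV])
  have "\<exists>z\<in>A. q (z - (scl X a x + scl X b y)) < \<epsilon>" if q: "q \<in> snorms X" and e: "\<epsilon> > 0" for q \<epsilon>
  proof -
    obtain x' where x': "x' \<in> A" "q (x' - x) < \<epsilon> / 2"
      using x q half_gt_zero[OF e] unfolding in_closure_iff[OF AV] by blast
    obtain y' where y': "y' \<in> A" "q (y' - y) < \<epsilon> / 2"
      using y q half_gt_zero[OF e] unfolding in_closure_iff[OF AV] by blast
    have d: "x' - x \<in> vecs X" "y' - y \<in> vecs X" using AV x' y' xV yV by (auto intro: V_diff)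
    have "scl X a x' + scl X b y' - (scl X a x + scl X b y) = scl X a (x' - x) + scl X b (y' - y)"
      by (simp add: scale_right_diff_distrib)
    also have "q \<dots> \<le> q (scl X a (x' - x)) + q (scl X b (y' - y))"
      by (intro seminorm_on_add[OF snorm[OF q]] V_scale d)
    also have "\<dots> = norm a * q (x' - x) + norm b * q (y' - y)"
      using seminorm_on_scale[OF snorm[OF q]] d by simp
    also have "\<dots> \<le> 1 * q (x' - x) + 1 * q (y' - y)"
    proof (intro add_mono mult_right_mono)
      show "norm a \<le> 1" "norm b \<le> 1"
        using order_trans[OF _ ab, of "norm a"] order_trans[OF _ ab, of "norm b"] by simp_all
    qed (use snorm_nonneg[OF q] d in auto)
    also have "\<dots> < \<epsilon>" using x' y' by simp
    finally show ?thesis using abs_convexD(3)[OF A x'(1) y'(1) ab] by blast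
  qed
  then show "scl X a x + scl X b y \<in> lcs_topology X closure_of A"
    unfolding in_closure_iff[OF AV] using xV yV by (auto intro: V_add V_scale)
qed

lemma Hausdorff_eq_0:
  assumes "Hausdorff_space (lcs_topology X)" "x \<in> vecs X" "\<And>q. q \<in> snorms X \<Longrightarrow> q x = 0"
  shows "x = 0"
proof (rule ccontr)
  assume "x \<noteq> 0"
  then obtain U W where UW: "openin (lcs_topology X) U" "openin (lcs_topology X) W" "x \<in> W" "0 \<in> U" "disjnt W U"
    using assms(1,2) V_0 unfolding Hausdorff_space_def by (metis topspace_lcs_topology)
  then obtain q \<epsilon> where "q \<in> snorms X" "\<epsilon> > 0" "{y \<in> vecs X. q (y - 0) < \<epsilon>} \<subseteq> U"
    using open_contains_ball by metis
  then have "x \<in> U" using assms(2) assms(3)[of q] by auto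
  then show False using UW by (auto simp: disjnt_iff)
qed

text \<open>Rescaling moves \<open>x\<close> into the ball. The scaling uses an arbitrary
  \<open>t\<close> above \<open>q x\<close> instead of \<open>q x\<close> itself, which may vanish,
  and \<open>t\<close> then tends to \<open>q x\<close>.\<close>

lemma homogeneous_bound:
  assumes q: "q \<in> snorms X" and \<epsilon>: "\<epsilon> > 0"
    and h: "\<And>x a. x \<in> vecs X \<Longrightarrow> a > 0 \<Longrightarrow> h (scl X (of_real a) x) = a * h x"
    and ball: "\<And>x. x \<in> vecs X \<Longrightarrow> q x < \<epsilon> \<Longrightarrow> h x < (1::real)"
    and x: "x \<in> vecs X"
  shows "h x \<le> (1 / \<epsilon>) * q x"
proof -
  have "\<epsilon> * h x \<le> t" if t: "q x < t" for t
  proof -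
    have t0: "t > 0" using snorm_nonneg[OF q x] t by linarith
    have "q (scl X (of_real (\<epsilon> / t)) x) = (\<epsilon> / t) * q x"
      using seminorm_on_scale[OF snorm[OF q] x, of "of_real (\<epsilon> / t)"] \<epsilon> t0 unfolding norm_of_real by simp
    also have "\<dots> < \<epsilon>" using \<epsilon> t t0 by (simp add: field_simps)
    finally have "h (scl X (of_real (\<epsilon> / t)) x) < 1" by (intro ball V_scale x)
    then have "(\<epsilon> / t) * h x < 1" using h[OF x, of "\<epsilon> / t"] \<epsilon> t0 by simp
    then show ?thesis using t0 by (simp add: field_simps)
  qed
  then have "\<epsilon> * h x \<le> q x" by (rule dense_ge)
  then show ?thesis using \<epsilon> by (simp add: field_simps)
qed

lemma continuous_map_imp_bounded:
  assumes Z: "lc_space Z" and u: "linear_on (vecs X) (scl X) (scl Z) u"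
    and cont: "continuous_map (lcs_topology X) (lcs_topology Z) u" and r: "r \<in> snorms Z"
  shows "\<exists>q\<in>snorms X. \<exists>C>0. \<forall>x\<in>vecs X. r (u x) \<le> C * q x"
proof -
  interpret Z: lc_space Z by (rule Z)
  have uV: "u x \<in> vecs Z" if "x \<in> vecs X" for x
    using cont that by (auto simp: continuous_map_def)
  have u0: "u 0 = 0" using linear_on_scale[OF u V_0, of 0] by simp
  have "openin (lcs_topology Z) {z \<in> vecs Z. r (z - 0) < 1}" by (rule Z.openin_ball[OF r Z.V_0])
  then have "openin (lcs_topology X) {x \<in> vecs X. u x \<in> {z \<in> vecs Z. r (z - 0) < 1}}"
    using cont unfolding continuous_map_def topspace_lcs_topology by blast
  moreover have "0 \<in> {x \<in> vecs X. u x \<in> {z \<in> vecs Z. r (z - 0) < 1}}"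
    using V_0 Z.V_0 u0 Z.seminorm_on_0[OF Z.snorm[OF r]] by simp
  ultimately obtain q \<epsilon> where q: "q \<in> snorms X" "\<epsilon> > 0"
    and sub: "{y \<in> vecs X. q (y - 0) < \<epsilon>} \<subseteq> {x \<in> vecs X. u x \<in> {z \<in> vecs Z. r (z - 0) < 1}}"
    by (rule open_contains_ball)
  have "r (u x) \<le> (1 / \<epsilon>) * q x" if x: "x \<in> vecs X" for x
  proof (rule homogeneous_bound[OF q _ _ x])
    fix z and a :: real assume z: "z \<in> vecs X" and a: "a > 0"
    show "r (u (scl X (of_real a) z)) = a * r (u z)"
      using linear_on_scale[OF u z, of "of_real a"] a
        seminorm_on_scale[OF Z.snorm[OF r] uV[OF z], of "of_real a"] by simp
  next
    fix z assume "z \<in> vecs X" "q z < \<epsilon>"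
    then show "r (u z) < 1" using sub by auto
  qed
  then show ?thesis using q by (intro bexI[of _ q] exI[of _ "1 / \<epsilon>"]) auto
qed

end

lemma lc_space_scalar: "lc_space (scalar_lcs :: ('k::real_or_complex, 'k) lcs)"
proof -
  have vs: "vector_space ((*) :: 'k \<Rightarrow> 'k \<Rightarrow> 'k)"
    by unfold_locales (auto simp: algebra_simps)
  interpret vector_space "(*) :: 'k \<Rightarrow> 'k \<Rightarrow> 'k" by (rule vs)
  show ?thesis
    by unfold_locales
      (auto simp: algebra_simps seminorm_on_def norm_triangle_ineq norm_mult directed_seminorms_def
        intro: exI[of _ 1])
qed

section \<open>The continuous dual\<close>

context lc_space
begin

lemma dual_iff:
  "y \<in> dual X \<longleftrightarrow> linear_on (vecs X) (scl X) (*) y \<and>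
     (\<exists>q\<in>snorms X. \<exists>C>0. \<forall>x\<in>vecs X. norm (y x) \<le> C * q x) \<and> (\<forall>x. x \<notin> vecs X \<longrightarrow> y x = 0)"
proof -
  have "continuous_map (lcs_topology X) euclidean y \<longleftrightarrow>
      (\<exists>q\<in>snorms X. \<exists>C>0. \<forall>x\<in>vecs X. norm (y x) \<le> C * q x)"
    if lin: "linear_on (vecs X) (scl X) (*) y"
  proof
    assume "continuous_map (lcs_topology X) euclidean y"
    then show "\<exists>q\<in>snorms X. \<exists>C>0. \<forall>x\<in>vecs X. norm (y x) \<le> C * q x"
      using continuous_map_imp_bounded[OF lc_space_scalar, of y norm] lin by simp
  next
    assume "\<exists>q\<in>snorms X. \<exists>C>0. \<forall>x\<in>vecs X. norm (y x) \<le> C * q x"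
    moreover have "y (a - b) = y a - y b" if "a \<in> vecs X" "b \<in> vecs X" for a b
      using linear_on_add[OF lin V_diff[OF that] that(2)] by simp
    ultimately have "continuous_map (lcs_topology X) (lcs_topology scalar_lcs) y"
      by (intro bounded_imp_continuous_map V_diff) auto
    then show "continuous_map (lcs_topology X) euclidean y" by simp
  qed
  then show ?thesis unfolding dual_def by blast
qed

lemma dual_linear: "y \<in> dual X \<Longrightarrow> linear_on (vecs X) (scl X) (*) y"
  and dual_off: "y \<in> dual X \<Longrightarrow> x \<notin> vecs X \<Longrightarrow> y x = 0"
  and dual_continuous: "y \<in> dual X \<Longrightarrow> continuous_map (lcs_topology X) euclidean y"
  by (auto simp: dual_def)

lemma dual_bound:
  assumes "y \<in> dual X"
  obtains q C where "q \<in> snorms X" "C > 0" "\<And>x. x \<in> vecs X \<Longrightarrow> norm (y x) \<le> C * q x"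
  using assms unfolding dual_iff by blast

end

lemma vector_space_functions: "vector_space (\<lambda>c (y :: 'v \<Rightarrow> 'k::field) x. c * y x)"
  by unfold_locales (auto simp: algebra_simps fun_eq_iff)

lemma sum_fun_apply: "(\<Sum>a\<in>A. f a) x = (\<Sum>a\<in>A. f a x)"
  for f :: "'a \<Rightarrow> 'b \<Rightarrow> 'c::comm_monoid_add"
  by (induction A rule: infinite_finite_induct) auto

lemma (in lc_space) subspace_dual: "module.subspace (\<lambda>c y x. c * y x) (dual X)"
proof -
  interpret f: vector_space "\<lambda>c (y :: 'v \<Rightarrow> 'k) x. c * y x" by (rule vector_space_functions)
  show ?thesis
  proof (rule f.subspaceI)
    obtain q where "q \<in> snorms X" using directed unfolding directed_seminorms_def by blast
    then show "0 \<in> dual X"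
      unfolding dual_iff by (auto simp: linear_on_def snorm_nonneg intro!: bexI[of _ q] exI[of _ 1])
  next
    fix y z assume y: "y \<in> dual X" and z: "z \<in> dual X"
    obtain p B where p: "p \<in> snorms X" "B > 0" "\<And>x. x \<in> vecs X \<Longrightarrow> norm (y x) \<le> B * p x"
      using dual_bound[OF y] by blast
    obtain q C where q: "q \<in> snorms X" "C > 0" "\<And>x. x \<in> vecs X \<Longrightarrow> norm (z x) \<le> C * q x"
      using dual_bound[OF z] by blast
    obtain r A where r: "r \<in> snorms X" "A > 0" "\<forall>q'\<in>{p, q}. \<forall>x\<in>vecs X. q' x \<le> A * r x"
      using finite_dominated[of "{p, q}"] p q by auto
    have "norm (y x + z x) \<le> ((B + C) * A) * r x" if x: "x \<in> vecs X" for x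
    proof -
      have "norm (y x + z x) \<le> B * p x + C * q x"
        using norm_triangle_ineq[of "y x" "z x"] p(3)[OF x] q(3)[OF x] by linarith
      also have "\<dots> \<le> B * (A * r x) + C * (A * r x)"
        using r(3) x p(2) q(2) by (intro add_mono mult_left_mono) auto
      finally show ?thesis by (simp add: algebra_simps)
    qed
    moreover have "(B + C) * A > 0" using p q r by simp
    ultimately have "\<exists>q\<in>snorms X. \<exists>C>0. \<forall>x\<in>vecs X. norm ((y + z) x) \<le> C * q x"
      using r(1) by (intro bexI[of _ r] exI[of _ "(B + C) * A"]) auto
    then show "y + z \<in> dual X"
      using dual_linear[OF y] dual_linear[OF z] dual_off[OF y] dual_off[OF z]
      unfolding dual_iff by (auto simp: linear_on_def algebra_simps)
  next
    fix c y assume y: "y \<in> dual X"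
    obtain q C where q: "q \<in> snorms X" "C > 0" "\<And>x. x \<in> vecs X \<Longrightarrow> norm (y x) \<le> C * q x"
      using dual_bound[OF y] by blast
    have "norm (c * y x) \<le> ((norm c + 1) * C) * q x" if x: "x \<in> vecs X" for x
    proof -
      have "norm (c * y x) \<le> (norm c + 1) * norm (y x)" by (simp add: norm_mult algebra_simps)
      also have "\<dots> \<le> (norm c + 1) * (C * q x)" by (intro mult_left_mono q x) simp
      finally show ?thesis by simp
    qed
    moreover have "(norm c + 1) * C > 0" using q by (simp add: add_nonneg_pos)
    ultimately have "\<exists>q\<in>snorms X. \<exists>C>0. \<forall>x\<in>vecs X. norm (c * y x) \<le> C * q x"
      using q(1) by (intro bexI[of _ q] exI[of _ "(norm c + 1) * C"]) auto
    then show "(\<lambda>x. c * y x) \<in> dual X"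
      using dual_linear[OF y] dual_off[OF y]
      unfolding dual_iff by (auto simp: linear_on_def algebra_simps)
  qed
qed

section \<open>Compact sets and the dual with the topology of compact convergence\<close>

text \<open>If \<open>x\<close> minimises the squared distance from the vector of values on \<open>Y0\<close> to \<open>\<phi>\<close> over \<open>K\<close>, then
  the first variation at \<open>x\<close> bounds the functional \<open>w\<close> formed with the residual, and this contradicts
  the assumed bound on \<open>\<phi>\<close> unless the residual vanishes.\<close>

lemma compact_interpolation:
  fixes Y :: "('v::ab_group_add \<Rightarrow> 'k::real_or_complex) set"
  assumes X: "subspace_of (scl X) (vecs X)"
    and K: "compactin T K" "abs_convex X K"
    and Y: "module.subspace (\<lambda>c y x. c * y x) Y"
    and lin: "\<And>y. y \<in> Y \<Longrightarrow> linear_on (vecs X) (scl X) (*) y"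
    and cont: "\<And>y. y \<in> Y \<Longrightarrow> continuous_map T euclidean y"
    and \<phi>: "linear_on Y (\<lambda>c y x. c * y x) (*) \<phi>"
    and bnd: "\<And>y B. y \<in> Y \<Longrightarrow> (\<And>x. x \<in> K \<Longrightarrow> norm (y x) \<le> B) \<Longrightarrow> norm (\<phi> y) \<le> B"
    and Y0: "finite Y0" "Y0 \<subseteq> Y"
  shows "\<exists>x\<in>K. \<forall>y\<in>Y0. y x = \<phi> y"
proof -
  interpret subspace_of "scl X" "vecs X" by (rule X)
  interpret f: subspace_of "\<lambda>c (y :: 'v \<Rightarrow> 'k) x. c * y x" Y
    using vector_space_functions Y by (simp add: subspace_of_def subspace_of_axioms_def)
  define g where "g x = (\<Sum>y\<in>Y0. (norm (y x - \<phi> y))\<^sup>2)" for x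
  have "continuous_map T euclideanreal (\<lambda>x. (norm (y x - \<phi> y))\<^sup>2)" if "y \<in> Y0" for y
  proof -
    have "continuous_map euclidean euclideanreal (\<lambda>z::'k. (norm (z - \<phi> y))\<^sup>2)"
      by (simp add: continuous_intros)
    then show ?thesis
      using continuous_map_compose[OF cont, of y euclideanreal] Y0(2) that by (auto simp: comp_def)
  qed
  then have "continuous_map T euclideanreal g"
    unfolding g_def by (intro continuous_map_sum Y0)
  then have "compact (g ` K)"
    using image_compactin[OF K(1), of euclideanreal g] by simp
  then obtain x where x: "x \<in> K" "\<And>z. z \<in> K \<Longrightarrow> g x \<le> g z"
    using compact_attains_inf[of "g ` K"] abs_convexD(1)[OF K(2)] by auto
  define d where "d y = y x - \<phi> y" for y
  \<comment> \<open>With the conjugated residuals as weights, the real part of the sum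
    \<open>w\<close> is half the derivative of \<open>g\<close> at \<open>x\<close>.\<close>
  define F where "F y = (\<lambda>x. kcnj (d y) * y x)" for y :: "'v \<Rightarrow> 'k"
  have FY: "F y \<in> Y" and \<phi>F: "\<phi> (F y) = kcnj (d y) * \<phi> y" if "y \<in> Y" for y
    using f.V_scale[OF that] linear_on_scale[OF \<phi> that] by (simp_all add: F_def)
  define w where "w = (\<Sum>y\<in>Y0. F y)"
  have w_apply: "w z = (\<Sum>y\<in>Y0. kcnj (d y) * y z)" for z
    by (simp add: w_def sum_fun_apply F_def)
  have sumY: "(\<Sum>y\<in>A. F y) \<in> Y" if "A \<subseteq> Y" for A
    using that FY by (intro f.subspace_sum f.sub) auto
  have wY: "w \<in> Y" unfolding w_def by (rule sumY[OF Y0(2)])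
  have \<phi>w: "\<phi> w = (\<Sum>y\<in>Y0. kcnj (d y) * \<phi> y)"
    unfolding w_def using Y0
  proof (induction Y0)
    case empty
    show ?case using linear_on_scale[OF \<phi> f.V_0, of 0] by (simp add: zero_fun_def)
  next
    case (insert y A)
    then have "\<phi> (F y + (\<Sum>y\<in>A. F y)) = \<phi> (F y) + \<phi> (\<Sum>y\<in>A. F y)"
      by (intro linear_on_add[OF \<phi>] FY sumY) auto
    moreover have "\<phi> (F y) = kcnj (d y) * \<phi> y" using insert.prems by (intro \<phi>F) auto
    ultimately show ?case using insert.IH insert.prems
      by (simp only: sum.insert[OF insert.hyps] insert_subset simp_thms)
  qed
  have KV: "K \<subseteq> vecs X" by (rule abs_convexD(2)[OF K(2)])
  have var: "kre (w x) \<le> kre (w z)" if z: "z \<in> K" for z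
  proof -
    define h where "h y = y z - y x" for y :: "'v \<Rightarrow> 'k"
    define A where "A = (\<Sum>y\<in>Y0. kre (kcnj (d y) * h y))"
    define B where "B = (\<Sum>y\<in>Y0. (norm (h y))\<^sup>2)"
    \<comment> \<open>The segment from \<open>x\<close> to \<open>z\<close> stays in
      \<open>K\<close>, and along it \<open>g\<close> is a quadratic polynomial in \<open>t\<close>
      that is smallest at 0. One factor \<open>t\<close> is divided out.\<close>
    have step: "0 \<le> 2 * A + t * B" if t: "0 < t" "t \<le> 1" for t
    proof -
      define v where "v = scl X (of_real (1 - t)) x + scl X (of_real t) z"
      have n: "norm (of_real (1 - t) :: 'k) + norm (of_real t :: 'k) \<le> 1"
        using t unfolding norm_of_real by simp
      have v: "v \<in> K" unfolding v_def by (rule abs_convexD(3)[OF K(2) x(1) z n])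
      have "(norm (y v - \<phi> y))\<^sup>2 = (norm (d y))\<^sup>2 + 2 * t * kre (kcnj (d y) * h y) + t\<^sup>2 * (norm (h y))\<^sup>2"
        if y: "y \<in> Y0" for y
      proof -
        have l: "linear_on (vecs X) (scl X) (*) y" using lin Y0 y by blast
        have "y v = of_real (1 - t) * y x + of_real t * y z"
          using linear_on_add[OF l V_scale V_scale] linear_on_scale[OF l] KV x(1) z unfolding v_def
          by (metis subsetD)
        then have "y v - \<phi> y = d y + of_real t * h y"
          by (simp add: d_def h_def algebra_simps)
        moreover have "kre (kcnj (d y) * (of_real t * h y)) = t * kre (kcnj (d y) * h y)"
          using kre_scale[of t "kcnj (d y) * h y"] by (simp add: algebra_simps)
        ultimately show ?thesis
          by (simp add: norm_add_squared norm_mult power_mult_distrib)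
      qed
      then have "g v = g x + 2 * t * A + t\<^sup>2 * B"
        unfolding g_def A_def B_def d_def[symmetric]
        by (simp add: sum.distrib sum_distrib_left)
      then have "0 \<le> t * (2 * A + t * B)"
        using x(2)[OF v] by (simp add: power2_eq_square algebra_simps)
      then show ?thesis using t(1) by (simp add: zero_le_mult_iff)
    qed
    \<comment> \<open>As \<open>t\<close> tends to 0 from the right only the linear coefficient
      survives.\<close>
    have "((\<lambda>t. 2 * A + t * B) \<longlongrightarrow> 2 * A + 0 * B) (at_right 0)"
      by (intro tendsto_intros)
    moreover have "eventually (\<lambda>t. 0 \<le> 2 * A + t * B) (at_right 0)"
      unfolding eventually_at_right_field using step by (intro exI[of _ 1]) auto
    ultimately have "0 \<le> 2 * A + 0 * B"
      by (intro tendsto_lowerbound) auto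
    then have "0 \<le> A" by simp
    moreover have "kre (w z) - kre (w x) = A"
      unfolding w_apply A_def kre_sum h_def
      by (simp add: sum_subtractf right_diff_distrib kre_diff)
    ultimately show ?thesis by simp
  qed
  have wl: "linear_on (vecs X) (scl X) (*) w" using lin wY by blast
  have "norm (w z) \<le> - kre (w x)" if z: "z \<in> K" for z
  proof -
    obtain c where c: "norm c = 1" "c * w z = of_real (norm (w z))" using unimodular_rotation by blast
    \<comment> \<open>Absolute convexity permits the rotation by \<open>- c\<close>, which turns the
      one-sided inequality for real parts into a bound for the modulus on all of
      \<open>K\<close>.\<close>
    have "scl X (- c) z \<in> K" using abs_convexD(3)[OF K(2) z z, of "- c" 0] c(1) by simp
    then have "kre (w x) \<le> kre (w (scl X (- c) z))" by (rule var)
    also have "w (scl X (- c) z) = - (c * w z)" using linear_on_scale[OF wl, of z "- c"] KV z by auto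
    also have "kre \<dots> = - norm (w z)" unfolding kre_minus c(2) by simp
    finally show ?thesis by simp
  qed
  then have "norm (\<phi> w) \<le> - kre (w x)" by (rule bnd[OF wY])
  \<comment> \<open>Since \<open>\<phi> y\<close> is \<open>y x - d y\<close>, the value at
    \<open>w\<close> falls short of \<open>w x\<close> by exactly the squared residual. The bound
    \<open>norm (\<phi> w) \<le> - kre (w x)\<close> leaves no room for such a loss.\<close>
  moreover have "kre (\<phi> w) = kre (w x) - (\<Sum>y\<in>Y0. (norm (d y))\<^sup>2)"
  proof -
    have "kre (kcnj (d y) * \<phi> y) = kre (kcnj (d y) * y x) - (norm (d y))\<^sup>2" for y
    proof -
      have "kcnj (d y) * \<phi> y = kcnj (d y) * y x - kcnj (d y) * d y"
        unfolding right_diff_distrib[symmetric] by (simp add: d_def)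
      then show ?thesis by (simp only: kre_diff kcnj_mult_self kre_of_real)
    qed
    then show ?thesis unfolding \<phi>w w_apply kre_sum by (simp add: sum_subtractf)
  qed
  moreover have "- kre (\<phi> w) \<le> norm (\<phi> w)" using kre_le_norm[of "- \<phi> w"] by (simp add: kre_minus)
  ultimately have "(\<Sum>y\<in>Y0. (norm (d y))\<^sup>2) \<le> 0" by linarith
  then have "\<forall>y\<in>Y0. (norm (d y))\<^sup>2 = 0"
    using sum_nonneg_eq_0_iff[OF Y0(1), of "\<lambda>y. (norm (d y))\<^sup>2"]
      sum_nonneg[of Y0 "\<lambda>y. (norm (d y))\<^sup>2"] by simp
  then show ?thesis using x(1) by (auto simp: d_def)
qed

text \<open>This is the part of the Mackey--Arens theorem that is needed here.\<close>

theorem compact_representation: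
  fixes Y :: "('v::ab_group_add \<Rightarrow> 'k::real_or_complex) set"
  assumes X: "subspace_of (scl X) (vecs X)"
    and K: "compactin T K" "abs_convex X K"
    and Y: "module.subspace (\<lambda>c y x. c * y x) Y"
    and lin: "\<And>y. y \<in> Y \<Longrightarrow> linear_on (vecs X) (scl X) (*) y"
    and cont: "\<And>y. y \<in> Y \<Longrightarrow> continuous_map T euclidean y"
    and \<phi>: "linear_on Y (\<lambda>c y x. c * y x) (*) \<phi>"
    and C: "C > 0"
    and bnd: "\<And>y B. y \<in> Y \<Longrightarrow> (\<And>x. x \<in> K \<Longrightarrow> norm (y x) \<le> B) \<Longrightarrow> norm (\<phi> y) \<le> C * B"
  shows "\<exists>x\<in>vecs X. \<forall>y\<in>Y. \<phi> y = y x"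
proof -
  interpret subspace_of "scl X" "vecs X" by (rule X)
  \<comment> \<open>Interpolation needs the constant 1; the point found for \<open>\<psi>\<close> is
    multiplied by \<open>C\<close> at the end.\<close>
  define \<psi> where "\<psi> y = of_real (inverse C) * \<phi> y" for y
  have \<psi>: "linear_on Y (\<lambda>c y x. c * y x) (*) \<psi>"
    using \<phi> by (auto simp: linear_on_def \<psi>_def algebra_simps)
  have \<psi>_bnd: "norm (\<psi> y) \<le> B" if "y \<in> Y" "\<And>x. x \<in> K \<Longrightarrow> norm (y x) \<le> B" for y B
    using bnd[OF that] C by (simp add: \<psi>_def norm_mult norm_divide field_simps)
  define S where "S y = {x \<in> topspace T. y x \<in> {\<psi> y}}" for y
  \<comment> \<open>Finitely many equations are solvable in \<open>K\<close> by interpolation. Their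
    solution sets are closed, so compactness gives a common solution of all of them.\<close>
  have "K \<inter> \<Inter>\<F> \<noteq> {}" if fin: "finite \<F>" "\<F> \<subseteq> S ` Y" for \<F>
  proof -
    obtain Y0 where Y0: "finite Y0" "Y0 \<subseteq> Y" "\<F> = S ` Y0"
      using finite_subset_image[OF fin] by blast
    obtain x where "x \<in> K" "\<forall>y\<in>Y0. y x = \<psi> y"
      using compact_interpolation[OF X K Y lin cont \<psi> \<psi>_bnd Y0(1,2)] by blast
    then show ?thesis using Y0(3) compactin_subset_topspace[OF K(1)] by (auto simp: S_def)
  qed
  moreover have "closedin T (S y)" if "y \<in> Y" for y
    unfolding S_def by (rule closedin_continuous_map_preimage[OF cont[OF that]]) simp
  ultimately have "K \<inter> \<Inter>(S ` Y) \<noteq> {}"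
    using K(1)[unfolded compactin_fip, THEN conjunct2, rule_format, of "S ` Y"] by blast
  then obtain x where x: "x \<in> K" "\<And>y. y \<in> Y \<Longrightarrow> y x = \<psi> y" by (auto simp: S_def)
  have xV: "x \<in> vecs X" using x(1) abs_convexD(2)[OF K(2)] by blast
  have "\<phi> y = y (scl X (of_real C) x)" if "y \<in> Y" for y
  proof -
    have "y (scl X (of_real C) x) = of_real C * \<psi> y"
      using linear_on_scale[OF lin[OF that] xV] x(2)[OF that] by simp
    then show ?thesis using C by (simp add: \<psi>_def mult.assoc[symmetric] of_real_mult[symmetric] del: of_real_mult of_real_inverse)
  qed
  then show ?thesis using V_scale[OF xV] by blast
qed

section \<open>The seminorms of compact convergence and their duality\<close>

context lc_space
begin

text \<open>This makes the suprema in the seminorms of \<open>kappa_dual X\<close> genuine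
  suprema.\<close>

lemma dual_bdd_above_compact:
  assumes "y \<in> dual X" "compactin (lcs_topology X) K"
  shows "bdd_above ((\<lambda>x. norm (y x)) ` K)"
proof -
  have "compact (y ` K)" using image_compactin[OF assms(2) dual_continuous[OF assms(1)]]
    by (simp only: compactin_euclidean_iff)
  then have "bounded (y ` K)" by (rule compact_imp_bounded)
  then obtain B where B: "\<forall>z\<in>y ` K. norm z \<le> B" unfolding bounded_iff by (elim exE)
  show ?thesis by (rule bdd_aboveI2[of _ _ B]) (use B in simp)
qed

lemma kappa_dual_simps [simp]:
  "vecs (kappa_dual X) = dual X" "scl (kappa_dual X) = (\<lambda>c y x. c * y x)"
  by (simp_all add: kappa_dual_def)

lemma kappa_snorm_iff:
  "q \<in> snorms (kappa_dual X) \<longleftrightarrow>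
    (\<exists>K. q = (\<lambda>y. SUP x\<in>K. norm (y x)) \<and> abs_convex X K \<and> compactin (lcs_topology X) K)"
  by (auto simp: kappa_dual_def)

lemma kappa_snorm_le:
  assumes "abs_convex X K" "\<And>x. x \<in> K \<Longrightarrow> norm (y x) \<le> B"
  shows "(SUP x\<in>K. norm (y x)) \<le> B"
  using assms abs_convexD(1) by (intro cSUP_least) auto

lemma kappa_snorm_ge:
  assumes "compactin (lcs_topology X) K" "y \<in> dual X" "x \<in> K"
  shows "norm (y x) \<le> (SUP x\<in>K. norm (y x))"
  by (intro cSUP_upper dual_bdd_above_compact assms)

text \<open>The sum of two absolutely convex compact sets contains both of them, which is how the
  seminorms of compact convergence are seen to be directed.\<close>

lemma compactin_sums:
  assumes "compactin (lcs_topology X) K" "compactin (lcs_topology X) L"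
  shows "compactin (lcs_topology X) ((\<lambda>(x, y). x + y) ` (K \<times> L))"
proof (rule image_compactin)
  show "compactin (prod_topology (lcs_topology X) (lcs_topology X)) (K \<times> L)"
    using assms by (simp add: compactin_Times)
  show "continuous_map (prod_topology (lcs_topology X) (lcs_topology X)) (lcs_topology X) (\<lambda>(x, y). x + y)"
    unfolding continuous_map_def
  proof (intro conjI allI impI)
    fix U assume U: "openin (lcs_topology X) U"
    show "openin (prod_topology (lcs_topology X) (lcs_topology X))
        {p \<in> topspace (prod_topology (lcs_topology X) (lcs_topology X)). (\<lambda>(x, y). x + y) p \<in> U}"
      unfolding openin_prod_topology_alt
    proof (intro allI impI)
      fix x y assume "(x, y) \<in> {p \<in> topspace (prod_topology (lcs_topology X) (lcs_topology X)). (\<lambda>(x, y). x + y) p \<in> U}"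
      then have xy: "x \<in> vecs X" "y \<in> vecs X" "x + y \<in> U" by auto
      obtain q \<epsilon> where q: "q \<in> snorms X" "\<epsilon> > 0" "{z \<in> vecs X. q (z - (x + y)) < \<epsilon>} \<subseteq> U"
        using open_contains_ball[OF U xy(3)] by metis
      define B where "B z = {v \<in> vecs X. q (v - z) < \<epsilon> / 2}" for z
      have "a + b \<in> U" if "a \<in> B x" "b \<in> B y" for a b
      proof -
        have ab: "a \<in> vecs X" "b \<in> vecs X" "q (a - x) < \<epsilon> / 2" "q (b - y) < \<epsilon> / 2"
          using that by (auto simp: B_def)
        have "a + b - (x + y) = (a - x) + (b - y)" by simp
        also have "q \<dots> \<le> q (a - x) + q (b - y)"
          by (intro seminorm_on_add[OF snorm[OF q(1)]] V_diff ab xy)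
        finally have "q (a + b - (x + y)) < \<epsilon>" using ab by simp
        then show ?thesis using q(3) ab V_add by blast
      qed
      moreover have "openin (lcs_topology X) (B z)" if "z \<in> vecs X" for z
        unfolding B_def by (rule openin_ball[OF q(1) that])
      moreover have "z \<in> B z" if "z \<in> vecs X" for z
        using that seminorm_on_0[OF snorm[OF q(1)]] q(2) by (simp add: B_def)
      moreover have "B z \<subseteq> vecs X" for z by (auto simp: B_def)
      ultimately have "openin (lcs_topology X) (B x) \<and> openin (lcs_topology X) (B y) \<and> x \<in> B x \<and> y \<in> B y \<and>
          B x \<times> B y \<subseteq> {p \<in> topspace (prod_topology (lcs_topology X) (lcs_topology X)). (\<lambda>(x, y). x + y) p \<in> U}"
        using xy(1,2) by (simp add: subset_iff) blast
      then show "\<exists>U' V'. openin (lcs_topology X) U' \<and> openin (lcs_topology X) V' \<and> x \<in> U' \<and> y \<in> V' \<and>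
          U' \<times> V' \<subseteq> {p \<in> topspace (prod_topology (lcs_topology X) (lcs_topology X)). (\<lambda>(x, y). x + y) p \<in> U}"
        by blast
    qed
  qed (auto intro: V_add)
qed

lemma abs_convex_sums:
  assumes K: "abs_convex X K" and L: "abs_convex X L"
  shows "abs_convex X ((\<lambda>(x, y). x + y) ` (K \<times> L))"
  unfolding abs_convex_def
proof (intro conjI ballI allI impI)
  show "(\<lambda>(x, y). x + y) ` (K \<times> L) \<noteq> {}" using abs_convexD(1)[OF K] abs_convexD(1)[OF L] by simp
  show "(\<lambda>(x, y). x + y) ` (K \<times> L) \<subseteq> vecs X"
    using abs_convexD(2)[OF K] abs_convexD(2)[OF L] by (auto intro: V_add)
  fix u v and a b :: 'k
  assume "u \<in> (\<lambda>(x, y). x + y) ` (K \<times> L)" "v \<in> (\<lambda>(x, y). x + y) ` (K \<times> L)" and ab: "norm a + norm b \<le> 1"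
  then obtain x y x' y' where *: "u = x + y" "x \<in> K" "y \<in> L" "v = x' + y'" "x' \<in> K" "y' \<in> L" by auto
  have "scl X a u + scl X b v = (scl X a x + scl X b x') + (scl X a y + scl X b y')"
    by (simp add: * scale_right_distrib algebra_simps)
  moreover have "scl X a x + scl X b x' \<in> K" "scl X a y + scl X b y' \<in> L"
    using abs_convexD(3)[OF K *(2,5) ab] abs_convexD(3)[OF L *(3,6) ab] by auto
  ultimately show "scl X a u + scl X b v \<in> (\<lambda>(x, y). x + y) ` (K \<times> L)" by force
qed

lemma lc_space_kappa_dual: "lc_space (kappa_dual X)"
proof -
  interpret f: subspace_of "\<lambda>c (y :: 'v \<Rightarrow> 'k) x. c * y x" "dual X"
    using vector_space_functions subspace_dual by (simp add: subspace_of_def subspace_of_axioms_def)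
  have "seminorm_on (dual X) (\<lambda>c y x. c * y x) (\<lambda>y. SUP x\<in>K. norm (y x))"
    if K: "abs_convex X K" "compactin (lcs_topology X) K" for K
  proof (rule f.seminorm_onI)
    obtain x where x: "x \<in> K" using abs_convexD(1)[OF K(1)] by blast
    show "0 \<le> (SUP x\<in>K. norm (y x))" if "y \<in> dual X" for y
      using kappa_snorm_ge[OF K(2) that x] norm_ge_zero[of "y x"] by linarith
    show "(SUP x\<in>K. norm ((y + z) x)) \<le> (SUP x\<in>K. norm (y x)) + (SUP x\<in>K. norm (z x))"
      if "y \<in> dual X" "z \<in> dual X" for y z
    proof (rule kappa_snorm_le[OF K(1)])
      fix x assume "x \<in> K"
      then show "norm ((y + z) x) \<le> (SUP x\<in>K. norm (y x)) + (SUP x\<in>K. norm (z x))"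
        using kappa_snorm_ge[OF K(2) that(1)] kappa_snorm_ge[OF K(2) that(2)] norm_triangle_ineq[of "y x" "z x"]
        by fastforce
    qed
    show "(SUP x\<in>K. norm (c * y x)) \<le> norm c * (SUP x\<in>K. norm (y x))" if "y \<in> dual X" for c y
      using kappa_snorm_ge[OF K(2) that]
      by (intro kappa_snorm_le[OF K(1)]) (simp add: norm_mult mult_left_mono)
  qed
  moreover have "directed_seminorms (kappa_dual X)"
    unfolding directed_seminorms_def
  proof (intro conjI ballI)
    have "abs_convex X {0}" by (simp add: abs_convex_def V_0)
    moreover have "compactin (lcs_topology X) {0}" by (simp add: V_0)
    ultimately show "snorms (kappa_dual X) \<noteq> {}" using kappa_snorm_iff by blast
    fix p q assume "p \<in> snorms (kappa_dual X)" "q \<in> snorms (kappa_dual X)"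
    then obtain K L where K: "abs_convex X K" "compactin (lcs_topology X) K" and p: "p = (\<lambda>y. SUP x\<in>K. norm (y x))"
      and L: "abs_convex X L" "compactin (lcs_topology X) L" and q: "q = (\<lambda>y. SUP x\<in>L. norm (y x))"
      unfolding kappa_snorm_iff by blast
    define S where "S = (\<lambda>(x, y). x + y) ` (K \<times> L)"
    have S: "compactin (lcs_topology X) S" "abs_convex X S"
      unfolding S_def using K L by (auto intro: compactin_sums abs_convex_sums)
    \<comment> \<open>The absolutely convex set \<open>L\<close> contains 0, so \<open>K\<close> is
      contained in the sum; the same holds with the roles exchanged.\<close>
    have KS: "x \<in> S" if "x \<in> K" for x
      using that abs_convex_0[OF L(1)] unfolding S_def by (metis (no_types, lifting) SigmaI add.right_neutral case_prod_conv image_eqI)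
    have LS: "x \<in> S" if "x \<in> L" for x
      using that abs_convex_0[OF K(1)] unfolding S_def by (metis (no_types, lifting) SigmaI add.left_neutral case_prod_conv image_eqI)
    have "p y \<le> 1 * (SUP x\<in>S. norm (y x)) \<and> q y \<le> 1 * (SUP x\<in>S. norm (y x))" if "y \<in> dual X" for y
      unfolding p q mult_1
      by (intro conjI kappa_snorm_le[OF K(1)] kappa_snorm_le[OF L(1)] kappa_snorm_ge[OF S(1) that] KS LS)
    then show "\<exists>r\<in>snorms (kappa_dual X). \<exists>C\<ge>0. \<forall>y\<in>vecs (kappa_dual X). p y \<le> C * r y \<and> q y \<le> C * r y"
      using S by (intro bexI[of _ "\<lambda>y. SUP x\<in>S. norm (y x)"] exI[of _ 1]) (auto simp: kappa_snorm_iff)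
  qed
  ultimately show ?thesis
    using f.subspace_of_axioms
    by (auto simp: lc_space_def lc_space_axioms_def kappa_snorm_iff)
qed

text \<open>A seminorm of compact convergence is at most any bound of \<open>y\<close> on
  \<open>K\<close>, so Mackey--Arens applies with the original topology: the dual of
  \<open>kappa_dual X\<close> consists of evaluations at vectors of \<open>X\<close>.\<close>

lemma kappa_dual_representation:
  assumes "linear_on (dual X) (\<lambda>c y x. c * y x) (*) \<phi>"
    and "q \<in> snorms (kappa_dual X)" "C > 0" "\<And>y. y \<in> dual X \<Longrightarrow> norm (\<phi> y) \<le> C * q y"
  shows "\<exists>x\<in>vecs X. \<forall>y\<in>dual X. \<phi> y = y x"
proof -
  obtain K where K: "q = (\<lambda>y. SUP x\<in>K. norm (y x))" "abs_convex X K" "compactin (lcs_topology X) K"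
    using assms(2) kappa_snorm_iff by blast
  show ?thesis
  proof (rule compact_representation[OF subspace_of_axioms K(3,2) subspace_dual dual_linear dual_continuous assms(1,3)])
    fix y B assume y: "y \<in> dual X" and B: "\<And>x. x \<in> K \<Longrightarrow> norm (y x) \<le> B"
    have "q y \<le> B" unfolding K(1) by (rule kappa_snorm_le[OF K(2) B])
    then show "norm (\<phi> y) \<le> C * B" using assms(3) assms(4)[OF y] mult_left_mono[of "q y" B C] by linarith
  qed
qed

text \<open>By Hahn--Banach applied to the distance seminorm from \<open>Z\<close>.\<close>

lemma separating_subspace_kappa_dense:
  assumes Z: "module.subspace (\<lambda>c y x. c * y x) Z" "Z \<subseteq> dual X"
    and sep: "\<And>x. x \<in> vecs X \<Longrightarrow> (\<And>z. z \<in> Z \<Longrightarrow> z x = 0) \<Longrightarrow> x = 0"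
    and y: "y \<in> dual X" and q: "q \<in> snorms (kappa_dual X)" and e: "\<epsilon> > 0"
  shows "\<exists>z\<in>Z. q (y - z) < \<epsilon>"
proof (rule ccontr)
  assume "\<not> ?thesis"
  then have far: "\<epsilon> \<le> q (y - z)" if "z \<in> Z" for z using that by force
  interpret k: lc_space "kappa_dual X" by (rule lc_space_kappa_dual)
  note Z' = Z[folded kappa_dual_simps]
  define r where "r = (\<lambda>y. INF z\<in>Z. q (y - z))"
  have r: "seminorm_on (vecs (kappa_dual X)) (scl (kappa_dual X)) r"
    and r_le: "\<And>y z. y \<in> dual X \<Longrightarrow> z \<in> Z \<Longrightarrow> r y \<le> q (y - z)"
    unfolding r_def using k.quotient_seminorm[OF k.snorm[OF q]] Z by auto
  have Z0: "0 \<in> Z" using k.subspace_0 Z(1) by simp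
  obtain \<phi> where \<phi>: "linear_on (dual X) (\<lambda>c y x. c * y x) (*) \<phi>"
    "\<And>y. y \<in> dual X \<Longrightarrow> norm (\<phi> y) \<le> r y" "norm (\<phi> y) = r y"
    using k.seminorm_hahn_banach[OF r, of y] y unfolding kappa_dual_simps by metis
  have "norm (\<phi> y) \<le> 1 * q y" if "y \<in> dual X" for y
    using \<phi>(2)[OF that] r_le[OF that Z0] by simp
  \<comment> \<open>The distance from \<open>Z\<close> is at most \<open>q\<close>, because 0 lies
    in \<open>Z\<close>. Hence \<open>\<phi>\<close> is continuous for compact convergence and is an
    evaluation.\<close>
  then obtain x where x: "x \<in> vecs X" "\<forall>y\<in>dual X. \<phi> y = y x"
    using kappa_dual_representation[OF \<phi>(1) q, of 1] by auto
  have "z x = 0" if "z \<in> Z" for z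
  proof -
    have "norm (\<phi> z) \<le> q (z - z)" using \<phi>(2)[of z] r_le[of z z] Z(2) that by fastforce
    then have "\<phi> z = 0" using k.seminorm_on_0[OF k.snorm[OF q]] by simp
    then show ?thesis using x(2) Z(2) that by auto
  qed
  then have "x = 0" by (rule sep[OF x(1)])
  then have "\<phi> y = 0" using x(2) y linear_on_scale[OF dual_linear[OF y] V_0, of 0] by simp
  moreover have "\<epsilon> \<le> r y" unfolding r_def using far Z0 by (intro cINF_greatest) auto
  ultimately show False using \<phi>(3) e by simp
qed

end

section \<open>Disks\<close>

context lc_space
begin

lemma disk_space_simps [simp]: "scl (disk_space X D) = scl X" "snorms (disk_space X D) = {gauge_norm X D}"
  by (simp_all add: disk_space_def)

text \<open>Multiplication by scalars of modulus at most 1 keeps \<open>D\<close> inside itself, so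
  its positive multiples increase.\<close>

lemma scale_disk_mono:
  assumes D: "abs_convex X D" and x: "x \<in> scl X (of_real t) ` D" and t: "0 \<le> t" "t \<le> r" "0 < r"
  shows "x \<in> scl X (of_real r) ` D"
proof -
  obtain d where d: "d \<in> D" "x = scl X (of_real t) d" using x by blast
  have "norm (of_real (t / r) :: 'k) \<le> 1" using t unfolding norm_of_real by simp
  then have "scl X (of_real (t / r)) d \<in> D" by (rule abs_convex_scale[OF D d(1)])
  moreover have "x = scl X (of_real r) (scl X (of_real (t / r)) d)"
    using t(3) unfolding d(2) scale_scale of_real_mult[symmetric] by simp
  ultimately show ?thesis by blast
qed

lemma in_disk_space_iff:
  assumes D: "abs_convex X D"
  shows "x \<in> vecs (disk_space X D) \<longleftrightarrow> (\<exists>t>0. x \<in> scl X (of_real t) ` D)"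
proof
  assume "x \<in> vecs (disk_space X D)"
  then obtain n :: nat where "x \<in> scl X (of_real (real n)) ` D"
    unfolding disk_space_def by auto
  \<comment> \<open>The multiple 0 is among the sets that make up the disk space, but a positive
    factor is wanted; hence the step to n + 1.\<close>
  then have "x \<in> scl X (of_real (real n + 1)) ` D" by (rule scale_disk_mono[OF D]) auto
  then show "\<exists>t>0. x \<in> scl X (of_real t) ` D" by (intro exI[of _ "real n + 1"]) auto
next
  assume "\<exists>t>0. x \<in> scl X (of_real t) ` D"
  then obtain t where t: "t > 0" "x \<in> scl X (of_real t) ` D" by blast
  obtain n :: nat where n: "t \<le> real n" using real_arch_simple by blast
  have "x \<in> scl X (of_real (real n)) ` D"
    using t n by (intro scale_disk_mono[OF D t(2)]) auto
  then show "x \<in> vecs (disk_space X D)" unfolding disk_space_def by auto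
qed

lemma scale_disk_add:
  assumes D: "abs_convex X D" and "x \<in> scl X (of_real t) ` D" "y \<in> scl X (of_real r) ` D" "0 < t" "0 < r"
  shows "x + y \<in> scl X (of_real (t + r)) ` D"
proof -
  obtain a b where a: "a \<in> D" "x = scl X (of_real t) a" and b: "b \<in> D" "y = scl X (of_real r) b"
    using assms(2,3) by blast
  have "norm (of_real (t / (t + r)) :: 'k) + norm (of_real (r / (t + r)) :: 'k) \<le> 1"
    using assms(4,5) unfolding norm_of_real by (simp add: add_divide_distrib[symmetric])
  then have "scl X (of_real (t / (t + r))) a + scl X (of_real (r / (t + r))) b \<in> D"
    by (rule abs_convexD(3)[OF D a(1) b(1)])
  moreover have "x + y = scl X (of_real (t + r)) (scl X (of_real (t / (t + r))) a + scl X (of_real (r / (t + r))) b)"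
    using assms(4,5) unfolding a b scale_right_distrib scale_scale of_real_mult[symmetric] by simp
  ultimately show ?thesis by blast
qed

lemma scale_disk_minus:
  assumes "abs_convex X D" "x \<in> scl X (of_real t) ` D"
  shows "- x \<in> scl X (of_real t) ` D"
proof -
  obtain d where d: "d \<in> D" "x = scl X (of_real t) d" using assms(2) by blast
  then have "- x = scl X (of_real t) (- d)" by simp
  then show ?thesis using abs_convex_uminus[OF assms(1) d(1)] by blast
qed

lemma gauge_le:
  assumes "0 < t" "x \<in> scl X (of_real t) ` D"
  shows "gauge_norm X D x \<le> t"
  unfolding gauge_norm_def using assms by (intro cInf_lower bdd_belowI[of _ 0]) auto

lemma gauge_less:
  assumes D: "abs_convex X D" and x: "x \<in> vecs (disk_space X D)" and "gauge_norm X D x < r"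
  shows "\<exists>t>0. t < r \<and> x \<in> scl X (of_real t) ` D"
proof -
  have "{t. t > 0 \<and> x \<in> scl X (of_real t) ` D} \<noteq> {}" using x in_disk_space_iff[OF D] by blast
  from cInf_lessD[OF this assms(3)[unfolded gauge_norm_def]] show ?thesis by blast
qed

lemma disk_space_diff:
  assumes D: "abs_convex X D" and "x \<in> vecs (disk_space X D)" "y \<in> vecs (disk_space X D)"
  shows "x - y \<in> vecs (disk_space X D)"
proof -
  obtain t r where t: "t > 0" "x \<in> scl X (of_real t) ` D" "r > 0" "y \<in> scl X (of_real r) ` D"
    using assms in_disk_space_iff[OF D] by blast
  then have "x + - y \<in> scl X (of_real (t + r)) ` D" by (intro scale_disk_add[OF D] scale_disk_minus[OF D])
  then show ?thesis using t in_disk_space_iff[OF D] by (metis add_pos_pos diff_conv_add_uminus)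
qed

lemma gauge_add:
  assumes D: "abs_convex X D" and x: "x \<in> vecs (disk_space X D)" and y: "y \<in> vecs (disk_space X D)"
  shows "gauge_norm X D (x + y) \<le> gauge_norm X D x + gauge_norm X D y"
proof (rule field_le_epsilon)
  fix e :: real assume e: "e > 0"
  obtain t where t: "t > 0" "t < gauge_norm X D x + e / 2" "x \<in> scl X (of_real t) ` D"
    using gauge_less[OF D x, of "gauge_norm X D x + e / 2"] e by auto
  obtain r where r: "r > 0" "r < gauge_norm X D y + e / 2" "y \<in> scl X (of_real r) ` D"
    using gauge_less[OF D y, of "gauge_norm X D y + e / 2"] e by auto
  have "gauge_norm X D (x + y) \<le> t + r" using t r by (intro gauge_le scale_disk_add[OF D]) auto
  then show "gauge_norm X D (x + y) \<le> gauge_norm X D x + gauge_norm X D y + e" using t r by linarith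
qed

lemma gauge_0: "abs_convex X D \<Longrightarrow> gauge_norm X D 0 \<le> 0"
proof (rule field_le_epsilon)
  fix e :: real assume D: "abs_convex X D" and e: "e > 0"
  have "0 \<in> scl X (of_real e) ` D" using abs_convex_0[OF D] by (intro image_eqI[of _ _ 0]) auto
  then show "gauge_norm X D 0 \<le> 0 + e" using gauge_le[OF e] by simp
qed

lemma disk_space_subset: "abs_convex X D \<Longrightarrow> vecs (disk_space X D) \<subseteq> vecs X"
  using abs_convexD(2)[of X D] by (auto simp: in_disk_space_iff intro!: V_scale)

text \<open>Convergence in the gauge is restated as membership in small multiples of
  \<open>D\<close>, the form that can be carried over from one disk to another.\<close>

lemma disk_space_limit_gauge:
  assumes D: "abs_convex X D" and L: "limitin (lcs_topology (disk_space X D)) f l G" and r: "r > 0"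
  shows "eventually (\<lambda>a. f a - l \<in> scl X (of_real r) ` D) G"
proof -
  have l: "l \<in> vecs (disk_space X D)" using L by (auto simp: limitin_def)
  have "openin (lcs_topology (disk_space X D)) {y \<in> vecs (disk_space X D). gauge_norm X D (y - l) < r}"
    by (rule openin_lcs_ball) (auto intro: disk_space_diff[OF D] gauge_add[OF D] l)
  moreover have "l \<in> {y \<in> vecs (disk_space X D). gauge_norm X D (y - l) < r}"
    using l gauge_0[OF D] r by simp
  ultimately have "eventually (\<lambda>a. f a \<in> {y \<in> vecs (disk_space X D). gauge_norm X D (y - l) < r}) G"
    using L unfolding limitin_def by blast
  then show ?thesis
  proof eventually_elim
    case (elim a)
    then have fa: "f a \<in> vecs (disk_space X D)" "gauge_norm X D (f a - l) < r" by auto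
    from gauge_less[OF D disk_space_diff[OF D fa(1) l] fa(2)]
    obtain t where t: "t > 0" "t < r" "f a - l \<in> scl X (of_real t) ` D" by blast
    show ?case by (rule scale_disk_mono[OF D t(3)]) (use t r in auto)
  qed
qed

text \<open>Every seminorm is bounded on \<open>D\<close>, hence small on small multiples of
  \<open>D\<close>: the disk space embeds continuously.\<close>

lemma disk_space_limit:
  assumes D: "disk X D" and L: "limitin (lcs_topology (disk_space X D)) f l G"
  shows "limitin (lcs_topology X) f l G"
  unfolding limitin_iff
proof (intro conjI ballI allI impI)
  have ac: "abs_convex X D" and bd: "lcs_bounded X D" using D by (auto simp: disk_def)
  have l: "l \<in> vecs (disk_space X D)" using L by (auto simp: limitin_def)
  then show lV: "l \<in> vecs X" using disk_space_subset[OF ac] by blast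
  fix q and \<epsilon> :: real assume q: "q \<in> snorms X" and e: "\<epsilon> > 0"
  obtain M where M: "\<And>d. d \<in> D \<Longrightarrow> q d \<le> M"
    using bd q unfolding lcs_bounded_def bdd_above_def by blast
  \<comment> \<open>The denominator stays positive even if the seminorm vanishes on all of
    \<open>D\<close>.\<close>
  define r where "r = \<epsilon> / (\<bar>M\<bar> + 1)"
  have r: "r > 0" using e by (simp add: r_def)
  show "eventually (\<lambda>a. f a \<in> vecs X \<and> q (f a - l) < \<epsilon>) G"
    using disk_space_limit_gauge[OF ac L r]
  proof eventually_elim
    case (elim a)
    then obtain d where d: "d \<in> D" "f a - l = scl X (of_real r) d" by blast
    have dV: "d \<in> vecs X" using d(1) abs_convexD(2)[OF ac] by blast
    have "q (f a - l) = r * q d"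
      unfolding d(2) using seminorm_on_scale[OF snorm[OF q] dV] r by simp
    also have "\<dots> \<le> r * \<bar>M\<bar>" using M[OF d(1)] r by (intro mult_left_mono) auto
    also have "\<dots> < r * (\<bar>M\<bar> + 1)" using r by simp
    also have "\<dots> = \<epsilon>" by (simp add: r_def)
    finally have "q (f a - l) < \<epsilon>" .
    moreover have "f a - l + l \<in> vecs X" unfolding d(2) by (intro V_add V_scale dV lV)
    ultimately show ?case by simp
  qed
qed

end

section \<open>Representing functionals on the dual by vectors\<close>

lemma lcHs_imp_lc_space: "lcHs X \<Longrightarrow> lc_space X"
  unfolding lcHs_def lc_space_def subspace_of_def subspace_of_axioms_def lc_space_axioms_def
  by auto

lemma lcs_of_simps [simp]: "vecs (lcs_of s p) = UNIV" "scl (lcs_of s p) = s" "snorms (lcs_of s p) = range p"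
  by (simp_all add: lcs_of_def)

locale seminorm_family =
  fixes s :: "'k::real_or_complex \<Rightarrow> 'e::ab_group_add \<Rightarrow> 'e" and p :: "'a \<Rightarrow> 'e \<Rightarrow> real"
  assumes lcHs: "lcHs (lcs_of s p)"
begin

abbreviation "E \<equiv> lcs_of s p"

sublocale E: lc_space E by (rule lcHs_imp_lc_space[OF lcHs])

lemma p_seminorm: "seminorm_on UNIV s (p \<alpha>)"
  using E.snorm[of "p \<alpha>"] by simp

lemma p_nonneg: "0 \<le> p \<alpha> x" and p_triangle: "p \<alpha> (x + y) \<le> p \<alpha> x + p \<alpha> y"
  and p_scale: "p \<alpha> (s c x) = norm c * p \<alpha> x"
  using seminorm_onD[OF p_seminorm[of \<alpha>]] by auto

lemma p_minus_commute: "p \<alpha> (x - y) = p \<alpha> (y - x)"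
  using E.seminorm_on_minus_commute[of "p \<alpha>"] p_seminorm by simp

lemma p_directed: "\<exists>\<gamma> C. C > 0 \<and> (\<forall>x. p \<alpha> x \<le> C * p \<gamma> x) \<and> (\<forall>x. p \<beta> x \<le> C * p \<gamma> x)"
  using E.finite_dominated[of "{p \<alpha>, p \<beta>}"] by fastforce

lemma dual_add: "e' \<in> dual E \<Longrightarrow> e' (x + y) = e' x + e' y"
  and dual_scale: "e' \<in> dual E \<Longrightarrow> e' (s c x) = c * e' x"
  using linear_onD[OF E.dual_linear] by auto

lemma dual_diff: "e' \<in> dual E \<Longrightarrow> e' (x - y) = e' x - e' y"
  using dual_add[of e' "x - y" y] by simp

lemma dual_E_iff:
  "e' \<in> dual E \<longleftrightarrow> linear_on UNIV s (*) e' \<and> (\<exists>\<alpha>. \<exists>C>0. \<forall>x. norm (e' x) \<le> C * p \<alpha> x)"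
  unfolding E.dual_iff by auto

text \<open>The bound on the open unit ball becomes homogeneous by scaling \<open>x\<close> with 1 /
  t for \<open>t\<close> above \<open>p \<alpha> x\<close> and letting \<open>t\<close>
  decrease.\<close>

lemma polar_iff: "e' \<in> polar_ball s p \<alpha> \<longleftrightarrow> linear_on UNIV s (*) e' \<and> (\<forall>x. norm (e' x) \<le> p \<alpha> x)"
proof
  assume e': "e' \<in> polar_ball s p \<alpha>"
  then have d: "e' \<in> dual E" and le: "\<And>x. p \<alpha> x < 1 \<Longrightarrow> norm (e' x) \<le> 1"
    by (auto simp: polar_ball_def)
  have "norm (e' x) \<le> p \<alpha> x" for x
  proof (rule dense_ge)
    fix t assume t: "p \<alpha> x < t"
    then have t0: "t > 0" using p_nonneg[of \<alpha> x] by linarith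
    have n: "norm (of_real (1 / t) :: 'k) = 1 / t" using t0 unfolding norm_of_real by simp
    have "norm (e' (s (of_real (1 / t)) x)) \<le> 1"
      using t t0 n by (intro le) (simp add: p_scale del: of_real_divide)
    then show "norm (e' x) \<le> t"
      using t0 n by (simp add: dual_scale[OF d] norm_mult del: of_real_divide)
  qed
  then show "linear_on UNIV s (*) e' \<and> (\<forall>x. norm (e' x) \<le> p \<alpha> x)" using d dual_E_iff by blast
next
  assume *: "linear_on UNIV s (*) e' \<and> (\<forall>x. norm (e' x) \<le> p \<alpha> x)"
  then have "e' \<in> dual E" unfolding dual_E_iff by (auto intro!: exI[of _ \<alpha>] exI[of _ 1])
  then show "e' \<in> polar_ball s p \<alpha>" using * order_trans less_imp_le unfolding polar_ball_def by blast
qed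

lemma polar_dual: "e' \<in> polar_ball s p \<alpha> \<Longrightarrow> e' \<in> dual E"
  and polar_le: "e' \<in> polar_ball s p \<alpha> \<Longrightarrow> norm (e' x) \<le> p \<alpha> x"
  by (simp_all add: polar_ball_def[of s p \<alpha>, THEN eqset_imp_iff] polar_iff) (auto simp: dual_E_iff intro!: exI[of _ \<alpha>] exI[of _ 1])

text \<open>Hahn--Banach provides a functional in the polar that attains
  \<open>p \<alpha> x\<close>. Seminorms of \<open>E\<close> are estimated through functionals in
  this way throughout.\<close>

lemma p_le_polar:
  assumes "\<And>e'. e' \<in> polar_ball s p \<alpha> \<Longrightarrow> norm (e' x) \<le> B"
  shows "p \<alpha> x \<le> B"
proof -
  obtain f where "linear_on UNIV s (*) f" "\<And>x. norm (f x) \<le> p \<alpha> x" "norm (f x) = p \<alpha> x"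
    using E.seminorm_hahn_banach[of "p \<alpha>" x] p_seminorm by auto
  then show ?thesis using assms[of f] polar_iff by auto
qed

lemma dual_scaled_polar:
  assumes "e' \<in> dual E"
  obtains \<alpha> C d where "C > 0" "d \<in> polar_ball s p \<alpha>" "e' = (\<lambda>x. of_real C * d x)"
proof -
  obtain \<alpha> C where C: "C > 0" "\<And>x. norm (e' x) \<le> C * p \<alpha> x" using assms dual_E_iff by blast
  define d where "d x = of_real (1 / C) * e' x" for x
  have "linear_on UNIV s (*) d"
    using E.dual_linear[OF assms] by (auto simp: linear_on_def d_def algebra_simps)
  moreover have "norm (d x) \<le> p \<alpha> x" for x
    using C by (simp add: d_def norm_mult norm_divide field_simps)
  ultimately have "d \<in> polar_ball s p \<alpha>" by (simp add: polar_iff)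
  then show ?thesis using C(1) by (intro that[of C d \<alpha>]) (auto simp: d_def)
qed

lemma polar_rescale:
  assumes "e' \<in> polar_ball s p \<alpha>" "C > 0" "\<And>x. p \<alpha> x \<le> C * p \<gamma> x"
  obtains d where "d \<in> polar_ball s p \<gamma>" "e' = (\<lambda>x. of_real C * d x)"
proof -
  define d where "d x = of_real (1 / C) * e' x" for x
  have "linear_on UNIV s (*) d"
    using assms(1) by (auto simp: polar_iff linear_on_def d_def algebra_simps)
  moreover have "norm (d x) \<le> p \<gamma> x" for x
    using assms(2) assms(3)[of x] polar_le[OF assms(1), of x] by (simp add: d_def norm_mult norm_divide field_simps)
  ultimately have "d \<in> polar_ball s p \<gamma>" by (simp add: polar_iff)
  then show ?thesis using assms(2) by (intro that[of d]) (auto simp: d_def)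
qed

lemma dual_separates:
  assumes "\<And>e'. e' \<in> dual E \<Longrightarrow> e' x = e' y"
  shows "x = y"
proof -
  have "p \<alpha> (x - y) \<le> 0" for \<alpha>
    using assms by (intro p_le_polar) (simp add: polar_dual dual_diff)
  then have "x - y = 0"
    using lcHs p_nonneg by (intro E.Hausdorff_eq_0) (auto simp: lcHs_def intro: antisym)
  then show ?thesis by simp
qed

text \<open>Every functional is a multiple of one in a polar, so uniform approximation on polars
  suffices. The filter is arbitrary in order to cover sequences as well as the filter of near
  representers.\<close>

lemma representation_by_limit:
  assumes lin: "linear_on (dual E) (\<lambda>c y x. c * y x) (*) \<phi>"
    and lim: "limitin (lcs_topology E) h l G" and G: "G \<noteq> bot"
    and approx: "\<And>\<alpha> \<epsilon>. \<epsilon> > 0 \<Longrightarrow> eventually (\<lambda>i. \<forall>e'\<in>polar_ball s p \<alpha>. norm (\<phi> e' - e' (h i)) \<le> \<epsilon>) G"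
    and e': "e' \<in> dual E"
  shows "\<phi> e' = e' l"
proof -
  obtain \<alpha> C d where d: "C > 0" "d \<in> polar_ball s p \<alpha>" "e' = (\<lambda>x. of_real C * d x)"
    using dual_scaled_polar[OF e'] by blast
  have "norm (\<phi> d - d l) \<le> 0 + \<epsilon>" if e: "\<epsilon> > 0" for \<epsilon>
  proof -
    have "eventually (\<lambda>i. h i \<in> vecs E \<and> p \<alpha> (h i - l) < \<epsilon> / 2) G"
      using lim[unfolded E.limitin_iff, THEN conjunct2, rule_format, of "p \<alpha>" "\<epsilon> / 2"] e by simp
    then have "eventually (\<lambda>i. (h i \<in> vecs E \<and> p \<alpha> (h i - l) < \<epsilon> / 2) \<and>
        (\<forall>e'\<in>polar_ball s p \<alpha>. norm (\<phi> e' - e' (h i)) \<le> \<epsilon> / 2)) G"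
      using approx[OF half_gt_zero[OF e], of \<alpha>] by (rule eventually_conj)
    then obtain i where i: "p \<alpha> (h i - l) < \<epsilon> / 2" "norm (\<phi> d - d (h i)) \<le> \<epsilon> / 2"
      using eventually_happens'[OF G] d(2) by blast
    have "norm (d (h i) - d l) \<le> \<epsilon> / 2"
      using polar_le[OF d(2), of "h i - l"] i(1) dual_diff[OF polar_dual[OF d(2)]] by simp
    then show ?thesis using norm_triangle_ineq[of "\<phi> d - d (h i)" "d (h i) - d l"] i(2) by simp
  qed
  then have "norm (\<phi> d - d l) \<le> 0" by (rule field_le_epsilon)
  then have "\<phi> d = d l" by simp
  then show ?thesis using linear_on_scale[OF lin polar_dual[OF d(2)]] d(3) by simp
qed

text \<open>The vectors of \<open>B\<close> that represent \<open>\<phi>\<close> on one polar up to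
  a tolerance form a filter base. It is Cauchy because two such vectors are close in the
  corresponding seminorm, and its limit in the complete set represents \<open>\<phi>\<close>
  exactly.\<close>

lemma representation_in_complete_set:
  assumes B: "lcs_complete_set E B" and lin: "linear_on (dual E) (\<lambda>c y x. c * y x) (*) \<phi>"
    and approx: "\<And>\<alpha> \<epsilon>. \<epsilon> > 0 \<Longrightarrow> \<exists>e\<in>B. \<forall>e'\<in>polar_ball s p \<alpha>. norm (\<phi> e' - e' e) \<le> \<epsilon>"
  shows "\<exists>e. \<forall>e'\<in>dual E. \<phi> e' = e' e"
proof -
  define A where "A = (\<lambda>(\<alpha>, \<epsilon>). {e \<in> B. \<forall>e'\<in>polar_ball s p \<alpha>. norm (\<phi> e' - e' e) \<le> \<epsilon>})"
  define I where "I = (UNIV :: 'a set) \<times> {0::real<..}"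
  define G where "G = (INF i\<in>I. principal (A i))"
  \<comment> \<open>A dominating seminorm has the larger polar up to the factor \<open>C\<close>, so
    the tolerance must shrink by the same factor.\<close>
  have dominated: "A (\<gamma>, \<eta> / C) \<subseteq> A (\<alpha>, \<eta>)" if C: "C > 0" "\<And>x. p \<alpha> x \<le> C * p \<gamma> x" for \<alpha> \<gamma> C \<eta>
  proof
    fix e assume e: "e \<in> A (\<gamma>, \<eta> / C)"
    have "norm (\<phi> e' - e' e) \<le> \<eta>" if e': "e' \<in> polar_ball s p \<alpha>" for e'
    proof -
      obtain d where d: "d \<in> polar_ball s p \<gamma>" "e' = (\<lambda>x. of_real C * d x)"
        using polar_rescale[OF e' C] by blast
      have "\<phi> e' - e' e = of_real C * (\<phi> d - d e)"
        using linear_on_scale[OF lin polar_dual[OF d(1)]] d(2) by (simp add: algebra_simps)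
      then have "norm (\<phi> e' - e' e) = C * norm (\<phi> d - d e)" using C(1) by (simp add: norm_mult)
      also have "\<dots> \<le> C * (\<eta> / C)" using e d(1) C(1) by (intro mult_left_mono) (auto simp: A_def)
      finally show ?thesis using C(1) by simp
    qed
    then show "e \<in> A (\<alpha>, \<eta>)" using e by (auto simp: A_def)
  qed
  have A_mono: "A (\<alpha>, \<epsilon>) \<subseteq> A (\<alpha>, \<delta>)" if "\<epsilon> \<le> \<delta>" for \<alpha> \<epsilon> \<delta>
    using that unfolding A_def by force
  have ev: "eventually P G \<longleftrightarrow> (\<exists>i\<in>I. eventually P (principal (A i)))" for P
    unfolding G_def
  proof (rule eventually_INF_base)
    show "I \<noteq> {}" by (auto simp: I_def)
    fix i j assume "i \<in> I" "j \<in> I"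
    then obtain \<alpha> \<epsilon> \<beta> \<delta> where ij: "i = (\<alpha>, \<epsilon>)" "j = (\<beta>, \<delta>)" "\<epsilon> > 0" "\<delta> > 0" by (auto simp: I_def)
    obtain \<gamma> C where C: "C > 0" "\<And>x. p \<alpha> x \<le> C * p \<gamma> x" "\<And>x. p \<beta> x \<le> C * p \<gamma> x"
      using p_directed[of \<alpha> \<beta>] by blast
    have "A (\<gamma>, min \<epsilon> \<delta> / C) \<subseteq> A i \<inter> A j"
      using dominated[OF C(1,2), of "min \<epsilon> \<delta>"] dominated[OF C(1,3), of "min \<epsilon> \<delta>"]
        A_mono[of "min \<epsilon> \<delta>" \<epsilon> \<alpha>] A_mono[of "min \<epsilon> \<delta>" \<delta> \<beta>] unfolding ij by auto
    then show "\<exists>k\<in>I. principal (A k) \<le> inf (principal (A i)) (principal (A j))"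
      using C(1) ij(3,4) by (intro bexI[of _ "(\<gamma>, min \<epsilon> \<delta> / C)"]) (auto simp: I_def)
  qed
  have ne: "G \<noteq> bot"
    unfolding trivial_limit_def ev using approx by (fastforce simp: eventually_principal I_def A_def)
  have inA: "eventually (\<lambda>e. e \<in> A (\<alpha>, \<epsilon>)) G" if "\<epsilon> > 0" for \<alpha> \<epsilon>
    unfolding ev using that by (intro bexI[of _ "(\<alpha>, \<epsilon>)"]) (auto simp: I_def eventually_principal)
  have "eventually (\<lambda>e. e \<in> B) G"
    \<comment> \<open>All the sets \<open>A\<close> lie in \<open>B\<close>, so any tolerance and
      any index will do.\<close>
    using inA[of 1 undefined] by (auto simp: A_def elim: eventually_mono)
  then have GB: "G \<le> principal B" by (simp add: le_principal)
  \<comment> \<open>Two tolerances add up; with thirds instead of halves the sum stays strictly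
    below \<open>\<epsilon>\<close>.\<close>
  have "p \<alpha> (x - y) < \<epsilon>" if "\<epsilon> > 0" "x \<in> A (\<alpha>, \<epsilon> / 3)" "y \<in> A (\<alpha>, \<epsilon> / 3)" for \<alpha> \<epsilon> x y
  proof -
    have "p \<alpha> (x - y) \<le> \<epsilon> / 3 + \<epsilon> / 3"
    proof (rule p_le_polar)
      fix e' assume e': "e' \<in> polar_ball s p \<alpha>"
      then have "norm (\<phi> e' - e' x) \<le> \<epsilon> / 3" "norm (\<phi> e' - e' y) \<le> \<epsilon> / 3"
        using that by (auto simp: A_def)
      then have "norm ((\<phi> e' - e' y) - (\<phi> e' - e' x)) \<le> \<epsilon> / 3 + \<epsilon> / 3"
        using norm_triangle_ineq4[of "\<phi> e' - e' y" "\<phi> e' - e' x"] by linarith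
      then show "norm (e' (x - y)) \<le> \<epsilon> / 3 + \<epsilon> / 3"
        by (simp add: dual_diff[OF polar_dual[OF e']])
    qed
    then show ?thesis using that(1) by linarith
  qed
  then have "lcs_cauchy_filter E G"
    unfolding lcs_cauchy_filter_def using inA by (auto intro!: exI[of _ "A (_, _ / 3)"])
  then obtain l where "limitin (lcs_topology E) (\<lambda>x. x) l G"
    using B ne GB unfolding lcs_complete_set_def by blast
  then have "\<forall>e'\<in>dual E. \<phi> e' = e' l"
  proof (intro ballI representation_by_limit[OF lin _ ne])
    fix \<alpha> and \<epsilon> :: real assume "\<epsilon> > 0"
    from inA[OF this, of \<alpha>] show "eventually (\<lambda>e. \<forall>e'\<in>polar_ball s p \<alpha>. norm (\<phi> e' - e' e) \<le> \<epsilon>) G"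
      by eventually_elim (simp add: A_def)
  qed
  then show ?thesis by blast
qed

end

section \<open>The transpose of a function with relatively compact polar images\<close>

locale compact_transpose = seminorm_family s p + F: lc_space F
  for s :: "'k::real_or_complex \<Rightarrow> 'e::ab_group_add \<Rightarrow> 'e" and p :: "'a \<Rightarrow> 'e \<Rightarrow> real"
    and F :: "('k, 'x \<Rightarrow> 'k) lcs" +
  fixes f :: "'x \<Rightarrow> 'e"
  assumes F_scl: "scl F = pointwise (*)"
    and eval: "\<And>x. pt_eval F x \<in> dual F"
    and f: "f \<in> FV_kappa F s p"
begin

sublocale k: lc_space "kappa_dual F" by (rule F.lc_space_kappa_dual)

lemma dual_F_diff: "y \<in> dual F \<Longrightarrow> z \<in> dual F \<Longrightarrow> y - z \<in> dual F"
  using k.V_diff[of y z] by (simp only: F.kappa_dual_simps)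

text \<open>The equation of the transpose at \<open>y\<close> with the canonical image of
  \<open>e\<close>. A relation is used because the existence of \<open>e\<close> is precisely what
  the completeness hypotheses must supply.\<close>

definition represents :: "(('x \<Rightarrow> 'k) \<Rightarrow> 'k) \<Rightarrow> 'e \<Rightarrow> bool" where
  "represents y e \<longleftrightarrow> (\<forall>e'\<in>dual E. y (e' \<circ> f) = e' e)"

definition polar_image :: "'a \<Rightarrow> ('x \<Rightarrow> 'k) set" where
  "polar_image \<alpha> = lcs_topology F closure_of ((\<lambda>e'. e' \<circ> f) ` polar_ball s p \<alpha>)"

text \<open>Only the closure of the polar image is known to be compact. The supremum over that
  closure is one of the seminorms that define \<open>kappa_dual F\<close>.\<close>

definition polar_snorm :: "'a \<Rightarrow> (('x \<Rightarrow> 'k) \<Rightarrow> 'k) \<Rightarrow> real" where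
  "polar_snorm \<alpha> y = (SUP g\<in>polar_image \<alpha>. norm (y g))"

lemma comp_in_F: "e' \<in> dual E \<Longrightarrow> e' \<circ> f \<in> vecs F"
  using f by (auto simp: FV_kappa_def FV_sigma_def)

lemma comp_add: "(e1 + e2) \<circ> f = (e1 \<circ> f) + (e2 \<circ> f)"
  and comp_scale: "(\<lambda>x. c * e' x) \<circ> f = scl F c (e' \<circ> f)"
  by (auto simp: fun_eq_iff F_scl pointwise_def)

lemma polar_image_in_F: "(\<lambda>e'. e' \<circ> f) ` polar_ball s p \<alpha> \<subseteq> vecs F"
  using comp_in_F polar_dual by blast

lemma compactin_polar_image: "compactin (lcs_topology F) (polar_image \<alpha>)"
  using f by (auto simp: FV_kappa_def polar_image_def)

lemma abs_convex_polar_image: "abs_convex F (polar_image \<alpha>)"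
  unfolding polar_image_def
proof (rule F.abs_convex_closure_of)
  have "(\<lambda>_. 0) \<in> polar_ball s p \<alpha>" by (simp add: polar_iff linear_on_def p_nonneg)
  moreover have "scl F a g + scl F b h \<in> (\<lambda>e'. e' \<circ> f) ` polar_ball s p \<alpha>"
    if g: "g \<in> (\<lambda>e'. e' \<circ> f) ` polar_ball s p \<alpha>" and h: "h \<in> (\<lambda>e'. e' \<circ> f) ` polar_ball s p \<alpha>"
      and ab: "norm a + norm b \<le> 1" for g h a b
  proof -
    obtain c d where c: "c \<in> polar_ball s p \<alpha>" "g = c \<circ> f" and d: "d \<in> polar_ball s p \<alpha>" "h = d \<circ> f"
      using g h by blast
    have "norm (a * c x + b * d x) \<le> p \<alpha> x" for x
    proof -
      have "norm (a * c x + b * d x) \<le> norm a * norm (c x) + norm b * norm (d x)"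
        using norm_triangle_ineq[of "a * c x" "b * d x"] by (simp add: norm_mult)
      also have "\<dots> \<le> norm a * p \<alpha> x + norm b * p \<alpha> x"
        using c d by (intro add_mono mult_left_mono polar_le) auto
      also have "\<dots> \<le> p \<alpha> x"
        using mult_right_mono[OF ab p_nonneg[of \<alpha> x]] by (simp add: algebra_simps)
      finally show ?thesis .
    qed
    moreover have "linear_on UNIV s (*) (\<lambda>x. a * c x + b * d x)"
      using c(1) d(1) by (simp add: polar_iff linear_on_def algebra_simps)
    ultimately have "(\<lambda>x. a * c x + b * d x) \<in> polar_ball s p \<alpha>" by (simp add: polar_iff)
    moreover have "scl F a g + scl F b h = (\<lambda>x. a * c x + b * d x) \<circ> f"
      by (simp add: c d fun_eq_iff F_scl pointwise_def)
    ultimately show ?thesis by blast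
  qed
  ultimately show "abs_convex F ((\<lambda>e'. e' \<circ> f) ` polar_ball s p \<alpha>)"
    unfolding abs_convex_def using polar_image_in_F by blast
qed

lemma comp_in_polar_image: "e' \<in> polar_ball s p \<alpha> \<Longrightarrow> e' \<circ> f \<in> polar_image \<alpha>"
  unfolding polar_image_def
  using closure_of_subset[of "(\<lambda>e'. e' \<circ> f) ` polar_ball s p \<alpha>" "lcs_topology F"] polar_image_in_F[of \<alpha>]
  by (simp only: topspace_lcs_topology) blast

lemma polar_snorm: "polar_snorm \<alpha> \<in> snorms (kappa_dual F)"
  unfolding F.kappa_snorm_iff polar_snorm_def[abs_def]
  using compactin_polar_image abs_convex_polar_image by blast

lemma transpose_le:
  assumes "y \<in> dual F" "e' \<in> polar_ball s p \<alpha>"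
  shows "norm (y (e' \<circ> f)) \<le> polar_snorm \<alpha> y"
  unfolding polar_snorm_def
  by (rule F.kappa_snorm_ge[OF compactin_polar_image assms(1) comp_in_polar_image[OF assms(2)]])

lemma transpose_linear:
  assumes "y \<in> dual F"
  shows "linear_on (dual E) (\<lambda>c y x. c * y x) (*) (\<lambda>e'. y (e' \<circ> f))"
  using linear_onD[OF F.dual_linear[OF assms]] comp_in_F
  unfolding linear_on_def by (simp add: comp_add comp_scale)

lemma representsD: "represents y e \<Longrightarrow> e' \<in> dual E \<Longrightarrow> y (e' \<circ> f) = e' e"
  by (simp add: represents_def)

lemma dual_0: "e' \<in> dual E \<Longrightarrow> e' 0 = 0"
  using dual_diff[of e' 0 0] by simp

lemma represents_0: "represents 0 0"
  unfolding represents_def by (auto dest: dual_0)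

lemma represents_add: "represents y e \<Longrightarrow> represents z d \<Longrightarrow> represents (y + z) (e + d)"
  by (simp add: represents_def dual_add)

lemma represents_scale: "represents y e \<Longrightarrow> represents (\<lambda>g. c * y g) (s c e)"
  by (simp add: represents_def dual_scale)

lemma represents_diff: "represents y e \<Longrightarrow> represents z d \<Longrightarrow> represents (y - z) (e - d)"
  by (simp add: represents_def dual_diff)

lemma represents_eval: "represents (pt_eval F x) (f x)"
  using comp_in_F by (simp add: represents_def pt_eval_def)

text \<open>The central estimate: it gives the continuity of the transposed map and, by linearity of
  the relation, carries Cauchy and boundedness properties over to the representing vectors.\<close>

lemma represents_le:
  assumes "y \<in> dual F" "represents y e"
  shows "p \<alpha> e \<le> polar_snorm \<alpha> y"
proof (rule p_le_polar)
  fix e' assume e': "e' \<in> polar_ball s p \<alpha>"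
  show "norm (e' e) \<le> polar_snorm \<alpha> y"
    using transpose_le[OF assms(1) e'] representsD[OF assms(2) polar_dual[OF e']] by simp
qed

lemma represents_approx:
  assumes "y \<in> dual F" "z \<in> dual F" "represents z e" "polar_snorm \<alpha> (z - y) \<le> \<epsilon>"
    and e': "e' \<in> polar_ball s p \<alpha>"
  shows "norm (y (e' \<circ> f) - e' e) \<le> \<epsilon>"
proof -
  have "z - y \<in> dual F" using k.V_diff assms by simp
  from transpose_le[OF this e'] have "norm ((z - y) (e' \<circ> f)) \<le> \<epsilon>" using assms(4) by linarith
  then show ?thesis using representsD[OF assms(3) polar_dual[OF e']] by (simp add: norm_minus_commute)
qed

lemma kappa_limit_polar_snorm:
  assumes "limitin (lcs_topology (kappa_dual F)) g y G" "\<epsilon> > 0"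
  shows "eventually (\<lambda>i. g i \<in> dual F \<and> polar_snorm \<alpha> (g i - y) < \<epsilon>) G"
  using assms polar_snorm[of \<alpha>] unfolding k.limitin_iff by simp

lemma represented_if_complete:
  assumes "lcs_complete E" and y: "y \<in> dual F"
  shows "\<exists>e. represents y e"
proof -
  define Z where "Z = k.span (range (pt_eval F))"
  have Z: "k.subspace Z" unfolding Z_def by (rule k.subspace_span)
  have ZF: "Z \<subseteq> dual F"
    unfolding Z_def by (intro k.span_minimal) (use eval k.sub in auto)
  \<comment> \<open>The elements of \<open>F\<close> are functions, so one on which all point
    evaluations vanish is zero; thus the span of the evaluations separates \<open>F\<close>.\<close>
  have sep: "x = 0" if "x \<in> vecs F" "\<And>z. z \<in> Z \<Longrightarrow> z x = 0" for x
  proof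
    fix t
    have "pt_eval F t \<in> Z" unfolding Z_def by (rule k.span_base) simp
    then show "x t = 0 t" using that by (force simp: pt_eval_def)
  qed
  \<comment> \<open>A linear combination of point evaluations is represented by the same combination
    of values of \<open>f\<close>.\<close>
  have rep: "\<exists>e. represents z e" if "z \<in> Z" for z
    using that unfolding Z_def
  proof (induction rule: k.span_induct_alt)
    case base
    show ?case using represents_0 by blast
  next
    case (step c x z)
    then obtain t e where "x = pt_eval F t" "represents z e" by blast
    then have "represents (scl (kappa_dual F) c x + z) (s c (f t) + e)"
      using represents_add[OF represents_scale[OF represents_eval]] by simp
    then show ?case by blast
  qed
  have "\<exists>e\<in>UNIV. \<forall>e'\<in>polar_ball s p \<alpha>. norm (y (e' \<circ> f) - e' e) \<le> \<epsilon>" if e: "\<epsilon> > 0" for \<alpha> \<epsilon>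
  proof -
    obtain z where z: "z \<in> Z" "polar_snorm \<alpha> (y - z) < \<epsilon>"
      using F.separating_subspace_kappa_dense[OF Z[unfolded F.kappa_dual_simps] ZF sep y polar_snorm e] by blast
    have zF: "z \<in> dual F" using z(1) ZF by blast
    have "polar_snorm \<alpha> (z - y) = polar_snorm \<alpha> (y - z)"
      using zF y by (intro k.seminorm_on_minus_commute k.snorm polar_snorm) auto
    then have le: "polar_snorm \<alpha> (z - y) \<le> \<epsilon>" using z(2) by simp
    obtain e where "represents z e" using rep z(1) by blast
    then show ?thesis using represents_approx[OF y zF _ le] by blast
  qed
  then show ?thesis
    using representation_in_complete_set[OF _ transpose_linear[OF y], of UNIV] assms(1)
    by (simp add: lcs_complete_def represents_def)
qed

section \<open>Representation under the weaker completeness conditions\<close>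

lemma closedin_seminorm_bounds: "closedin (lcs_topology E) {e. \<forall>\<alpha>. p \<alpha> e \<le> M \<alpha>}"
proof -
  have "x \<in> {e. \<forall>\<alpha>. p \<alpha> e \<le> M \<alpha>}" if x: "x \<in> lcs_topology E closure_of {e. \<forall>\<alpha>. p \<alpha> e \<le> M \<alpha>}" for x
  proof
    show "\<forall>\<alpha>. p \<alpha> x \<le> M \<alpha>"
    proof
      fix \<alpha>
      show "p \<alpha> x \<le> M \<alpha>"
      proof (rule field_le_epsilon)
        fix \<epsilon> :: real assume "\<epsilon> > 0"
        then obtain a where "\<forall>\<alpha>. p \<alpha> a \<le> M \<alpha>" "p \<alpha> (a - x) < \<epsilon>"
          using E.in_closure_iff[of "{e. \<forall>\<alpha>. p \<alpha> e \<le> M \<alpha>}" x, THEN iffD1, OF _ x, THEN conjunct2, rule_format, of "p \<alpha>" \<epsilon>]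
          by auto
        then show "p \<alpha> x \<le> M \<alpha> + \<epsilon>"
          using p_triangle[of \<alpha> a "x - a"] p_minus_commute[of \<alpha> x a] by (smt (verit) add_diff_cancel_left' diff_add_cancel add.commute)
      qed
    qed
  qed
  then show ?thesis by (intro closure_of_subset_eq[THEN iffD1]) auto
qed

lemma represented_if_quasi_complete:
  assumes E: "lcs_quasi_complete E" and y: "y \<in> dual F"
    and I: "directed_set I le" "g ` I \<subseteq> dual F" "lcs_bounded (kappa_dual F) (g ` I)"
    and conv: "net_converges (lcs_topology (kappa_dual F)) I le g y"
    and rep: "\<And>\<tau>. \<tau> \<in> I \<Longrightarrow> \<exists>e. represents (g \<tau>) e"
  shows "\<exists>e. represents y e"
proof -
  \<comment> \<open>Boundedness of the net makes these suprema finite, and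
    \<open>represents_le\<close> carries them over to the seminorms of the representers.\<close>
  define M where "M \<alpha> = (SUP \<tau>\<in>I. polar_snorm \<alpha> (g \<tau>))" for \<alpha>
  define B where "B = {e. \<forall>\<alpha>. p \<alpha> e \<le> M \<alpha>}"
  have M: "polar_snorm \<alpha> (g \<tau>) \<le> M \<alpha>" if "\<tau> \<in> I" for \<alpha> \<tau>
  proof -
    have "bdd_above (polar_snorm \<alpha> ` g ` I)" 
      by (rule I(3)[unfolded lcs_bounded_def, THEN conjunct2, THEN bspec, OF polar_snorm])
    then show ?thesis unfolding M_def by (intro cSUP_upper that) (simp add: image_image)
  qed
  have "closedin (lcs_topology E) B" unfolding B_def by (rule closedin_seminorm_bounds)
  moreover have "lcs_bounded E B" by (auto simp: lcs_bounded_def B_def intro!: bdd_aboveI2)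
  ultimately have B: "lcs_complete_set E B" using E unfolding lcs_quasi_complete_def by blast
  have "\<exists>e\<in>B. \<forall>e'\<in>polar_ball s p \<alpha>. norm (y (e' \<circ> f) - e' e) \<le> \<epsilon>" if e: "\<epsilon> > 0" for \<alpha> \<epsilon>
  proof -
    have "openin (lcs_topology (kappa_dual F)) {z \<in> vecs (kappa_dual F). polar_snorm \<alpha> (z - y) < \<epsilon>}"
      using y by (intro k.openin_ball polar_snorm) simp
    moreover have "y \<in> {z \<in> vecs (kappa_dual F). polar_snorm \<alpha> (z - y) < \<epsilon>}"
      using y e k.seminorm_on_0[OF k.snorm[OF polar_snorm]] by simp
    ultimately obtain \<tau> where \<tau>: "\<tau> \<in> I" "\<forall>b\<in>I. le \<tau> b \<longrightarrow> g b \<in> {z \<in> vecs (kappa_dual F). polar_snorm \<alpha> (z - y) < \<epsilon>}"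
      using conv unfolding net_converges_def by blast
    \<comment> \<open>Reflexivity of the order allows the index \<open>\<tau>\<close> itself to be
      taken.\<close>
    then have less: "polar_snorm \<alpha> (g \<tau> - y) < \<epsilon>" using I(1) unfolding directed_set_def by blast
    have g\<tau>: "g \<tau> \<in> dual F" using I(2) \<tau>(1) by blast
    obtain e where e: "represents (g \<tau>) e" using rep[OF \<tau>(1)] by blast
    have "e \<in> B" unfolding B_def using represents_le[OF g\<tau> e] M[OF \<tau>(1)] order_trans by blast
    then show ?thesis using represents_approx[OF y g\<tau> e less_imp_le[OF less]] by blast
  qed
  then show ?thesis
    using representation_in_complete_set[OF B transpose_linear[OF y]] by (simp add: represents_def)
qed

lemma represented_if_limit:
  assumes y: "y \<in> dual F" and conv: "limitin (lcs_topology (kappa_dual F)) g y G" and G: "G \<noteq> bot"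
    and rep: "\<And>i. represents (g i) (e i)" and lim: "limitin (lcs_topology E) e l G"
  shows "represents y l"
  unfolding represents_def
proof (intro ballI representation_by_limit[OF transpose_linear[OF y] lim G])
  fix \<alpha> and \<epsilon> :: real assume "\<epsilon> > 0"
  from kappa_limit_polar_snorm[OF conv this, of \<alpha>]
  show "eventually (\<lambda>i. \<forall>e'\<in>polar_ball s p \<alpha>. norm (y (e' \<circ> f) - e' (e i)) \<le> \<epsilon>) G"
    by eventually_elim (auto intro: represents_approx[OF y _ rep less_imp_le])
qed

text \<open>Differences of representers represent differences of functionals, so a convergent
  sequence of functionals has a Cauchy sequence of representers.\<close>

lemma represented_if_seq_complete:
  assumes E: "lcs_seq_complete E" and y: "y \<in> dual F" and g: "range g \<subseteq> dual F"
    and conv: "limitin (lcs_topology (kappa_dual F)) g y sequentially"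
    and rep: "\<And>n. \<exists>e. represents (g n) e"
  shows "\<exists>e. represents y e"
proof -
  obtain e where e: "\<And>n. represents (g n) (e n)" using rep by metis
  have gF: "g n \<in> dual F" for n using g by blast
  have "\<exists>N. \<forall>m\<ge>N. \<forall>n\<ge>N. p \<alpha> (e m - e n) < \<epsilon>" if \<epsilon>: "\<epsilon> > 0" for \<alpha> \<epsilon>
  proof -
    obtain N where N: "\<And>n. n \<ge> N \<Longrightarrow> polar_snorm \<alpha> (g n - y) < \<epsilon> / 2"
      using kappa_limit_polar_snorm[OF conv half_gt_zero[OF \<epsilon>], of \<alpha>] unfolding eventually_sequentially by blast
    have "p \<alpha> (e m - e n) < \<epsilon>" if mn: "m \<ge> N" "n \<ge> N" for m n
    proof -
      have "p \<alpha> (e m - e n) \<le> polar_snorm \<alpha> (g m - g n)"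
        using k.V_diff gF by (intro represents_le represents_diff e) simp
      also have "g m - g n = (g m - y) - (g n - y)" by simp
      also have "polar_snorm \<alpha> \<dots> \<le> polar_snorm \<alpha> (g m - y) + polar_snorm \<alpha> (g n - y)"
        by (intro k.seminorm_on_diff k.snorm polar_snorm) (simp_all only: F.kappa_dual_simps dual_F_diff gF y)
      finally show ?thesis using N[OF mn(1)] N[OF mn(2)] by simp
    qed
    then show ?thesis by blast
  qed
  then have "\<forall>q\<in>snorms E. \<forall>\<epsilon>>0. \<exists>N. \<forall>m\<ge>N. \<forall>n\<ge>N. q (e m - e n) < \<epsilon>" by simp
  then obtain l where "limitin (lcs_topology E) e l sequentially"
    using E unfolding lcs_seq_complete_def by (metis lcs_of_simps(1) subset_UNIV)
  then show ?thesis using represented_if_limit[OF y conv _ e] by auto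
qed

text \<open>The disk \<open>A\<close> in the dual is transported to a closed disk \<open>B\<close>
  in \<open>E\<close> such that representers of elements of \<open>t A\<close> lie in
  \<open>t B\<close>. Thus the representers form a Cauchy sequence for the gauge of
  \<open>B\<close>, and local completeness yields a limit.\<close>

lemma represented_if_locally_complete:
  assumes E: "locally_complete E" and y: "y \<in> dual F" and g: "range g \<subseteq> dual F"
    and conv: "locally_converges (kappa_dual F) g y"
    and rep: "\<And>n. \<exists>e. represents (g n) e"
  shows "\<exists>e. represents y e"
proof -
  obtain e where e: "\<And>n. represents (g n) (e n)" using rep by metis
  obtain A where A: "disk (kappa_dual F) A" "range g \<subseteq> vecs (disk_space (kappa_dual F) A)"
    "limitin (lcs_topology (disk_space (kappa_dual F) A)) g y sequentially"
    using conv unfolding locally_converges_def by blast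
  have acA: "abs_convex (kappa_dual F) A" and bA: "lcs_bounded (kappa_dual F) A"
    using A(1) by (auto simp: disk_def)
  have AF: "A \<subseteq> dual F" and A_ne: "A \<noteq> {}" using abs_convexD(1,2)[OF acA] by auto
  have snorm_bdd: "bdd_above (polar_snorm \<alpha> ` A)" for \<alpha>
    by (rule bA[unfolded lcs_bounded_def, THEN conjunct2, THEN bspec, OF polar_snorm])
  \<comment> \<open>\<open>N e'\<close> is the bound that all elements of \<open>A\<close> impose on
    a representing vector in the direction \<open>e'\<close>; \<open>B\<close> collects the vectors
    obeying all these bounds.\<close>
  define N where "N e' = (SUP y\<in>A. norm (y (e' \<circ> f)))" for e'
  have bdd: "bdd_above ((\<lambda>y. norm (y (e' \<circ> f))) ` A)" if e': "e' \<in> dual E" for e'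
  proof -
    obtain \<alpha> C d where d: "C > 0" "d \<in> polar_ball s p \<alpha>" "e' = (\<lambda>x. of_real C * d x)"
      using dual_scaled_polar[OF e'] by blast
    obtain M where M: "\<And>y. y \<in> A \<Longrightarrow> polar_snorm \<alpha> y \<le> M" using snorm_bdd[of \<alpha>] unfolding bdd_above_def by blast
    have "norm (y (e' \<circ> f)) \<le> C * M" if yA: "y \<in> A" for y
    proof -
      have yF: "y \<in> dual F" using AF yA by blast
      have "y (e' \<circ> f) = of_real C * y (d \<circ> f)"
        unfolding d(3) by (rule linear_on_scale[OF transpose_linear[OF yF] polar_dual[OF d(2)]])
      then show ?thesis
        using transpose_le[OF yF d(2)] M[OF yA] d(1) by (simp add: norm_mult)
    qed
    then show ?thesis by (intro bdd_aboveI2)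
  qed
  have N_ge: "norm (y (e' \<circ> f)) \<le> N e'" if "y \<in> A" "e' \<in> dual E" for y e'
    unfolding N_def using that bdd by (intro cSUP_upper)
  define B where "B = {e. \<forall>e'\<in>dual E. norm (e' e) \<le> N e'}"
  have acB: "abs_convex E B"
    unfolding abs_convex_def
  proof (intro conjI ballI allI impI)
    obtain z where z: "z \<in> A" using A_ne by blast
    have "0 \<le> N e'" if "e' \<in> dual E" for e' using N_ge[OF z that] norm_ge_zero order_trans by blast
    then have "0 \<in> B" by (simp add: B_def dual_0)
    then show "B \<noteq> {}" by blast
    fix u v and a b :: 'k assume uv: "u \<in> B" "v \<in> B" and ab: "norm a + norm b \<le> 1"
    have "norm (e' (s a u + s b v)) \<le> N e'" if e': "e' \<in> dual E" for e'
    proof -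
      have u: "norm (e' u) \<le> N e'" and v: "norm (e' v) \<le> N e'" using uv e' by (auto simp: B_def)
      have "norm (e' (s a u + s b v)) \<le> norm a * norm (e' u) + norm b * norm (e' v)"
        using norm_triangle_ineq[of "a * e' u" "b * e' v"] by (simp add: norm_mult dual_add[OF e'] dual_scale[OF e'])
      also have "\<dots> \<le> norm a * N e' + norm b * N e'" using u v by (intro add_mono mult_left_mono) auto
      also have "\<dots> \<le> N e'"
        using mult_right_mono[OF ab, of "N e'"] u norm_ge_zero[of "e' u"] by (simp add: algebra_simps)
      finally show ?thesis .
    qed
    then show "scl E a u + scl E b v \<in> B" by (simp add: B_def)
  qed simp
  have "lcs_bounded E B"
    unfolding lcs_bounded_def
  proof (intro conjI ballI)
    fix q assume "q \<in> snorms E"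
    then obtain \<alpha> where q: "q = p \<alpha>" by auto
    obtain M where M: "\<And>y. y \<in> A \<Longrightarrow> polar_snorm \<alpha> y \<le> M" using snorm_bdd[of \<alpha>] unfolding bdd_above_def by blast
    \<comment> \<open>On a polar the numbers \<open>N e'\<close> are bounded by the supremum of
      \<open>polar_snorm \<alpha>\<close> over \<open>A\<close>, so \<open>p_le_polar\<close>
      applies.\<close>
    have "p \<alpha> u \<le> M" if u: "u \<in> B" for u
    proof (rule p_le_polar)
      fix e' assume e': "e' \<in> polar_ball s p \<alpha>"
      have "N e' \<le> M"
        unfolding N_def using transpose_le[OF _ e'] M AF A_ne by (intro cSUP_least) (auto intro: order_trans)
      then show "norm (e' u) \<le> M" using u polar_dual[OF e'] unfolding B_def by force
    qed
    then show "bdd_above (q ` B)" unfolding q by (intro bdd_aboveI2)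
  qed simp
  then have diskB: "disk E B" using acB by (simp add: disk_def)
  \<comment> \<open>Each of the defining inequalities involves one continuous functional and
    therefore survives limits.\<close>
  have "x \<in> B" if x: "x \<in> lcs_topology E closure_of B" for x
    unfolding B_def
  proof (intro CollectI ballI)
    fix e' assume e': "e' \<in> dual E"
    then obtain \<alpha> C where C: "C > 0" "\<And>x. norm (e' x) \<le> C * p \<alpha> x" using dual_E_iff by blast
    show "norm (e' x) \<le> N e'"
    proof (rule field_le_epsilon)
      fix \<epsilon> :: real assume "\<epsilon> > 0"
      then have "\<epsilon> / C > 0" using C(1) by simp
      then obtain a where a: "a \<in> B" "p \<alpha> (a - x) < \<epsilon> / C"
        using x by (subst (asm) E.in_closure_iff) auto
      have "norm (e' (a - x)) \<le> C * p \<alpha> (a - x)" by (rule C(2))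
      also have "\<dots> \<le> \<epsilon>" using a(2) C(1) by (simp add: field_simps)
      finally have "norm (e' a - e' x) \<le> \<epsilon>" by (simp add: dual_diff[OF e'])
      moreover have "norm (e' a) \<le> N e'" using a(1) e' by (simp add: B_def)
      ultimately show "norm (e' x) \<le> N e' + \<epsilon>"
        using norm_triangle_ineq2[of "e' x" "e' a"] by (simp add: norm_minus_commute)
    qed
  qed
  then have "closedin (lcs_topology E) B" by (intro closure_of_subset_eq[THEN iffD1]) auto
  then have complete: "lcs_seq_complete (disk_space E B)"
    using E diskB unfolding locally_complete_def by blast
  have scaled: "u \<in> s (of_real t) ` B"
    if z: "z \<in> scl (kappa_dual F) (of_real t) ` A" and u: "represents z u" and t: "t > 0" for z u t
  proof -
    obtain a where a: "a \<in> A" "z = scl (kappa_dual F) (of_real t) a" using z by blast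
    have "represents (\<lambda>x. of_real (1 / t) * z x) (s (of_real (1 / t)) u)" by (rule represents_scale[OF u])
    moreover have "(\<lambda>x. of_real (1 / t) * z x) = a" using t by (simp add: a(2) fun_eq_iff)
    ultimately have "s (of_real (1 / t)) u \<in> B"
      unfolding B_def using N_ge[OF a(1)] representsD by fastforce
    moreover have "u = s (of_real t) (s (of_real (1 / t)) u)"
      using t E.scale_scale[of "of_real t" "of_real (1 / t)" u] E.scale_one[of u] by simp
    ultimately show ?thesis by blast
  qed
  have e_in: "range e \<subseteq> vecs (disk_space E B)"
  proof
    fix u assume "u \<in> range e"
    then obtain n where n: "u = e n" by blast
    obtain t where "t > 0" "g n \<in> scl (kappa_dual F) (of_real t) ` A"
      using A(2) k.in_disk_space_iff[OF acA, of "g n"] by blast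
    then show "u \<in> vecs (disk_space E B)" using scaled[OF _ e] n E.in_disk_space_iff[OF acB] by auto
  qed
  have "\<exists>n0. \<forall>m\<ge>n0. \<forall>n\<ge>n0. gauge_norm E B (e m - e n) < \<epsilon>" if \<epsilon>: "\<epsilon> > 0" for \<epsilon>
  proof -
    have e3: "\<epsilon> / 3 > 0" using \<epsilon> by simp
    \<comment> \<open>Two differences from the limit add up to a factor of two thirds of
      \<open>\<epsilon>\<close>, which gives the strict inequality although the gauge is only
      bounded weakly.\<close>
    obtain n0 where n0: "\<And>n. n \<ge> n0 \<Longrightarrow> g n - y \<in> scl (kappa_dual F) (of_real (\<epsilon> / 3)) ` A"
      using k.disk_space_limit_gauge[OF acA A(3) e3] unfolding eventually_sequentially by blast
    have "gauge_norm E B (e m - e n) < \<epsilon>" if mn: "m \<ge> n0" "n \<ge> n0" for m n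
    proof -
      have "(g m - y) + - (g n - y) \<in> scl (kappa_dual F) (of_real (\<epsilon> / 3 + \<epsilon> / 3)) ` A"
        by (rule k.scale_disk_add[OF acA n0[OF mn(1)] k.scale_disk_minus[OF acA n0[OF mn(2)]] e3 e3])
      then have "g m - g n \<in> scl (kappa_dual F) (of_real (\<epsilon> / 3 + \<epsilon> / 3)) ` A" by (simp only: minus_diff_eq add_diff_eq diff_add_cancel)
      then have "e m - e n \<in> s (of_real (\<epsilon> / 3 + \<epsilon> / 3)) ` B"
        using \<epsilon> by (intro scaled[OF _ represents_diff[OF e e]]) auto
      then have "gauge_norm E B (e m - e n) \<le> \<epsilon> / 3 + \<epsilon> / 3" using \<epsilon> by (intro E.gauge_le) auto
      then show ?thesis using \<epsilon> by linarith
    qed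
    then show ?thesis by blast
  qed
  then have "\<forall>q\<in>snorms (disk_space E B). \<forall>\<epsilon>>0. \<exists>n0. \<forall>m\<ge>n0. \<forall>n\<ge>n0. q (e m - e n) < \<epsilon>" by simp
  then obtain l where "limitin (lcs_topology (disk_space E B)) e l sequentially"
    using complete e_in unfolding lcs_seq_complete_def by blast
  then have "limitin (lcs_topology E) e l sequentially" by (rule E.disk_space_limit[OF diskB])
  then show ?thesis
    using represented_if_limit[OF y k.disk_space_limit[OF A(1,3)] _ e] by auto
qed

section \<open>The transposed map as an element of the epsilon-product\<close>

lemma canon_inj_eq_iff: "Rt_dual E f y = canon_inj E e \<longleftrightarrow> represents y e"
  unfolding Rt_dual_def canon_inj_def represents_def fun_eq_iff by auto

lemma inj_canon_inj: "inj (canon_inj E)"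
proof (rule injI, rule dual_separates)
  fix x y e' assume eq: "canon_inj E x = canon_inj E y" and e': "e' \<in> dual E"
  from fun_cong[OF eq, of e'] e' show "e' x = e' y" by (simp add: canon_inj_def)
qed

lemma Rt_dual_in_range_iff: "Rt_dual E f y \<in> range (canon_inj E) \<longleftrightarrow> (\<exists>e. represents y e)"
  by (auto simp: image_iff canon_inj_eq_iff)

lemma Rt_map_eq: "y \<in> dual F \<Longrightarrow> represents y e \<Longrightarrow> Rt_map F E f y = e"
  unfolding Rt_map_def using canon_inj_eq_iff[of y e] inv_f_f[OF inj_canon_inj] by simp

text \<open>Representing vectors are unique, so linearity and the value at a point evaluation follow
  by naming a representer; continuity is \<open>represents_le\<close>.\<close>

lemma Rt_map_in_eps_product:
  assumes rep: "\<And>y. y \<in> dual F \<Longrightarrow> \<exists>e. represents y e"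
  shows "Rt_map F E f \<in> vecs (eps_product F E)" "S_map F (Rt_map F E f) = f"
proof -
  let ?u = "Rt_map F E f"
  have u: "represents y (?u y)" if "y \<in> dual F" for y
    using rep[OF that] Rt_map_eq[OF that] by blast
  have lin: "linear_on (dual F) (scl (kappa_dual F)) (scl E) ?u"
    unfolding linear_on_def
  proof (intro conjI ballI allI)
    fix y z assume "y \<in> dual F" "z \<in> dual F"
    then show "?u (y + z) = ?u y + ?u z"
      using k.V_add by (intro Rt_map_eq represents_add u) auto
  next
    fix c y assume y: "y \<in> dual F"
    then show "?u (scl (kappa_dual F) c y) = scl E c (?u y)"
      using k.V_scale[of y c] represents_scale[OF u[OF y]] by (intro Rt_map_eq) auto
  qed
  have "continuous_map (lcs_topology (kappa_dual F)) (lcs_topology E) ?u"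
  proof (rule bounded_imp_continuous_map)
    show "?u (x - y) = ?u x - ?u y" if "x \<in> vecs (kappa_dual F)" "y \<in> vecs (kappa_dual F)" for x y
      using that k.V_diff by (intro Rt_map_eq represents_diff u) auto
    fix r assume "r \<in> snorms E"
    then obtain \<alpha> where r: "r = p \<alpha>" by auto
    show "\<exists>q\<in>snorms (kappa_dual F). \<exists>C>0. \<forall>x\<in>vecs (kappa_dual F). r (?u x) \<le> C * q x"
      unfolding r using represents_le u
      by (intro bexI[OF _ polar_snorm[of \<alpha>]] exI[of _ 1]) simp
  qed (use k.V_diff in auto)
  then show "?u \<in> vecs (eps_product F E)" using lin by (simp add: eps_product_def Rt_map_def)
  show "S_map F ?u = f"
    using Rt_map_eq[OF eval represents_eval] by (simp add: S_map_def fun_eq_iff)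
qed

end

section \<open>Equicontinuous sets and weak continuity\<close>

context lc_space
begin

lemma equicontinuous_bound:
  assumes "equicontinuous X H"
  obtains q C where "q \<in> snorms X" "C > 0" "\<And>y x. y \<in> H \<Longrightarrow> x \<in> vecs X \<Longrightarrow> norm (y x) \<le> C * q x"
proof -
  have HX: "H \<subseteq> dual X" using assms by (simp add: equicontinuous_def)
  obtain U where U: "openin (lcs_topology X) U" "0 \<in> U" "\<And>y x. y \<in> H \<Longrightarrow> x \<in> U \<Longrightarrow> norm (y x) < 1"
    using assms unfolding equicontinuous_def by (metis zero_less_one)
  obtain q \<delta> where q: "q \<in> snorms X" "\<delta> > 0" "{x \<in> vecs X. q (x - 0) < \<delta>} \<subseteq> U"
    using open_contains_ball[OF U(1,2)] by blast
  have "norm (y x) \<le> (1 / \<delta>) * q x" if y: "y \<in> H" and x: "x \<in> vecs X" for y x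
  proof (rule homogeneous_bound[OF q(1,2) _ _ x])
    fix z and a :: real assume "z \<in> vecs X" "a > 0"
    then show "norm (y (scl X (of_real a) z)) = a * norm (y z)"
      using linear_on_scale[OF dual_linear, of y z] HX y by (auto simp: norm_mult)
  next
    fix z assume "z \<in> vecs X" "q z < \<delta>"
    then show "norm (y z) < 1" using q(3) by (intro U(3)[OF y]) auto
  qed
  then show ?thesis using q by (intro that[of q "1 / \<delta>"]) auto
qed

lemma snorm_bdd_above_compact:
  assumes K: "compactin (lcs_topology X) K" and q: "q \<in> snorms X"
  shows "bdd_above (q ` K)"
proof -
  define U where "U n = {x \<in> vecs X. q (x - 0) < real n}" for n
  have "openin (lcs_topology X) (U n)" for n
    unfolding U_def by (rule openin_ball[OF q V_0])
  moreover have "K \<subseteq> \<Union>(range U)"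
    using compactin_subset_topspace[OF K] reals_Archimedean2 by (fastforce simp: U_def)
  ultimately obtain \<F> where \<F>: "finite \<F>" "\<F> \<subseteq> range U" "K \<subseteq> \<Union>\<F>"
    using compactinD[OF K, of "range U"] by blast
  obtain I where I: "finite I" "\<F> = U ` I" using finite_subset_image[OF \<F>(1,2)] by blast
  \<comment> \<open>The sum replaces the maximum of the radii and needs no separate treatment of an
    empty subcover.\<close>
  have "q x \<le> (\<Sum>n\<in>I. real n)" if x: "x \<in> K" for x
  proof -
    obtain n where n: "n \<in> I" "x \<in> U n" using \<F>(3) I(2) x by blast
    have "q x < real n" using n(2) by (simp add: U_def)
    also have "\<dots> \<le> (\<Sum>n\<in>I. real n)" using member_le_sum[OF n(1), of real] I(1) by simp
    finally show ?thesis by simp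
  qed
  then show ?thesis by (intro bdd_aboveI2)
qed

text \<open>Equicontinuous sets are bounded for compact convergence; hence the suprema in the
  seminorms of the \<open>\<epsilon>\<close>-product are finite.\<close>

lemma kappa_snorm_bdd_above_equicontinuous:
  assumes H: "equicontinuous X H" and q: "q \<in> snorms (kappa_dual X)"
  shows "bdd_above (q ` H)"
proof -
  obtain K where K: "q = (\<lambda>y. SUP x\<in>K. norm (y x))" "abs_convex X K" "compactin (lcs_topology X) K"
    using q kappa_snorm_iff by blast
  obtain r C where r: "r \<in> snorms X" "C > 0" "\<And>y x. y \<in> H \<Longrightarrow> x \<in> vecs X \<Longrightarrow> norm (y x) \<le> C * r x"
    using equicontinuous_bound[OF H] by blast
  obtain M where M: "\<And>x. x \<in> K \<Longrightarrow> r x \<le> M"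
    using snorm_bdd_above_compact[OF K(3) r(1)] unfolding bdd_above_def by blast
  have "q y \<le> C * M" if y: "y \<in> H" for y
    unfolding K(1)
  proof (rule kappa_snorm_le[OF K(2)])
    fix x assume x: "x \<in> K"
    have "norm (y x) \<le> C * r x" using abs_convexD(2)[OF K(2)] x by (intro r(3)[OF y]) blast
    also have "\<dots> \<le> C * M" using M[OF x] r(2) by simp
    finally show "norm (y x) \<le> C * M" .
  qed
  then show ?thesis by (intro bdd_aboveI2)
qed

lemma dual_weakly_continuous:
  assumes "y \<in> dual X"
  shows "continuous_map (weak_topology X) euclidean y"
proof -
  have "continuous_map (weak_topology X) (lcs_topology scalar_lcs) y"
    unfolding weak_topology_def
  proof (rule bounded_imp_continuous_map)
    fix r :: "'k \<Rightarrow> real" assume "r \<in> snorms scalar_lcs"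
    then show "\<exists>q\<in>snorms (X\<lparr>snorms := {\<lambda>x. norm (y x) |y. y \<in> dual X}\<rparr>). \<exists>C>0.
        \<forall>x\<in>vecs (X\<lparr>snorms := {\<lambda>x. norm (y x) |y. y \<in> dual X}\<rparr>). r (y x) \<le> C * q x"
      using assms by (intro bexI[of _ "\<lambda>x. norm (y x)"] exI[of _ 1]) auto
  next
    fix a b assume "a \<in> vecs (X\<lparr>snorms := {\<lambda>x. norm (y x) |y. y \<in> dual X}\<rparr>)"
      "b \<in> vecs (X\<lparr>snorms := {\<lambda>x. norm (y x) |y. y \<in> dual X}\<rparr>)"
    then show "y (a - b) = y a - y b"
      using linear_on_add[OF dual_linear[OF assms] V_diff, of a b b] by simp
  qed (auto intro: V_diff)
  then show ?thesis by simp
qed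

end

section \<open>Weighted function spaces\<close>

lemma lc_space_FV_space:
  fixes s :: "'k::real_or_complex \<Rightarrow> 'y::ab_group_add \<Rightarrow> 'y"
  assumes s: "vector_space s" and p: "\<And>\<alpha>. seminorm_on UNIV s (p \<alpha>)"
    and w: "weights \<omega> \<nu>" and D: "linear_data s \<omega> D" and dir: "directed_seminorms (FV_space s p \<omega> \<nu> D)"
  shows "lc_space (FV_space s p \<omega> \<nu> D)"
proof -
  let ?X = "FV_space s p \<omega> \<nu> D"
  interpret s: vector_space s by (rule s)
  have vs: "vector_space (pointwise s :: 'k \<Rightarrow> ('x \<Rightarrow> 'y) \<Rightarrow> 'x \<Rightarrow> 'y)"
    by unfold_locales
      (auto simp: pointwise_def fun_eq_iff s.scale_right_distrib s.scale_left_distrib)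
  interpret f: vector_space "pointwise s :: 'k \<Rightarrow> ('x \<Rightarrow> 'y) \<Rightarrow> 'x \<Rightarrow> 'y" by (rule vs)
  have AP: "f.subspace (fd_AP D)" and dom: "\<And>m. f.subspace (fd_dom D m)"
    and op: "\<And>m x. x \<in> \<omega> m \<Longrightarrow> linear_on (fd_dom D m) (pointwise s) s (\<lambda>f. fd_op D m f x)"
    using D by (auto simp: linear_data_def)
  have \<nu>: "0 \<le> \<nu> j m x" if "x \<in> \<omega> m" for j m x using w that by (auto simp: weights_def)
  have \<omega>: "\<omega> m \<noteq> {}" for m using w by (auto simp: weights_def)
  define v where "v \<alpha> j m f x = p \<alpha> (fd_op D m f x) * \<nu> j m x" for \<alpha> j m f x
  have vecs: "vecs ?X = {f \<in> F_space D. \<forall>j m \<alpha>. bdd_above (v \<alpha> j m f ` \<omega> m)}"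
    by (simp add: FV_space_def v_def[abs_def])
  have snorms: "snorms ?X = {\<lambda>f. SUP x\<in>\<omega> m. v \<alpha> j m f x | j m \<alpha>. True}"
    by (simp add: FV_space_def v_def)
  have F: "f.subspace (F_space D)"
    unfolding F_space_def by (intro f.subspace_inter AP f.subspace_Inter) (use dom in auto)
  have Fdom: "f \<in> fd_dom D m" if "f \<in> F_space D" for f m using that by (auto simp: F_space_def)
  have v_nonneg: "0 \<le> v \<alpha> j m f x" if "x \<in> \<omega> m" for \<alpha> j m f x
    using \<nu>[OF that] seminorm_on_nonneg[OF p] by (simp add: v_def)
  have v_add: "v \<alpha> j m (f + g) x \<le> v \<alpha> j m f x + v \<alpha> j m g x"
    if "x \<in> \<omega> m" "f \<in> F_space D" "g \<in> F_space D" for \<alpha> j m f g x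
  proof -
    have "fd_op D m (f + g) x = fd_op D m f x + fd_op D m g x"
      using linear_on_add[OF op[OF that(1)] Fdom[OF that(2)] Fdom[OF that(3)]] .
    then have "v \<alpha> j m (f + g) x \<le> (p \<alpha> (fd_op D m f x) + p \<alpha> (fd_op D m g x)) * \<nu> j m x"
      using seminorm_on_add[OF p] \<nu>[OF that(1)] by (simp add: v_def mult_right_mono)
    then show ?thesis by (simp add: v_def distrib_right)
  qed
  have v_scale: "v \<alpha> j m (pointwise s c f) x = norm c * v \<alpha> j m f x"
    if "x \<in> \<omega> m" "f \<in> F_space D" for \<alpha> j m c f x
    using linear_on_scale[OF op[OF that(1)] Fdom[OF that(2)]] seminorm_on_scale[OF p] by (simp add: v_def)
  have bdd: "bdd_above (v \<alpha> j m f ` \<omega> m)" if "f \<in> vecs ?X" for \<alpha> j m f using that vecs by auto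
  have v_le: "v \<alpha> j m f x \<le> (SUP x\<in>\<omega> m. v \<alpha> j m f x)" if "f \<in> vecs ?X" "x \<in> \<omega> m" for \<alpha> j m f x
    using that bdd by (intro cSUP_upper)
  have VF: "vecs ?X \<subseteq> F_space D" using vecs by auto
  have sub: "f.subspace (vecs ?X)"
  proof (rule f.subspaceI)
    have "v \<alpha> j m 0 x = 0" if "x \<in> \<omega> m" for \<alpha> j m x
      using v_scale[OF that f.subspace_0[OF F], of \<alpha> j 0] by simp
    then show "0 \<in> vecs ?X" unfolding vecs using f.subspace_0[OF F] by (auto intro!: bdd_aboveI2[of _ _ 0])
  next
    fix f g assume fg: "f \<in> vecs ?X" "g \<in> vecs ?X"
    have bd: "bdd_above (v \<alpha> j m (f + g) ` \<omega> m)" for \<alpha> j m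
    proof (rule bdd_aboveI2)
      fix x assume x: "x \<in> \<omega> m"
      show "v \<alpha> j m (f + g) x \<le> (SUP x\<in>\<omega> m. v \<alpha> j m f x) + (SUP x\<in>\<omega> m. v \<alpha> j m g x)"
        using v_add[OF x, of f g \<alpha> j] v_le[OF fg(1) x, of \<alpha> j] v_le[OF fg(2) x, of \<alpha> j] fg VF by force
    qed
    have "f + g \<in> F_space D" using fg VF by (intro f.subspace_add[OF F]) auto
    with bd show "f + g \<in> vecs ?X" unfolding vecs by simp
  next
    fix c f assume f: "f \<in> vecs ?X"
    have bd: "bdd_above (v \<alpha> j m (pointwise s c f) ` \<omega> m)" for \<alpha> j m
    proof (rule bdd_aboveI2)
      fix x assume x: "x \<in> \<omega> m"
      show "v \<alpha> j m (pointwise s c f) x \<le> norm c * (SUP x\<in>\<omega> m. v \<alpha> j m f x)"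
        using mult_left_mono[OF v_le[OF f x, of \<alpha> j], of "norm c"] v_scale[OF x, of f \<alpha> j c] f VF by auto
    qed
    have "pointwise s c f \<in> F_space D" using f VF by (intro f.subspace_scale[OF F]) auto
    with bd show "pointwise s c f \<in> vecs ?X" unfolding vecs by simp
  qed
  interpret V: subspace_of "pointwise s" "vecs ?X" by unfold_locales (rule sub)
  have "seminorm_on (vecs ?X) (pointwise s) (\<lambda>f. SUP x\<in>\<omega> m. v \<alpha> j m f x)" for \<alpha> j m
  proof (rule V.seminorm_onI)
    obtain x where x: "x \<in> \<omega> m" using \<omega> by blast
    show "0 \<le> (SUP x\<in>\<omega> m. v \<alpha> j m f x)" if "f \<in> vecs ?X" for f
      using v_le[OF that x, of \<alpha> j] v_nonneg[OF x, of \<alpha> j f] by linarith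
  next
    fix f g assume fg: "f \<in> vecs ?X" "g \<in> vecs ?X"
    show "(SUP x\<in>\<omega> m. v \<alpha> j m (f + g) x) \<le> (SUP x\<in>\<omega> m. v \<alpha> j m f x) + (SUP x\<in>\<omega> m. v \<alpha> j m g x)"
    proof (rule cSUP_least[OF \<omega>])
      fix x assume x: "x \<in> \<omega> m"
      show "v \<alpha> j m (f + g) x \<le> (SUP x\<in>\<omega> m. v \<alpha> j m f x) + (SUP x\<in>\<omega> m. v \<alpha> j m g x)"
        using v_add[OF x, of f g \<alpha> j] v_le[OF fg(1) x, of \<alpha> j] v_le[OF fg(2) x, of \<alpha> j] fg VF by force
    qed
  next
    fix c f assume f: "f \<in> vecs ?X"
    show "(SUP x\<in>\<omega> m. v \<alpha> j m (pointwise s c f) x) \<le> norm c * (SUP x\<in>\<omega> m. v \<alpha> j m f x)"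
    proof (rule cSUP_least[OF \<omega>])
      fix x assume x: "x \<in> \<omega> m"
      show "v \<alpha> j m (pointwise s c f) x \<le> norm c * (SUP x\<in>\<omega> m. v \<alpha> j m f x)"
        using mult_left_mono[OF v_le[OF f x, of \<alpha> j], of "norm c"] v_scale[OF x, of f \<alpha> j c] f VF by auto
    qed
  qed
  moreover have scl: "scl ?X = pointwise s" by (simp add: FV_space_def)
  ultimately show ?thesis
    using V.subspace_of_axioms dir unfolding lc_space_def lc_space_axioms_def scl snorms by auto
qed

lemma FV_space_simps:
  "scl (FV_space s p \<omega> \<nu> D) = pointwise s"
  "vecs (FV_space s p \<omega> \<nu> D) = {f \<in> F_space D. \<forall>j m \<alpha>. bdd_above ((\<lambda>x. p \<alpha> (fd_op D m f x) * \<nu> j m x) ` \<omega> m)}"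
  "snorms (FV_space s p \<omega> \<nu> D) = {\<lambda>f. SUP x\<in>\<omega> m. p \<alpha> (fd_op D m f x) * \<nu> j m x | j m \<alpha>. True}"
  by (simp_all add: FV_space_def)

section \<open>The scalar-valued and the vector-valued weighted space\<close>

locale weighted_spaces = seminorm_family s p
  for s :: "'k::real_or_complex \<Rightarrow> 'e::ab_group_add \<Rightarrow> 'e" and p :: "'a \<Rightarrow> 'e \<Rightarrow> real" +
  fixes \<omega> :: "'m \<Rightarrow> 'w set"
    and \<nu> :: "'j \<Rightarrow> 'm \<Rightarrow> 'w \<Rightarrow> real"
    and DE :: "('x, 'e, 'm, 'w) fun_data"
    and D :: "('x, 'k, 'm, 'w) fun_data"
  assumes gen: "generator s p \<omega> \<nu> DE D"
    and strong: "strong s p \<omega> \<nu> DE D"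
    and consistent: "consistent s p \<omega> \<nu> DE D"
    and kappa: "vecs (FV_space s p \<omega> \<nu> DE) \<subseteq> FV_kappa (FV_scalar \<omega> \<nu> D) s p"
begin

abbreviation "FV \<equiv> FV_scalar \<omega> \<nu> D"
abbreviation "FVE \<equiv> FV_space s p \<omega> \<nu> DE"

lemma \<omega>_nonempty: "\<omega> m \<noteq> {}"
  and \<nu>_nonneg: "x \<in> \<omega> m \<Longrightarrow> 0 \<le> \<nu> j m x"
  and \<nu>_pos: "x \<in> \<omega> m \<Longrightarrow> \<exists>j. \<nu> j m x > 0"
  using gen by (auto simp: generator_def weights_def)

sublocale F: lc_space FV
proof (rule lc_space_FV_space)
  show "vector_space ((*) :: 'k \<Rightarrow> 'k \<Rightarrow> 'k)" by unfold_locales (auto simp: algebra_simps)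
  show "seminorm_on UNIV (*) (norm :: 'k \<Rightarrow> real)"
    by (simp add: seminorm_on_def norm_mult norm_triangle_ineq)
qed (use gen in \<open>auto simp: generator_def\<close>)

sublocale FE: lc_space FVE
proof (rule lc_space_FV_space)
  show "vector_space s" using E.vector_space_axioms by simp
qed (use gen p_seminorm in \<open>auto simp: generator_def\<close>)

sublocale k: lc_space "kappa_dual FV" by (rule F.lc_space_kappa_dual)

definition nrm :: "'j \<Rightarrow> 'm \<Rightarrow> ('x \<Rightarrow> 'k) \<Rightarrow> real" where
  "nrm j m f = (SUP x\<in>\<omega> m. norm (fd_op D m f x) * \<nu> j m x)"

definition nrmE :: "'a \<Rightarrow> 'j \<Rightarrow> 'm \<Rightarrow> ('x \<Rightarrow> 'e) \<Rightarrow> real" where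
  "nrmE \<alpha> j m f = (SUP x\<in>\<omega> m. p \<alpha> (fd_op DE m f x) * \<nu> j m x)"

lemma snorms_FV: "snorms FV = {nrm j m | j m. True}"
  unfolding FV_space_simps nrm_def[abs_def] by simp

lemma snorms_FVE: "snorms FVE = {nrmE \<alpha> j m | \<alpha> j m. True}"
  unfolding FV_space_simps nrmE_def[abs_def] by blast

lemma nrm_ge: "f \<in> vecs FV \<Longrightarrow> x \<in> \<omega> m \<Longrightarrow> norm (fd_op D m f x) * \<nu> j m x \<le> nrm j m f"
  unfolding nrm_def by (rule cSUP_upper) (simp_all add: FV_space_simps)

lemma nrmE_ge: "f \<in> vecs FVE \<Longrightarrow> x \<in> \<omega> m \<Longrightarrow> p \<alpha> (fd_op DE m f x) * \<nu> j m x \<le> nrmE \<alpha> j m f"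
  unfolding nrmE_def by (rule cSUP_upper) (simp_all add: FV_space_simps)

lemma fd_op_linear: "x \<in> \<omega> m \<Longrightarrow> linear_on (vecs FV) (pointwise (*)) (*) (\<lambda>f. fd_op D m f x)"
  using gen unfolding generator_def linear_data_def linear_on_def FV_space_simps F_space_def by auto

text \<open>Some weight is positive at \<open>x\<close>, and dividing by it bounds the evaluation by
  a single weighted seminorm.\<close>

lemma op_eval_dual:
  assumes x: "x \<in> \<omega> m"
  shows "op_eval FV D m x \<in> dual FV"
  unfolding F.dual_iff
proof (intro conjI)
  show "linear_on (vecs FV) (scl FV) (*) (op_eval FV D m x)"
    using fd_op_linear[OF x] F.V_add F.V_scale unfolding linear_on_def op_eval_def by (simp add: FV_space_simps(1))
  obtain j where j: "\<nu> j m x > 0" using \<nu>_pos[OF x] by blast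
  have "norm (op_eval FV D m x f) \<le> (1 / \<nu> j m x) * nrm j m f" if "f \<in> vecs FV" for f
    using nrm_ge[OF that x, of j] j that by (simp add: op_eval_def field_simps)
  then show "\<exists>q\<in>snorms FV. \<exists>C>0. \<forall>f\<in>vecs FV. norm (op_eval FV D m x f) \<le> C * q f"
    using j by (intro bexI[of _ "nrm j m"] exI[of _ "1 / \<nu> j m x"]) (auto simp: snorms_FV)
qed (simp add: op_eval_def)

lemma pt_eval_dual: "pt_eval FV x \<in> dual FV"
proof -
  have "continuous_map (lcs_topology FV) euclidean (\<lambda>f. f x)" using gen by (simp add: generator_def)
  then have "continuous_map (lcs_topology FV) euclidean (pt_eval FV x)"
    by (rule continuous_map_eq) (simp add: pt_eval_def)
  then show ?thesis
    using F.V_add F.V_scale by (simp add: dual_def pt_eval_def linear_on_def FV_space_simps(1) pointwise_def)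
qed

lemma compact_transpose: "f \<in> vecs FVE \<Longrightarrow> compact_transpose s p FV f"
  using gen kappa pt_eval_dual
  by unfold_locales (auto simp: generator_def FV_space_simps(1))

text \<open>The supremum of \<open>p \<alpha>\<close> composed with \<open>u\<close> over this
  equicontinuous set is exactly a weighted seminorm of \<open>S u\<close>. This links the two
  topologies.\<close>

definition weighted_evals :: "'j \<Rightarrow> 'm \<Rightarrow> (('x \<Rightarrow> 'k) \<Rightarrow> 'k) set" where
  "weighted_evals j m = (\<lambda>x. scl (kappa_dual FV) (of_real (\<nu> j m x)) (op_eval FV D m x)) ` \<omega> m"

lemma equicontinuous_weighted_evals: "equicontinuous FV (weighted_evals j m)"
  unfolding equicontinuous_def
proof (intro conjI allI impI)
  show "weighted_evals j m \<subseteq> dual FV"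
    unfolding weighted_evals_def using k.V_scale op_eval_dual by auto
  fix \<epsilon> :: real assume \<epsilon>: "\<epsilon> > 0"
  have q: "nrm j m \<in> snorms FV" by (auto simp: snorms_FV)
  have "norm (y f) \<le> nrm j m f" if "y \<in> weighted_evals j m" "f \<in> vecs FV" for y f
    using that nrm_ge[OF that(2), of _ m j] \<nu>_nonneg
    by (auto simp: weighted_evals_def op_eval_def norm_mult mult.commute)
  then show "\<exists>U. openin (lcs_topology FV) U \<and> 0 \<in> U \<and> (\<forall>y\<in>weighted_evals j m. \<forall>x\<in>U. norm (y x) < \<epsilon>)"
    using F.openin_ball[OF q F.V_0, of \<epsilon>] F.V_0 F.seminorm_on_0[OF F.snorm[OF q]] \<epsilon>
    by (intro exI[of _ "{f \<in> vecs FV. nrm j m (f - 0) < \<epsilon>}"]) (force intro: le_less_trans)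
qed

lemma nrm_comp_le:
  assumes f: "f \<in> vecs FVE" and e': "e' \<in> dual E"
    and B: "\<And>x. x \<in> \<omega> m \<Longrightarrow> norm (e' (fd_op DE m f x)) * \<nu> j m x \<le> B"
  shows "nrm j m (e' \<circ> f) \<le> B"
  unfolding nrm_def using B strong f e' by (intro cSUP_least \<omega>_nonempty) (simp add: strong_def)

lemma nrm_comp_polar_le:
  assumes f: "f \<in> vecs FVE" and e': "e' \<in> polar_ball s p \<alpha>"
  shows "nrm j m (e' \<circ> f) \<le> nrmE \<alpha> j m f"
proof (rule nrm_comp_le[OF f polar_dual[OF e']])
  fix x assume x: "x \<in> \<omega> m"
  show "norm (e' (fd_op DE m f x)) * \<nu> j m x \<le> nrmE \<alpha> j m f"
    using nrmE_ge[OF f x, of \<alpha> j] mult_right_mono[OF polar_le[OF e'] \<nu>_nonneg[OF x], of "fd_op DE m f x" j]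
    by linarith
qed

text \<open>The functional \<open>y\<close> is dominated by one weighted seminorm, and for
  \<open>e' \<circ> f\<close> that seminorm is at most any bound of \<open>e'\<close> on
  \<open>K\<close>, because \<open>K\<close> contains the weighted values of
  \<open>f\<close>.\<close>

lemma represented_if_weakly_compact:
  assumes f: "f \<in> vecs FVE" and y: "y \<in> dual FV"
    and K: "\<And>j m. \<exists>K. abs_convex E K \<and> compactin (weak_topology E) K \<and> N_set \<omega> \<nu> s DE j m f \<subseteq> K"
  shows "\<exists>e. \<forall>e'\<in>dual E. y (e' \<circ> f) = e' e"
proof -
  interpret f: compact_transpose s p FV f by (rule compact_transpose[OF f])
  obtain q C where q: "q \<in> snorms FV" "C > 0" "\<And>g. g \<in> vecs FV \<Longrightarrow> norm (y g) \<le> C * q g"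
    using F.dual_bound[OF y] by blast
  obtain j m where "q = nrm j m" using q(1) unfolding snorms_FV by blast
  note C = q(2,3)[unfolded this]
  obtain K where K: "abs_convex E K" "compactin (weak_topology E) K" "N_set \<omega> \<nu> s DE j m f \<subseteq> K"
    using K by blast
  have "\<exists>e\<in>vecs E. \<forall>e'\<in>dual E. y (e' \<circ> f) = e' e"
  proof (rule compact_representation[OF E.subspace_of_axioms K(2,1) E.subspace_dual E.dual_linear
        E.dual_weakly_continuous f.transpose_linear[OF y] C(1)])
    fix e' B assume e': "e' \<in> dual E" and B: "\<And>x. x \<in> K \<Longrightarrow> norm (e' x) \<le> B"
    have "nrm j m (e' \<circ> f) \<le> B"
    proof (rule nrm_comp_le[OF f e'])
      fix x assume x: "x \<in> \<omega> m"
      have "s (of_real (\<nu> j m x)) (fd_op DE m f x) \<in> K" using K(3) x by (auto simp: N_set_def)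
      from B[OF this] show "norm (e' (fd_op DE m f x)) * \<nu> j m x \<le> B"
        using \<nu>_nonneg[OF x, of j] by (simp add: dual_scale[OF e'] norm_mult mult.commute)
    qed
    then show "norm (y (e' \<circ> f)) \<le> C * B"
      using C(2)[OF f.comp_in_F[OF e']] C(1) mult_left_mono[of "nrm j m (e' \<circ> f)" B C] by linarith
  qed
  then show ?thesis by auto
qed

section \<open>The epsilon-product and the map S\<close>

lemma eps_vecs_iff:
  "u \<in> vecs (eps_product FV E) \<longleftrightarrow> linear_on (dual FV) (scl (kappa_dual FV)) s u \<and>
    continuous_map (lcs_topology (kappa_dual FV)) (lcs_topology E) u \<and> (\<forall>y. y \<notin> dual FV \<longrightarrow> u y = 0)"
  by (simp add: eps_product_def)

lemma eps_snorms: "snorms (eps_product FV E) =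
    {\<lambda>u. SUP y\<in>H. p \<alpha> (u y) | H \<alpha>. H \<noteq> {} \<and> equicontinuous FV H}"
  unfolding eps_product_def by (simp add: image_iff) blast

lemma eps_bound:
  assumes "u \<in> vecs (eps_product FV E)"
  shows "\<exists>q\<in>snorms (kappa_dual FV). \<exists>C>0. \<forall>y\<in>dual FV. p \<alpha> (u y) \<le> C * q y"
  using k.continuous_map_imp_bounded[OF E.lc_space_axioms, of u "p \<alpha>"] assms eps_vecs_iff by auto

lemma eps_diff:
  assumes u: "u \<in> vecs (eps_product FV E)" and v: "v \<in> vecs (eps_product FV E)"
  shows "u - v \<in> vecs (eps_product FV E)"
proof -
  have lin: "linear_on (dual FV) (scl (kappa_dual FV)) s (u - v)"
    using u v E.scale_right_diff_distrib unfolding eps_vecs_iff linear_on_def by (simp add: algebra_simps)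
  have "continuous_map (lcs_topology (kappa_dual FV)) (lcs_topology E) (u - v)"
  proof (rule bounded_imp_continuous_map[OF k.V_diff])
    fix x y assume xy: "x \<in> vecs (kappa_dual FV)" "y \<in> vecs (kappa_dual FV)"
    then show "(u - v) (x - y) = (u - v) x - (u - v) y"
      using linear_on_add[OF lin, of "x - y" y] k.V_diff[OF xy] by simp
  next
    fix r assume "r \<in> snorms E"
    then obtain \<alpha> where r: "r = p \<alpha>" by auto
    obtain q C where q: "q \<in> snorms (kappa_dual FV)" "C > 0" "\<forall>y\<in>dual FV. p \<alpha> (u y) \<le> C * q y"
      using eps_bound[OF u] by blast
    obtain q' C' where q': "q' \<in> snorms (kappa_dual FV)" "C' > 0" "\<forall>y\<in>dual FV. p \<alpha> (v y) \<le> C' * q' y"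
      using eps_bound[OF v] by blast
    obtain t A where t: "t \<in> snorms (kappa_dual FV)" "A > 0" "\<forall>r\<in>{q, q'}. \<forall>y\<in>dual FV. r y \<le> A * t y"
      using k.finite_dominated[of "{q, q'}"] q(1) q'(1) by auto
    have "p \<alpha> ((u - v) y) \<le> ((C + C') * A) * t y" if y: "y \<in> dual FV" for y
    proof -
      have "p \<alpha> ((u - v) y) \<le> p \<alpha> (u y) + p \<alpha> (v y)"
        using E.seminorm_on_diff[of "p \<alpha>" "u y" "v y"] p_seminorm by simp
      also have "\<dots> \<le> C * q y + C' * q' y" using q(3) q'(3) y by (intro add_mono) auto
      also have "\<dots> \<le> C * (A * t y) + C' * (A * t y)"
        using t(3) q(2) q'(2) y by (intro add_mono mult_left_mono) auto
      finally show ?thesis by (simp add: algebra_simps)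
    qed
    moreover have "(C + C') * A > 0" using q(2) q'(2) t(2) by simp
    ultimately show "\<exists>q\<in>snorms (kappa_dual FV). \<exists>C>0. \<forall>x\<in>vecs (kappa_dual FV). r ((u - v) x) \<le> C * q x"
      unfolding r using t(1) by (intro bexI[of _ t] exI[of _ "(C + C') * A"]) auto
  qed auto
  then show ?thesis using lin u v unfolding eps_vecs_iff by simp
qed

text \<open>Since \<open>e' \<circ> u\<close> is continuous on \<open>FV'\<close> with the topology of compact convergence, it is the
  evaluation at an element of \<open>FV\<close>, which must be \<open>e' \<circ> S u\<close>.\<close>

lemma eps_dual:
  assumes u: "u \<in> vecs (eps_product FV E)" and e': "e' \<in> dual E"
  shows "e' \<circ> S_map FV u \<in> vecs FV" "\<And>y. y \<in> dual FV \<Longrightarrow> e' (u y) = y (e' \<circ> S_map FV u)"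
proof -
  have lin: "linear_on (dual FV) (\<lambda>c y x. c * y x) (*) (\<lambda>y. e' (u y))"
    using u e' unfolding eps_vecs_iff linear_on_def by (simp add: dual_add dual_scale)
  obtain \<alpha> A where A: "A > 0" "\<And>x. norm (e' x) \<le> A * p \<alpha> x" using e' dual_E_iff by blast
  obtain q C where q: "q \<in> snorms (kappa_dual FV)" "C > 0" "\<forall>y\<in>dual FV. p \<alpha> (u y) \<le> C * q y"
    using eps_bound[OF u] by blast
  have "norm (e' (u y)) \<le> (A * C) * q y" if "y \<in> dual FV" for y
    using order_trans[OF A(2) mult_left_mono[OF q(3)[rule_format, OF that], of A]] A(1)
    by (simp only: mult.assoc less_imp_le)
  then obtain g where g: "g \<in> vecs FV" "\<And>y. y \<in> dual FV \<Longrightarrow> e' (u y) = y g"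
    using F.kappa_dual_representation[OF lin q(1), of "A * C"] A(1) q(2) by auto
  \<comment> \<open>Point evaluations lie in the dual, so they identify the function
    \<open>g\<close> that Mackey--Arens provides.\<close>
  have "e' \<circ> S_map FV u = g"
    using g(2)[OF pt_eval_dual] g(1) by (simp add: fun_eq_iff S_map_def pt_eval_def)
  then show "e' \<circ> S_map FV u \<in> vecs FV" "\<And>y. y \<in> dual FV \<Longrightarrow> e' (u y) = y (e' \<circ> S_map FV u)"
    using g by auto
qed

lemma eps_bdd_above:
  assumes u: "u \<in> vecs (eps_product FV E)" and H: "equicontinuous FV H"
  shows "bdd_above ((\<lambda>y. p \<alpha> (u y)) ` H)"
proof -
  obtain q C where q: "q \<in> snorms (kappa_dual FV)" "C > 0" "\<forall>y\<in>dual FV. p \<alpha> (u y) \<le> C * q y"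
    using eps_bound[OF u] by blast
  obtain M where M: "\<And>y. y \<in> H \<Longrightarrow> q y \<le> M"
    using F.kappa_snorm_bdd_above_equicontinuous[OF H q(1)] unfolding bdd_above_def by blast
  have "p \<alpha> (u y) \<le> C * M" if "y \<in> H" for y
    using q(3) M[OF that] mult_left_mono[of "q y" M C] q(2) that H unfolding equicontinuous_def
    by (meson order_trans less_imp_le subsetD)
  then show ?thesis by (intro bdd_aboveI2)
qed

lemma weighted_op_S_map:
  assumes u: "u \<in> vecs (eps_product FV E)" and x: "x \<in> \<omega> m"
  shows "p \<alpha> (fd_op DE m (S_map FV u) x) * \<nu> j m x =
    p \<alpha> (u (scl (kappa_dual FV) (of_real (\<nu> j m x)) (op_eval FV D m x)))"
proof -
  have "fd_op DE m (S_map FV u) x = u (op_eval FV D m x)"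
    using consistent u x unfolding consistent_def Let_def by blast
  moreover have "u (scl (kappa_dual FV) (of_real (\<nu> j m x)) (op_eval FV D m x)) =
      s (of_real (\<nu> j m x)) (u (op_eval FV D m x))"
    using u op_eval_dual[OF x] unfolding eps_vecs_iff linear_on_def by blast
  ultimately show ?thesis using \<nu>_nonneg[OF x, of j] by (simp add: p_scale mult.commute)
qed

lemma S_map_in_FVE:
  assumes u: "u \<in> vecs (eps_product FV E)"
  shows "S_map FV u \<in> vecs FVE"
    and "nrmE \<alpha> j m (S_map FV u) = (SUP y\<in>weighted_evals j m. p \<alpha> (u y))"
proof -
  have img: "(\<lambda>x. p \<alpha> (fd_op DE m (S_map FV u) x) * \<nu> j m x) ` \<omega> m = (\<lambda>y. p \<alpha> (u y)) ` weighted_evals j m"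
    for \<alpha> j m
    unfolding weighted_evals_def image_image using weighted_op_S_map[OF u] by (intro image_cong) auto
  have "S_map FV u \<in> F_space DE" using consistent u unfolding consistent_def Let_def by blast
  then show "S_map FV u \<in> vecs FVE"
    by (simp add: FV_space_simps img eps_bdd_above[OF u equicontinuous_weighted_evals])
  show "nrmE \<alpha> j m (S_map FV u) = (SUP y\<in>weighted_evals j m. p \<alpha> (u y))"
    unfolding nrmE_def img ..
qed

text \<open>Equicontinuity bounds \<open>H\<close> by one scalar weighted seminorm. Applied to
  \<open>e' \<circ> S u\<close> for \<open>e'\<close> in a polar, strength turns it into a weighted
  seminorm of \<open>S u\<close>. The constant and the indices do not depend on \<open>u\<close>,
  which makes the inverse of \<open>S\<close> continuous.\<close>

lemma eps_snorm_le:
  assumes H: "H \<noteq> {}" "equicontinuous FV H"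
  obtains j m C where "C > 0"
    "\<And>u. u \<in> vecs (eps_product FV E) \<Longrightarrow> (SUP y\<in>H. p \<alpha> (u y)) \<le> C * nrmE \<alpha> j m (S_map FV u)"
proof -
  obtain q C where q: "q \<in> snorms FV" "C > 0" "\<And>y g. y \<in> H \<Longrightarrow> g \<in> vecs FV \<Longrightarrow> norm (y g) \<le> C * q g"
    using F.equicontinuous_bound[OF H(2)] by blast
  obtain j m where "q = nrm j m" using q(1) unfolding snorms_FV by blast
  note C = q(2,3)[unfolded this]
  have "(SUP y\<in>H. p \<alpha> (u y)) \<le> C * nrmE \<alpha> j m (S_map FV u)" if u: "u \<in> vecs (eps_product FV E)" for u
  proof (intro cSUP_least H(1) p_le_polar)
    fix y e' assume y: "y \<in> H" and e': "e' \<in> polar_ball s p \<alpha>"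
    have yF: "y \<in> dual FV" using H(2) y unfolding equicontinuous_def by blast
    note ed = eps_dual[OF u polar_dual[OF e']]
    have "norm (e' (u y)) = norm (y (e' \<circ> S_map FV u))" using ed(2)[OF yF] by simp
    also have "\<dots> \<le> C * nrm j m (e' \<circ> S_map FV u)" by (rule C(2)[OF y ed(1)])
    also have "\<dots> \<le> C * nrmE \<alpha> j m (S_map FV u)"
      using nrm_comp_polar_le[OF S_map_in_FVE(1)[OF u] e'] C(1) by (intro mult_left_mono) auto
    finally show "norm (e' (u y)) \<le> C * nrmE \<alpha> j m (S_map FV u)" .
  qed
  then show ?thesis using C(1) that by blast
qed

text \<open>By \<open>eps_dual\<close> the vector \<open>u y\<close> represents \<open>y\<close>
  with respect to \<open>S u\<close>, and representers are unique.\<close>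

lemma Rt_map_S_map:
  assumes u: "u \<in> vecs (eps_product FV E)"
  shows "Rt_map FV E (S_map FV u) = u"
proof
  fix y
  interpret f: compact_transpose s p FV "S_map FV u" by (rule compact_transpose[OF S_map_in_FVE(1)[OF u]])
  show "Rt_map FV E (S_map FV u) y = u y"
  proof (cases "y \<in> dual FV")
    case True
    have "f.represents y (u y)" unfolding f.represents_def using eps_dual(2)[OF u _ True] by simp
    then show ?thesis by (rule f.Rt_map_eq[OF True])
  next
    case False
    then show ?thesis using u unfolding eps_vecs_iff by (simp add: Rt_map_def)
  qed
qed

theorem eps_compatible_if_represented:
  assumes rep: "\<And>f y. f \<in> vecs FVE \<Longrightarrow> y \<in> dual FV \<Longrightarrow> \<exists>e. \<forall>e'\<in>dual E. y (e' \<circ> f) = e' e"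
  shows "eps_compatible FV FVE E
     \<and> (\<forall>f\<in>vecs FVE. \<forall>f'\<in>dual FV. Rt_dual E f f' \<in> range (canon_inj E))
     \<and> (\<forall>f\<in>vecs FVE. Rt_map FV E f \<in> vecs (eps_product FV E) \<and> S_map FV (Rt_map FV E f) = f)
     \<and> (\<forall>u\<in>vecs (eps_product FV E). Rt_map FV E (S_map FV u) = u)"
proof -
  have range: "Rt_dual E f y \<in> range (canon_inj E)" if f: "f \<in> vecs FVE" and y: "y \<in> dual FV" for f y
  proof -
    interpret f: compact_transpose s p FV f by (rule compact_transpose[OF f])
    show ?thesis unfolding f.Rt_dual_in_range_iff f.represents_def by (rule rep[OF f y])
  qed
  have R: "Rt_map FV E f \<in> vecs (eps_product FV E)" "S_map FV (Rt_map FV E f) = f" if f: "f \<in> vecs FVE" for f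
  proof -
    interpret f: compact_transpose s p FV f by (rule compact_transpose[OF f])
    show "Rt_map FV E f \<in> vecs (eps_product FV E)" "S_map FV (Rt_map FV E f) = f"
      using rep[OF f] by (intro f.Rt_map_in_eps_product; simp add: f.represents_def)+
  qed
  have cS: "continuous_map (lcs_topology (eps_product FV E)) (lcs_topology FVE) (S_map FV)"
  proof (rule bounded_imp_continuous_map[OF eps_diff S_map_in_FVE(1)])
    show "S_map FV (u - v) = S_map FV u - S_map FV v" for u v :: "(('x \<Rightarrow> 'k) \<Rightarrow> 'k) \<Rightarrow> 'e"
      by (simp add: S_map_def fun_eq_iff)
    fix r assume "r \<in> snorms FVE"
    then obtain \<alpha> j m where r: "r = nrmE \<alpha> j m" unfolding snorms_FVE by blast
    have "(\<lambda>u. SUP y\<in>weighted_evals j m. p \<alpha> (u y)) \<in> snorms (eps_product FV E)"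
      unfolding eps_snorms using equicontinuous_weighted_evals \<omega>_nonempty
      by (auto simp: weighted_evals_def)
    then show "\<exists>q\<in>snorms (eps_product FV E). \<exists>C>0. \<forall>u\<in>vecs (eps_product FV E). r (S_map FV u) \<le> C * q u"
      unfolding r by (rule bexI[rotated]) (auto simp: S_map_in_FVE(2) intro!: exI[of _ 1])
  qed
  have cR: "continuous_map (lcs_topology FVE) (lcs_topology (eps_product FV E)) (Rt_map FV E)"
  proof (rule bounded_imp_continuous_map[OF FE.V_diff R(1)])
    fix f g assume fg: "f \<in> vecs FVE" "g \<in> vecs FVE"
    \<comment> \<open>Additivity of the inverse is inherited from \<open>S\<close>: both sides have
      the same image, and \<open>Rt_map_S_map\<close> cancels \<open>S\<close>.\<close>
    have "S_map FV (Rt_map FV E f - Rt_map FV E g) = S_map FV (Rt_map FV E f) - S_map FV (Rt_map FV E g)"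
      by (simp add: S_map_def fun_eq_iff)
    then show "Rt_map FV E (f - g) = Rt_map FV E f - Rt_map FV E g"
      using Rt_map_S_map[OF eps_diff[OF R(1)[OF fg(1)] R(1)[OF fg(2)]]] R(2)[OF fg(1)] R(2)[OF fg(2)] by simp
  next
    fix r assume "r \<in> snorms (eps_product FV E)"
    then obtain H \<alpha> where r: "r = (\<lambda>u. SUP y\<in>H. p \<alpha> (u y))" "H \<noteq> {}" "equicontinuous FV H"
      unfolding eps_snorms by blast
    obtain j m C where C: "C > 0"
      "\<And>u. u \<in> vecs (eps_product FV E) \<Longrightarrow> (SUP y\<in>H. p \<alpha> (u y)) \<le> C * nrmE \<alpha> j m (S_map FV u)"
      by (rule eps_snorm_le[OF r(2,3)]) (rule that)
    have "r (Rt_map FV E f) \<le> C * nrmE \<alpha> j m f" if "f \<in> vecs FVE" for f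
      using C(2)[OF R(1)[OF that]] R(2)[OF that] by (simp add: r(1))
    moreover have "nrmE \<alpha> j m \<in> snorms FVE" unfolding snorms_FVE by blast
    ultimately show "\<exists>q\<in>snorms FVE. \<exists>C>0. \<forall>f\<in>vecs FVE. r (Rt_map FV E f) \<le> C * q f"
      using C(1) by blast
  qed
  have "homeomorphic_maps (lcs_topology (eps_product FV E)) (lcs_topology FVE) (S_map FV) (Rt_map FV E)"
    unfolding homeomorphic_maps_def using cS cR Rt_map_S_map R(2) by simp
  then have "homeomorphic_map (lcs_topology (eps_product FV E)) (lcs_topology FVE) (S_map FV)"
    unfolding homeomorphic_map_maps by blast
  moreover have "linear_on (vecs (eps_product FV E)) (scl (eps_product FV E)) (scl FVE) (S_map FV)"
    by (simp add: linear_on_def S_map_def FV_space_simps(1) pointwise_def eps_product_def fun_eq_iff)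
  ultimately have "eps_compatible FV FVE E" by (simp add: eps_compatible_def lcs_isomorphism_def)
  then show ?thesis using range R Rt_map_S_map by blast
qed

end

theorem theorem3p2p4:
  fixes s :: "'k::real_or_complex \<Rightarrow> 'e::ab_group_add \<Rightarrow> 'e"
    and p :: "'a \<Rightarrow> 'e \<Rightarrow> real"
    and \<omega> :: "'m \<Rightarrow> 'w set"
    and \<nu> :: "'j \<Rightarrow> 'm \<Rightarrow> 'w \<Rightarrow> real"
    and DE :: "('x, 'e, 'm, 'w) fun_data"
    and D :: "('x, 'k, 'm, 'w) fun_data"
  defines "E \<equiv> lcs_of s p"
    and "FV \<equiv> FV_scalar \<omega> \<nu> D"
    and "FVE \<equiv> FV_space s p \<omega> \<nu> DE"
  assumes "lcHs E"
    and "generator s p \<omega> \<nu> DE D"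
    and "strong s p \<omega> \<nu> DE D"
    and "consistent s p \<omega> \<nu> DE D"
    and "vecs FVE \<subseteq> FV_kappa FV s p"
    and "lcs_complete E
       \<or> (lcs_quasi_complete E \<and>
          (\<forall>f\<in>vecs FVE. \<forall>f'\<in>dual FV.
             \<exists>(I :: 't set) le g. directed_set I le \<and> g ` I \<subseteq> dual FV \<and>
               lcs_bounded (kappa_dual FV) (g ` I) \<and>
               net_converges (lcs_topology (kappa_dual FV)) I le g f' \<and>
               (\<forall>\<tau>\<in>I. Rt_dual E f (g \<tau>) \<in> range (canon_inj E))))
       \<or> (lcs_seq_complete E \<and>
          (\<forall>f\<in>vecs FVE. \<forall>f'\<in>dual FV.
             \<exists>g::nat \<Rightarrow> _. range g \<subseteq> dual FV \<and>
               limitin (lcs_topology (kappa_dual FV)) g f' sequentially \<and>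
               (\<forall>n. Rt_dual E f (g n) \<in> range (canon_inj E))))
       \<or> (locally_complete E \<and>
          (\<forall>f\<in>vecs FVE. \<forall>f'\<in>dual FV.
             \<exists>g::nat \<Rightarrow> _. range g \<subseteq> dual FV \<and>
               locally_converges (kappa_dual FV) g f' \<and>
               (\<forall>n. Rt_dual E f (g n) \<in> range (canon_inj E))))
       \<or> (\<forall>f\<in>vecs FVE. \<forall>j m.
             \<exists>K. abs_convex E K \<and> compactin (weak_topology E) K \<and> N_set \<omega> \<nu> s DE j m f \<subseteq> K)"
  shows "eps_compatible FV FVE E
     \<and> (\<forall>f\<in>vecs FVE. \<forall>f'\<in>dual FV. Rt_dual E f f' \<in> range (canon_inj E))
     \<and> (\<forall>f\<in>vecs FVE. Rt_map FV E f \<in> vecs (eps_product FV E) \<and> S_map FV (Rt_map FV E f) = f)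
     \<and> (\<forall>u\<in>vecs (eps_product FV E). Rt_map FV E (S_map FV u) = u)"
proof -
  interpret W: weighted_spaces s p \<omega> \<nu> DE D
    using assms(4-8) unfolding E_def FV_def FVE_def by unfold_locales
  have "\<exists>e. \<forall>e'\<in>dual E. y (e' \<circ> f) = e' e" if f: "f \<in> vecs FVE" and y: "y \<in> dual FV" for f y
  proof -
    interpret f: compact_transpose s p FV f
      unfolding FV_def using f unfolding FVE_def by (rule W.compact_transpose)
    \<comment> \<open>The hypotheses speak of the range of the canonical injection; these
      equivalences restate them as the existence of representing vectors.\<close>
    note [folded E_def] = f.Rt_dual_in_range_iff f.represents_def
    note rep = this
    have "\<exists>e. f.represents y e"
      using assms(9)
    proof (elim disjE)
      assume "lcs_complete E"
      then show ?thesis unfolding E_def by (rule f.represented_if_complete[OF _ y])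
    next
      assume "lcs_quasi_complete E \<and>
          (\<forall>f\<in>vecs FVE. \<forall>f'\<in>dual FV.
             \<exists>(I :: 't set) le g. directed_set I le \<and> g ` I \<subseteq> dual FV \<and>
               lcs_bounded (kappa_dual FV) (g ` I) \<and>
               net_converges (lcs_topology (kappa_dual FV)) I le g f' \<and>
               (\<forall>\<tau>\<in>I. Rt_dual E f (g \<tau>) \<in> range (canon_inj E)))"
      note h = this
      from bspec[OF bspec[OF conjunct2[OF h] f] y] obtain I :: "'t set" and le g where
        "directed_set I le \<and> g ` I \<subseteq> dual FV \<and> lcs_bounded (kappa_dual FV) (g ` I) \<and>
          net_converges (lcs_topology (kappa_dual FV)) I le g y \<and>
          (\<forall>\<tau>\<in>I. Rt_dual E f (g \<tau>) \<in> range (canon_inj E))"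
        by (elim exE)
      then have "lcs_quasi_complete E" "directed_set I le" "g ` I \<subseteq> dual FV"
        "lcs_bounded (kappa_dual FV) (g ` I)" "net_converges (lcs_topology (kappa_dual FV)) I le g y"
        "\<And>\<tau>. \<tau> \<in> I \<Longrightarrow> Rt_dual E f (g \<tau>) \<in> range (canon_inj E)"
        using conjunct1[OF h] by (elim conjE; simp)+
      then show ?thesis
        unfolding rep(1) unfolding E_def by (intro f.represented_if_quasi_complete[OF _ y])
    next
      assume "lcs_seq_complete E \<and>
          (\<forall>f\<in>vecs FVE. \<forall>f'\<in>dual FV.
             \<exists>g::nat \<Rightarrow> _. range g \<subseteq> dual FV \<and>
               limitin (lcs_topology (kappa_dual FV)) g f' sequentially \<and>
               (\<forall>n. Rt_dual E f (g n) \<in> range (canon_inj E)))"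
      with f y obtain g :: "nat \<Rightarrow> _" where "lcs_seq_complete E" "range g \<subseteq> dual FV"
        "limitin (lcs_topology (kappa_dual FV)) g y sequentially"
        "\<And>n. Rt_dual E f (g n) \<in> range (canon_inj E)"
        by blast
      then show ?thesis
        unfolding rep(1) unfolding E_def by (intro f.represented_if_seq_complete[OF _ y])
    next
      assume "locally_complete E \<and>
          (\<forall>f\<in>vecs FVE. \<forall>f'\<in>dual FV.
             \<exists>g::nat \<Rightarrow> _. range g \<subseteq> dual FV \<and>
               locally_converges (kappa_dual FV) g f' \<and>
               (\<forall>n. Rt_dual E f (g n) \<in> range (canon_inj E)))"
      with f y obtain g :: "nat \<Rightarrow> _" where "locally_complete E" "range g \<subseteq> dual FV"
        "locally_converges (kappa_dual FV) g y"
        "\<And>n. Rt_dual E f (g n) \<in> range (canon_inj E)"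
        by blast
      then show ?thesis
        unfolding rep(1) unfolding E_def by (intro f.represented_if_locally_complete[OF _ y])
    next
      assume "\<forall>f\<in>vecs FVE. \<forall>j m.
          \<exists>K. abs_convex E K \<and> compactin (weak_topology E) K \<and> N_set \<omega> \<nu> s DE j m f \<subseteq> K"
      then show ?thesis
        unfolding rep(2) using W.represented_if_weakly_compact f y unfolding E_def FV_def FVE_def by blast
    qed
    then show ?thesis unfolding rep(2) .
  qed
  then show ?thesis
    unfolding E_def FV_def FVE_def by (rule W.eps_compatible_if_represented)
qed

end
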